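(* Let $R_j\equiv(r_j,\mathsf{c}_{I_j})$ ($j=1,2,3$) be three linear rules with application conditions. Then there exists a bijection between the sets of pairs of admissible matches $M_A$ and $M_B$ defined as \[ \begin{aligned} M_A&:=\{(\mu_{21},\mu_{3(21)})\mid \mu_{21}\in M_{R_2}(R_1)\,,\; \mu_{3(21)}\in M_{R_3}(R_{21})\}\\ M_B&:=\{(\mu_{32},\mu_{(32)1})\mid \mu_{32}\in M_{R_3}(R_2)\,,\; \mu_{(32)1}\in M_{R_{32}}(R_{1})\} \end{aligned} \] with $R_{ij}:=(r_i\,{}^{\mu_{ij}}\!\circ\, r_j,\mathsf{c}_{I_{ij}})$, where $r_i\,{}^{\mu_{ij}}\!\circ\, r_j$ denotes the DPO-type composite of the underlying plain rules along $\mu_{ij}$ and $\mathsf{c}_{I_{ij}}$ is the composite application condition (both as described in the context), such that \[ \begin{aligned} \forall (\mu_{21},\mu_{3(21)})\in M_A: \exists! (\mu_{32},\mu_{(32)1})&\in M_B:\\ r_3\,{}^{\mu_{3(21)}}\!\circ\left(r_2\,{}^{\mu_{21}}\!\circ\, r_1\right)&\cong \left(r_3\,{}^{\mu_{32}}\!\circ\, r_2\right){}^{\mu_{(32)1}}\!\circ\, r_1\\ \land \quad\mathsf{c}_{I_{3(21)}}&\;\dot{\equiv}\; \mathsf{c}_{I_{(32)1}} \end{aligned} \] and vice versa. In this sense, the composition operation of rules with conditions is associative.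
   Context: Let $\mathbf{C}$ be an $\mathcal{M}$-adhesive category, with $\mathcal{M}$ a class of monomorphisms, which possesses an epi-$\mathcal{M}$-factorization, is balanced, has a strict $\mathcal{M}$-initial object $\varnothing$ and $\mathcal{M}$-effective unions (objects are finite). A linear rule is (an isomorphism class of) a span $r=(O\xleftarrow{o}K\xrightarrow{i}I)$ of $\mathcal{M}$-morphisms; a linear rule with application condition is a pair $R=(r,\mathsf{c}_I)$ with $\mathsf{c}_I$ a (nested) condition over $I$. For an $\mathcal{M}$-morphism $p:P\to Q$ and a condition $\mathsf{c}_P$ over $P$, $\mathsf{Shift}(p,\mathsf{c}_P)$ is the condition over $Q$ characterized by $n\vDash\mathsf{Shift}(p,\mathsf{c}_P)\Leftrightarrow n\circ p\vDash \mathsf{c}_P$ for all $\mathcal{M}$-morphisms $n$ out of $Q$. For a linear rule $r=(O\leftarrow K\rightarrow I)$ and a condition $\mathsf{c}_O$ over $O$, $\mathsf{Trans}(r,\mathsf{c}_O)$ is the transported condition over $I$, characterized by: for every DPO-admissible match $m:I\to X$ (an $\mathcal{M}$-morphism for which the pushout complement of $K\to I\to X$ exists) with comatch $m^*:O\to r_m(X)$, $m^*\vDash\mathsf{c}_O\Leftrightarrow m\vDash\mathsf{Trans}(r,\mathsf{c}_O)$. DPO-type composition of rules with conditions: given $R_j=(r_j,\mathsf{c}_{I_j})$, $r_j=(O_j\leftarrow K_j\rightarrow I_j)$ ($j=1,2$), and a span of $\mathcal{M}$-morphisms $\mu_{21}=(I_2\xleftarrow{m_2}M_{21}\xrightarrow{m_1}O_1)$,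 form the pushout $N_{21}$ of $\mu_{21}$ (with $m_2':I_2\to N_{21}$, $m_1':O_1\to N_{21}$), the pushout complements $K_1'$ of $K_1\to O_1\to N_{21}$ and $K_2'$ of $K_2\to I_2\to N_{21}$, the pushouts $O_{21}$ of $O_2\leftarrow K_2\rightarrow K_2'$ and $I_{21}$ of $K_1'\leftarrow K_1\rightarrow I_1$ (with $p_1:I_1\to I_{21}$), and the pullback $K_{21}$ of $K_2'\rightarrow N_{21}\leftarrow K_1'$. The composite plain rule is $r_2\,{}^{\mu_{21}}\!\circ\, r_1=(O_{21}\leftarrow K_{21}\rightarrow I_{21})$ and the composite condition is \[ \mathsf{c}_{I_{21}}:=\mathsf{Shift}(p_1,\mathsf{c}_{I_1})\;\wedge\;\mathsf{Trans}\big(N_{21}\leftarrow K_1'\rightarrow I_{21},\,\mathsf{Shift}(m_2',\mathsf{c}_{I_2})\big). \] $\mu_{21}$ is an admissible match, written $\mu_{21}\in M_{R_2}(R_1)$, iff the two pushout complements exist and $\mathsf{c}_{I_{21}}\not\equiv\mathsf{false}$; then $R_{21}=(O_{21}\leftarrow K_{21}\rightarrow I_{21},\mathsf{c}_{I_{21}})$. For conditions $\mathsf{c}_I,\tilde{\mathsf{c}}_I$ over the input $I$ of a linear rule $r$, $\mathsf{c}_I\,\dot{\equiv}\,\tilde{\mathsf{c}}_I$ means: for all objects $X$ and all DPO-admissible matches $m$ of $r$ into $X$, $m\vDash\mathsf{c}_I\Leftrightarrow m\vDash\tilde{\mathsf{c}}_I$.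
   Formalization: The "∃!" is read as the partner given by the bijection: corresponding pairs have isomorphic composites and equivalent conditions. Uniqueness among all pairs in M_B with an isomorphic composite fails already in finite sets and is not claimed. Matches are spans up to isomorphism. *)

theory Defs
  imports Main
begin

section \<open>Categories\<close>

record ('o, 'm) category =
  Obj :: "'o set"
  Arr :: "'m set"
  Dom :: "'m \<Rightarrow> 'o"
  Cod :: "'m \<Rightarrow> 'o"
  Id :: "'o \<Rightarrow> 'm"
  Comp :: "'m \<Rightarrow> 'm \<Rightarrow> 'm"  (infixl "\<odot>\<index>" 70)

locale category =
  fixes C :: "('o, 'm) category" (structure)
  assumes dom_obj: "f \<in> Arr C \<Longrightarrow> Dom C f \<in> Obj C"
    and cod_obj: "f \<in> Arr C \<Longrightarrow> Cod C f \<in> Obj C"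
    and id_arr: "X \<in> Obj C \<Longrightarrow> Id C X \<in> Arr C"
    and id_dom: "X \<in> Obj C \<Longrightarrow> Dom C (Id C X) = X"
    and id_cod: "X \<in> Obj C \<Longrightarrow> Cod C (Id C X) = X"
    and comp_arr: "\<lbrakk>f \<in> Arr C; g \<in> Arr C; Cod C f = Dom C g\<rbrakk> \<Longrightarrow> g \<odot> f \<in> Arr C"
    and comp_dom: "\<lbrakk>f \<in> Arr C; g \<in> Arr C; Cod C f = Dom C g\<rbrakk> \<Longrightarrow> Dom C (g \<odot> f) = Dom C f"
    and comp_cod: "\<lbrakk>f \<in> Arr C; g \<in> Arr C; Cod C f = Dom C g\<rbrakk> \<Longrightarrow> Cod C (g \<odot> f) = Cod C g"
    and id_right: "f \<in> Arr C \<Longrightarrow> f \<odot> Id C (Dom C f) = f"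
    and id_left: "f \<in> Arr C \<Longrightarrow> Id C (Cod C f) \<odot> f = f"
    and comp_assoc: "\<lbrakk>f \<in> Arr C; g \<in> Arr C; h \<in> Arr C; Cod C f = Dom C g; Cod C g = Dom C h\<rbrakk>
      \<Longrightarrow> (h \<odot> g) \<odot> f = h \<odot> (g \<odot> f)"

definition hom :: "('o, 'm) category \<Rightarrow> 'o \<Rightarrow> 'o \<Rightarrow> 'm set" where
  "hom C X Y = {f \<in> Arr C. Dom C f = X \<and> Cod C f = Y}"

definition is_mono :: "('o, 'm) category \<Rightarrow> 'm \<Rightarrow> bool" where
  "is_mono C f \<longleftrightarrow> f \<in> Arr C \<and>
    (\<forall>u\<in>Arr C. \<forall>v\<in>Arr C. Dom C u = Dom C v \<and> Cod C u = Dom C f \<and> Cod C v = Dom C f \<and>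
      f \<odot>\<^bsub>C\<^esub> u = f \<odot>\<^bsub>C\<^esub> v \<longrightarrow> u = v)"

definition is_epi :: "('o, 'm) category \<Rightarrow> 'm \<Rightarrow> bool" where
  "is_epi C f \<longleftrightarrow> f \<in> Arr C \<and>
    (\<forall>u\<in>Arr C. \<forall>v\<in>Arr C. Cod C u = Cod C v \<and> Dom C u = Cod C f \<and> Dom C v = Cod C f \<and>
      u \<odot>\<^bsub>C\<^esub> f = v \<odot>\<^bsub>C\<^esub> f \<longrightarrow> u = v)"

definition is_iso :: "('o, 'm) category \<Rightarrow> 'm \<Rightarrow> bool" where
  "is_iso C f \<longleftrightarrow> f \<in> Arr C \<and>
    (\<exists>g\<in>hom C (Cod C f) (Dom C f). g \<odot>\<^bsub>C\<^esub> f = Id C (Dom C f) \<and> f \<odot>\<^bsub>C\<^esub> g = Id C (Cod C f))"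

definition jointly_epic :: "('o, 'm) category \<Rightarrow> 'm \<Rightarrow> 'm \<Rightarrow> bool" where
  "jointly_epic C a b \<longleftrightarrow> a \<in> Arr C \<and> b \<in> Arr C \<and> Cod C a = Cod C b \<and>
    (\<forall>u\<in>Arr C. \<forall>v\<in>Arr C. Cod C u = Cod C v \<and> Dom C u = Cod C a \<and> Dom C v = Cod C a \<and>
      u \<odot>\<^bsub>C\<^esub> a = v \<odot>\<^bsub>C\<^esub> a \<and> u \<odot>\<^bsub>C\<^esub> b = v \<odot>\<^bsub>C\<^esub> b \<longrightarrow> u = v)"

text \<open>
  Squares are written \<open>f g h k\<close> with \<open>f : A \<rightarrow> B\<close>, \<open>g : A \<rightarrow> C\<close>, \<open>h : B \<rightarrow> D\<close>, \<open>k : C \<rightarrow> D\<close>; thus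
  \<open>(f, g)\<close> is the span, \<open>(h, k)\<close> the cospan, and \<open>k\<close> is opposite to \<open>f\<close>, \<open>h\<close> opposite to \<open>g\<close>.
\<close>

definition comm_square :: "('o, 'm) category \<Rightarrow> 'm \<Rightarrow> 'm \<Rightarrow> 'm \<Rightarrow> 'm \<Rightarrow> bool" where
  "comm_square C f g h k \<longleftrightarrow> f \<in> Arr C \<and> g \<in> Arr C \<and> h \<in> Arr C \<and> k \<in> Arr C \<and>
    Dom C f = Dom C g \<and> Cod C f = Dom C h \<and> Cod C g = Dom C k \<and> Cod C h = Cod C k \<and>
    h \<odot>\<^bsub>C\<^esub> f = k \<odot>\<^bsub>C\<^esub> g"

definition is_pushout :: "('o, 'm) category \<Rightarrow> 'm \<Rightarrow> 'm \<Rightarrow> 'm \<Rightarrow> 'm \<Rightarrow> bool" where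
  "is_pushout C f g h k \<longleftrightarrow> comm_square C f g h k \<and>
    (\<forall>h' k'. comm_square C f g h' k' \<longrightarrow>
      (\<exists>!u. u \<in> hom C (Cod C h) (Cod C h') \<and> u \<odot>\<^bsub>C\<^esub> h = h' \<and> u \<odot>\<^bsub>C\<^esub> k = k'))"

definition is_pullback :: "('o, 'm) category \<Rightarrow> 'm \<Rightarrow> 'm \<Rightarrow> 'm \<Rightarrow> 'm \<Rightarrow> bool" where
  "is_pullback C f g h k \<longleftrightarrow> comm_square C f g h k \<and>
    (\<forall>f' g'. comm_square C f' g' h k \<longrightarrow>
      (\<exists>!u. u \<in> hom C (Dom C f') (Dom C f) \<and> f \<odot>\<^bsub>C\<^esub> u = f' \<and> g \<odot>\<^bsub>C\<^esub> u = g'))"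

text \<open>The pushout complement of \<open>f : K \<rightarrow> O\<close> and \<open>h : O \<rightarrow> N\<close> consists of \<open>K \<rightarrow> K'\<close> and \<open>K' \<rightarrow> N\<close>.\<close>

definition has_pushout_complement :: "('o, 'm) category \<Rightarrow> 'm \<Rightarrow> 'm \<Rightarrow> bool" where
  "has_pushout_complement C f h \<longleftrightarrow> (\<exists>g k. is_pushout C f g h k)"

definition some_pushout_complement :: "('o, 'm) category \<Rightarrow> 'm \<Rightarrow> 'm \<Rightarrow> 'm \<times> 'm" where
  "some_pushout_complement C f h = (SOME (g, k). is_pushout C f g h k)"

definition some_pushout :: "('o, 'm) category \<Rightarrow> 'm \<Rightarrow> 'm \<Rightarrow> 'm \<times> 'm" where
  "some_pushout C f g = (SOME (h, k). is_pushout C f g h k)"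

definition some_pullback :: "('o, 'm) category \<Rightarrow> 'm \<Rightarrow> 'm \<Rightarrow> 'm \<times> 'm" where
  "some_pullback C h k = (SOME (f, g). is_pullback C f g h k)"


section \<open>M-adhesive categories\<close>

text \<open>
  The given square is the bottom of a commutative cube with vertical morphisms
  \<open>a\<close>, \<open>b\<close>, \<open>c\<close>, \<open>d\<close> in \<open>M\<close>, top square \<open>f' g' h' k'\<close>, and pullbacks as back faces.
\<close>

definition M_van_Kampen ::
  "('o, 'm) category \<Rightarrow> 'm set \<Rightarrow> 'm \<Rightarrow> 'm \<Rightarrow> 'm \<Rightarrow> 'm \<Rightarrow> bool" where
  "M_van_Kampen C M f g h k \<longleftrightarrow>
    (\<forall>a\<in>M. \<forall>b\<in>M. \<forall>c\<in>M. \<forall>d\<in>M. \<forall>f' g' h' k'.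
      comm_square C f' g' h' k' \<and>
      is_pullback C f' a b f \<and> is_pullback C g' a c g \<and>
      comm_square C h' b d h \<and> comm_square C k' c d k \<longrightarrow>
      (is_pushout C f' g' h' k' \<longleftrightarrow> is_pullback C h' b d h \<and> is_pullback C k' c d k))"

locale M_adhesive_category = category C for C :: "('o, 'm) category" (structure) +
  fixes M :: "'m set"
  assumes M_mono: "f \<in> M \<Longrightarrow> is_mono C f"
    and M_iso: "is_iso C f \<Longrightarrow> f \<in> M"
    and M_comp: "\<lbrakk>f \<in> M; g \<in> M; Cod C f = Dom C g\<rbrakk> \<Longrightarrow> g \<odot> f \<in> M"
    and M_decomp: "\<lbrakk>f \<in> Arr C; g \<in> M; Cod C f = Dom C g; g \<odot> f \<in> M\<rbrakk> \<Longrightarrow> f \<in> M"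
    and M_pushout_ex: "\<lbrakk>f \<in> M; g \<in> Arr C; Dom C f = Dom C g\<rbrakk> \<Longrightarrow> \<exists>h k. is_pushout C f g h k"
    and M_pullback_ex: "\<lbrakk>h \<in> M; k \<in> Arr C; Cod C h = Cod C k\<rbrakk> \<Longrightarrow> \<exists>f g. is_pullback C f g h k"
    and M_pushout_stable: "\<lbrakk>is_pushout C f g h k; f \<in> M\<rbrakk> \<Longrightarrow> k \<in> M"
    and M_pullback_stable: "\<lbrakk>is_pullback C f g h k; h \<in> M\<rbrakk> \<Longrightarrow> g \<in> M"
    and M_VK: "\<lbrakk>is_pushout C f g h k; f \<in> M\<rbrakk> \<Longrightarrow> M_van_Kampen C M f g h k"

definition epi_M_factorization :: "('o, 'm) category \<Rightarrow> 'm set \<Rightarrow> bool" where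
  "epi_M_factorization C M \<longleftrightarrow> (\<forall>f\<in>Arr C.
    (\<exists>e m. is_epi C e \<and> m \<in> M \<and> Cod C e = Dom C m \<and> m \<odot>\<^bsub>C\<^esub> e = f) \<and>
    (\<forall>e m e' m'. is_epi C e \<and> m \<in> M \<and> Cod C e = Dom C m \<and> m \<odot>\<^bsub>C\<^esub> e = f \<and>
        is_epi C e' \<and> m' \<in> M \<and> Cod C e' = Dom C m' \<and> m' \<odot>\<^bsub>C\<^esub> e' = f \<longrightarrow>
      (\<exists>\<phi>\<in>hom C (Cod C e) (Cod C e'). is_iso C \<phi> \<and> \<phi> \<odot>\<^bsub>C\<^esub> e = e' \<and> m' \<odot>\<^bsub>C\<^esub> \<phi> = m)))"

definition balanced :: "('o, 'm) category \<Rightarrow> bool" where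
  "balanced C \<longleftrightarrow> (\<forall>f. is_mono C f \<and> is_epi C f \<longrightarrow> is_iso C f)"

definition strict_M_initial :: "('o, 'm) category \<Rightarrow> 'm set \<Rightarrow> 'o \<Rightarrow> bool" where
  "strict_M_initial C M Z \<longleftrightarrow> Z \<in> Obj C \<and>
    (\<forall>X\<in>Obj C. (\<exists>!f. f \<in> hom C Z X) \<and> hom C Z X \<subseteq> M) \<and>
    (\<forall>f\<in>Arr C. Cod C f = Z \<longrightarrow> is_iso C f)"

definition M_effective_unions :: "('o, 'm) category \<Rightarrow> 'm set \<Rightarrow> bool" where
  "M_effective_unions C M \<longleftrightarrow> (\<forall>f g h k p q u. h \<in> M \<and> k \<in> M \<and>
    is_pullback C f g h k \<and> is_pushout C f g p q \<and>
    u \<in> hom C (Cod C p) (Cod C h) \<and> u \<odot>\<^bsub>C\<^esub> p = h \<and> u \<odot>\<^bsub>C\<^esub> q = k \<longrightarrow> u \<in> M)"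

definition subobject_iso :: "('o, 'm) category \<Rightarrow> ('m \<times> 'm) set" where
  "subobject_iso C =
    {(m, n). m \<in> Arr C \<and> n \<in> Arr C \<and>
      (\<exists>\<phi>\<in>hom C (Dom C m) (Dom C n). is_iso C \<phi> \<and> n \<odot>\<^bsub>C\<^esub> \<phi> = m)}"

definition finite_object :: "('o, 'm) category \<Rightarrow> 'm set \<Rightarrow> 'o \<Rightarrow> bool" where
  "finite_object C M X \<longleftrightarrow> finite ({m \<in> M. Cod C m = X} // subobject_iso C)"

locale rewriting_category = M_adhesive_category +
  assumes epi_M: "epi_M_factorization C M"
    and balanced: "balanced C"
    and initial: "\<exists>Z. strict_M_initial C M Z"
    and effective_unions: "M_effective_unions C M"
    and finite_objects: "X \<in> Obj C \<Longrightarrow> finite_object C M X"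


section \<open>Nested conditions\<close>

text \<open>
  Conjunctions \<open>\<And>i\<in>J. c i\<close> may be infinite; the index sets needed by \<open>shift\<close> below consist of
  pairs of morphisms.  Since every conjunction is equivalent to one that keeps at most one conjunct
  per violating morphism, bounding the index sets in this way loses no generality up to equivalence.
  The binary conjunction is separate because the index type may have a single element only.
\<close>

datatype 'm cond =
    CTrue
  | CExists 'm "'m cond"
  | CNot "'m cond"
  | CAnd "'m cond" "'m cond"
  | CConj "('m \<times> 'm) set" "'m \<times> 'm \<Rightarrow> 'm cond"

abbreviation CFalse :: "'m cond" where
  "CFalse \<equiv> CNot CTrue"

definition CDisj :: "('m \<times> 'm) set \<Rightarrow> ('m \<times> 'm \<Rightarrow> 'm cond) \<Rightarrow> 'm cond" where
  "CDisj J F = CNot (CConj J (\<lambda>j. CNot (F j)))"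

primrec cond_over :: "('o, 'm) category \<Rightarrow> 'm set \<Rightarrow> 'm cond \<Rightarrow> 'o \<Rightarrow> bool" where
  "cond_over C M CTrue = (\<lambda>X. X \<in> Obj C)"
| "cond_over C M (CExists a c) = (\<lambda>X. a \<in> M \<and> Dom C a = X \<and> cond_over C M c (Cod C a))"
| "cond_over C M (CNot c) = (\<lambda>X. cond_over C M c X)"
| "cond_over C M (CAnd c c') = (\<lambda>X. cond_over C M c X \<and> cond_over C M c' X)"
| "cond_over C M (CConj J F) = (\<lambda>X. X \<in> Obj C \<and> (\<forall>j\<in>J. cond_over C M (F j) X))"

primrec sat :: "('o, 'm) category \<Rightarrow> 'm set \<Rightarrow> 'm cond \<Rightarrow> 'm \<Rightarrow> bool" where
  "sat C M CTrue = (\<lambda>h. True)"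
| "sat C M (CExists a c) =
    (\<lambda>h. \<exists>q\<in>M. Dom C q = Cod C a \<and> q \<odot>\<^bsub>C\<^esub> a = h \<and> sat C M c q)"
| "sat C M (CNot c) = (\<lambda>h. \<not> sat C M c h)"
| "sat C M (CAnd c c') = (\<lambda>h. sat C M c h \<and> sat C M c' h)"
| "sat C M (CConj J F) = (\<lambda>h. \<forall>j\<in>J. sat C M (F j) h)"

definition cond_equiv :: "('o, 'm) category \<Rightarrow> 'm set \<Rightarrow> 'o \<Rightarrow> 'm cond \<Rightarrow> 'm cond \<Rightarrow> bool" where
  "cond_equiv C M X c c' \<longleftrightarrow> (\<forall>h\<in>M. Dom C h = X \<longrightarrow> (sat C M c h \<longleftrightarrow> sat C M c' h))"

text \<open>
  The usual recursive constructions of \<open>Shift(p, c)\<close> and \<open>Trans(r, c)\<close>; their characterizing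
  properties are the lemmas \<open>sat_shift\<close> and \<open>sat_transport\<close> below.
  \<open>shift_squares C M p a\<close> are the jointly epic completions of the span \<open>Q \<leftarrow> P \<rightarrow> Y\<close>
  given by \<open>p\<close> and \<open>a\<close>.
\<close>

definition shift_squares :: "('o, 'm) category \<Rightarrow> 'm set \<Rightarrow> 'm \<Rightarrow> 'm \<Rightarrow> ('m \<times> 'm) set" where
  "shift_squares C M p a =
    {(a', p'). a' \<in> M \<and> p' \<in> M \<and> comm_square C p a a' p' \<and> jointly_epic C a' p'}"

primrec shift :: "('o, 'm) category \<Rightarrow> 'm set \<Rightarrow> 'm cond \<Rightarrow> 'm \<Rightarrow> 'm cond" where
  "shift C M CTrue = (\<lambda>p. CTrue)"
| "shift C M (CExists a c) =
    (\<lambda>p. CDisj (shift_squares C M p a) (\<lambda>j. CExists (fst j) (shift C M c (snd j))))"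
| "shift C M (CNot c) = (\<lambda>p. CNot (shift C M c p))"
| "shift C M (CAnd c c') = (\<lambda>p. CAnd (shift C M c p) (shift C M c' p))"
| "shift C M (CConj J F) = (\<lambda>p. CConj J (\<lambda>j. shift C M (F j) p))"

text \<open>A span \<open>O \<leftarrow> K \<rightarrow> I\<close> is the pair of its legs \<open>(K \<rightarrow> O, K \<rightarrow> I)\<close>.\<close>

type_synonym 'm span = "'m \<times> 'm"

primrec transport :: "('o, 'm) category \<Rightarrow> 'm cond \<Rightarrow> 'm span \<Rightarrow> 'm cond" where
  "transport C CTrue = (\<lambda>r. CTrue)"
| "transport C (CExists a c) = (\<lambda>(l, i).
    if has_pushout_complement C l a
    then let (e, l') = some_pushout_complement C l a; (a', i') = some_pushout C i e
         in CExists a' (transport C c (l', i'))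
    else CFalse)"
| "transport C (CNot c) = (\<lambda>r. CNot (transport C c r))"
| "transport C (CAnd c c') = (\<lambda>r. CAnd (transport C c r) (transport C c' r))"
| "transport C (CConj J F) = (\<lambda>r. CConj J (\<lambda>j. transport C (F j) r))"


section \<open>Linear rules with conditions and their composition\<close>

definition linear_rule :: "('o, 'm) category \<Rightarrow> 'm set \<Rightarrow> 'm span \<Rightarrow> bool" where
  "linear_rule C M r \<longleftrightarrow> fst r \<in> M \<and> snd r \<in> M \<and> Dom C (fst r) = Dom C (snd r)"

abbreviation (input) rule_output :: "('o, 'm) category \<Rightarrow> 'm span \<Rightarrow> 'o" where
  "rule_output C r \<equiv> Cod C (fst r)"

abbreviation (input) rule_input :: "('o, 'm) category \<Rightarrow> 'm span \<Rightarrow> 'o" where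
  "rule_input C r \<equiv> Cod C (snd r)"

type_synonym 'm crule = "'m span \<times> 'm cond"

definition linear_crule :: "('o, 'm) category \<Rightarrow> 'm set \<Rightarrow> 'm crule \<Rightarrow> bool" where
  "linear_crule C M R \<longleftrightarrow> linear_rule C M (fst R) \<and> cond_over C M (snd R) (rule_input C (fst R))"

definition dpo_match :: "('o, 'm) category \<Rightarrow> 'm set \<Rightarrow> 'm span \<Rightarrow> 'm \<Rightarrow> bool" where
  "dpo_match C M r m \<longleftrightarrow>
    m \<in> M \<and> Dom C m = rule_input C r \<and> has_pushout_complement C (snd r) m"

definition dpo_comatch :: "('o, 'm) category \<Rightarrow> 'm span \<Rightarrow> 'm \<Rightarrow> 'm \<Rightarrow> bool" where
  "dpo_comatch C r m m' \<longleftrightarrow>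
    (\<exists>d x y. is_pushout C (snd r) d m x \<and> is_pushout C (fst r) d m' y)"

definition dot_equiv :: "('o, 'm) category \<Rightarrow> 'm set \<Rightarrow> 'm span \<Rightarrow> 'm cond \<Rightarrow> 'm cond \<Rightarrow> bool" where
  "dot_equiv C M r c c' \<longleftrightarrow> (\<forall>m. dpo_match C M r m \<longrightarrow> (sat C M c m \<longleftrightarrow> sat C M c' m))"

text \<open>
  The span \<open>\<mu> = (m2, m1)\<close> is \<open>I2 \<leftarrow> M21 \<rightarrow> O1\<close>; below, \<open>N21\<close> is the codomain of \<open>m2'\<close> and \<open>m1'\<close>,
  \<open>n1 : K1' \<rightarrow> N21\<close>, \<open>n2 : K2' \<rightarrow> N21\<close>, \<open>q1 : K1' \<rightarrow> I21\<close> and \<open>q2 : K2' \<rightarrow> O21\<close>.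
\<close>

definition compose_along ::
  "('o, 'm) category \<Rightarrow> 'm set \<Rightarrow> 'm crule \<Rightarrow> 'm span \<Rightarrow> 'm crule \<Rightarrow> 'm crule" where
  "compose_along C M R2 \<mu> R1 =
    (let ((o2, i2), c2) = R2;
         ((o1, i1), c1) = R1;
         (m2, m1) = \<mu>;
         (m2', m1') = some_pushout C m2 m1;
         (k1, n1) = some_pushout_complement C o1 m1';
         (k2, n2) = some_pushout_complement C i2 m2';
         (p2, q2) = some_pushout C o2 k2;
         (p1, q1) = some_pushout C i1 k1;
         (u2, u1) = some_pullback C n2 n1
     in ((q2 \<odot>\<^bsub>C\<^esub> u2, q1 \<odot>\<^bsub>C\<^esub> u1),
         CAnd (shift C M c1 p1) (transport C (shift C M c2 m2') (n1, q1))))"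

definition overlap_span :: "('o, 'm) category \<Rightarrow> 'm set \<Rightarrow> 'm span \<Rightarrow> 'm span \<Rightarrow> 'm span \<Rightarrow> bool" where
  "overlap_span C M r2 r1 \<mu> \<longleftrightarrow> fst \<mu> \<in> M \<and> snd \<mu> \<in> M \<and> Dom C (fst \<mu>) = Dom C (snd \<mu>) \<and>
    Cod C (fst \<mu>) = rule_input C r2 \<and> Cod C (snd \<mu>) = rule_output C r1"

definition admissible_span :: "('o, 'm) category \<Rightarrow> 'm set \<Rightarrow> 'm crule \<Rightarrow> 'm crule \<Rightarrow> 'm span \<Rightarrow> bool" where
  "admissible_span C M R2 R1 \<mu> \<longleftrightarrow> overlap_span C M (fst R2) (fst R1) \<mu> \<and>
    (let (m2', m1') = some_pushout C (fst \<mu>) (snd \<mu>);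
         (r21, c21) = compose_along C M R2 \<mu> R1
     in has_pushout_complement C (fst (fst R1)) m1' \<and>
        has_pushout_complement C (snd (fst R2)) m2' \<and>
        \<not> cond_equiv C M (rule_input C r21) c21 CFalse)"

text \<open>
  Matches are spans up to isomorphism of the apex (with fixed feet).  The composite along an
  isomorphism class is formed with a chosen representative and with chosen pushouts, pullbacks and
  pushout complements, hence is determined up to isomorphism.
\<close>

definition is_span :: "('o, 'm) category \<Rightarrow> 'm span \<Rightarrow> bool" where
  "is_span C \<mu> \<longleftrightarrow> fst \<mu> \<in> Arr C \<and> snd \<mu> \<in> Arr C \<and> Dom C (fst \<mu>) = Dom C (snd \<mu>)"

definition span_iso :: "('o, 'm) category \<Rightarrow> ('m span \<times> 'm span) set" where
  "span_iso C = {(\<mu>, \<nu>). is_span C \<mu> \<and> is_span C \<nu> \<and>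
    (\<exists>\<phi>\<in>hom C (Dom C (fst \<mu>)) (Dom C (fst \<nu>)). is_iso C \<phi> \<and>
      fst \<nu> \<odot>\<^bsub>C\<^esub> \<phi> = fst \<mu> \<and> snd \<nu> \<odot>\<^bsub>C\<^esub> \<phi> = snd \<mu>)}"

definition matches :: "('o, 'm) category \<Rightarrow> 'm set \<Rightarrow> 'm crule \<Rightarrow> 'm crule \<Rightarrow> 'm span set set" where
  "matches C M R2 R1 = {\<mu>. admissible_span C M R2 R1 \<mu>} // span_iso C"

definition composite ::
  "('o, 'm) category \<Rightarrow> 'm set \<Rightarrow> 'm crule \<Rightarrow> 'm span set \<Rightarrow> 'm crule \<Rightarrow> 'm crule" where
  "composite C M R2 X R1 = compose_along C M R2 (SOME \<mu>. \<mu> \<in> X) R1"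

text \<open>
  Isomorphism of rules together with dotted equivalence of their conditions.  As the conditions live
  over isomorphic but possibly different objects, \<open>c\<close> is first moved along the isomorphism of inputs.
\<close>

definition crule_equiv :: "('o, 'm) category \<Rightarrow> 'm set \<Rightarrow> 'm crule \<Rightarrow> 'm crule \<Rightarrow> bool" where
  "crule_equiv C M R R' \<longleftrightarrow>
    (let (r, c) = R; (r', c') = R' in
     \<exists>\<phi>O\<in>hom C (rule_output C r) (rule_output C r').
     \<exists>\<phi>K\<in>hom C (Dom C (fst r)) (Dom C (fst r')).
     \<exists>\<phi>I\<in>hom C (rule_input C r) (rule_input C r').
       is_iso C \<phi>O \<and> is_iso C \<phi>K \<and> is_iso C \<phi>I \<and>
       \<phi>O \<odot>\<^bsub>C\<^esub> fst r = fst r' \<odot>\<^bsub>C\<^esub> \<phi>K \<and> \<phi>I \<odot>\<^bsub>C\<^esub> snd r = snd r' \<odot>\<^bsub>C\<^esub> \<phi>K \<and>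
       dot_equiv C M r' (shift C M c \<phi>I) c')"


section \<open>The characterizing properties of shift and transport\<close>

context category
begin

lemma id_left': "\<lbrakk>f \<in> Arr C; Cod C f = X\<rbrakk> \<Longrightarrow> Id C X \<odot> f = f"
  using id_left by blast

lemma id_right': "\<lbrakk>f \<in> Arr C; Dom C f = X\<rbrakk> \<Longrightarrow> f \<odot> Id C X = f"
  using id_right by blast

lemma pushout_comm: "is_pushout C f g h k \<Longrightarrow> comm_square C f g h k"
  by (simp add: is_pushout_def)

lemma pullback_comm: "is_pullback C f g h k \<Longrightarrow> comm_square C f g h k"
  by (simp add: is_pullback_def)

lemma pushout_obtain:
  assumes "is_pushout C f g h k" "comm_square C f g h' k'"
  obtains u where "u \<in> Arr C" "Dom C u = Cod C h" "Cod C u = Cod C h'" "u \<odot> h = h'" "u \<odot> k = k'"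
  using assms unfolding is_pushout_def hom_def by blast

lemma pullback_obtain:
  assumes "is_pullback C f g h k" "comm_square C f' g' h k"
  obtains u where "u \<in> Arr C" "Dom C u = Dom C f'" "Cod C u = Dom C f" "f \<odot> u = f'" "g \<odot> u = g'"
  using assms unfolding is_pullback_def hom_def by blast

lemma comm_square_post:
  assumes "comm_square C f g h k" "u \<in> Arr C" "Dom C u = Cod C h"
  shows "comm_square C f g (u \<odot> h) (u \<odot> k)"
  using assms unfolding comm_square_def
  by (auto simp: comp_arr comp_dom comp_cod comp_assoc)

lemma comm_square_pre:
  assumes "comm_square C f g h k" "u \<in> Arr C" "Cod C u = Dom C f"
  shows "comm_square C (f \<odot> u) (g \<odot> u) h k"
  using assms unfolding comm_square_def
  by (auto simp: comp_arr comp_dom comp_cod comp_assoc[symmetric])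

lemma pushout_jointly_epic:
  assumes po: "is_pushout C f g h k"
  shows "jointly_epic C h k"
  unfolding jointly_epic_def
proof (intro conjI ballI impI)
  have cs: "comm_square C f g h k" using po by (rule pushout_comm)
  then show "h \<in> Arr C" "k \<in> Arr C" "Cod C h = Cod C k" by (auto simp: comm_square_def)
  fix u v assume u: "u \<in> Arr C" and v: "v \<in> Arr C"
    and *: "Cod C u = Cod C v \<and> Dom C u = Cod C h \<and> Dom C v = Cod C h \<and> u \<odot> h = v \<odot> h \<and> u \<odot> k = v \<odot> k"
  have "comm_square C f g (u \<odot> h) (u \<odot> k)" using comm_square_post[OF cs u] * by simp
  then have "\<exists>!w. w \<in> hom C (Cod C h) (Cod C (u \<odot> h)) \<and> w \<odot> h = u \<odot> h \<and> w \<odot> k = u \<odot> k"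
    using po unfolding is_pushout_def by blast
  moreover have "Cod C (u \<odot> h) = Cod C u" using cs u * by (intro comp_cod) (auto simp: comm_square_def)
  ultimately show "u = v" using u v * by (auto simp: hom_def)
qed

lemma pushout_unique:
  assumes "is_pushout C f g h k" "u \<in> Arr C" "v \<in> Arr C" "Cod C u = Cod C v"
    "Dom C u = Cod C h" "Dom C v = Cod C h" "u \<odot> h = v \<odot> h" "u \<odot> k = v \<odot> k"
  shows "u = v"
  using pushout_jointly_epic[OF assms(1)] assms unfolding jointly_epic_def by blast

lemma pushoutI:
  assumes "comm_square C f g h k"
    and "\<And>h' k'. comm_square C f g h' k' \<Longrightarrow>
      \<exists>u\<in>Arr C. Dom C u = Cod C h \<and> Cod C u = Cod C h' \<and> u \<odot> h = h' \<and> u \<odot> k = k'"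
    and "jointly_epic C h k"
  shows "is_pushout C f g h k"
  unfolding is_pushout_def
proof (intro conjI allI impI)
  fix h' k' assume "comm_square C f g h' k'"
  then obtain u where u: "u \<in> Arr C" "Dom C u = Cod C h" "Cod C u = Cod C h'" "u \<odot> h = h'" "u \<odot> k = k'"
    using assms(2) by blast
  show "\<exists>!u. u \<in> hom C (Cod C h) (Cod C h') \<and> u \<odot> h = h' \<and> u \<odot> k = k'"
  proof (rule ex1I[of _ u])
    show "u \<in> hom C (Cod C h) (Cod C h') \<and> u \<odot> h = h' \<and> u \<odot> k = k'" using u by (simp add: hom_def)
    fix v assume "v \<in> hom C (Cod C h) (Cod C h') \<and> v \<odot> h = h' \<and> v \<odot> k = k'"
    then show "v = u" using u assms(3) unfolding jointly_epic_def hom_def by auto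
  qed
qed (fact assms(1))

lemma pushout_compose:
  assumes p1: "is_pushout C f g h k" and p2: "is_pushout C k g2 h2 k2"
  shows "is_pushout C f (g2 \<odot> g) (h2 \<odot> h) k2"
proof (rule pushoutI)
  have c1: "comm_square C f g h k" and c2: "comm_square C k g2 h2 k2"
    using p1 p2 by (auto intro: pushout_comm)
  note [simp] = comp_arr comp_dom comp_cod
  have t: "f \<in> Arr C" "g \<in> Arr C" "h \<in> Arr C" "k \<in> Arr C" "g2 \<in> Arr C" "h2 \<in> Arr C" "k2 \<in> Arr C"
    "Dom C f = Dom C g" "Cod C f = Dom C h" "Cod C g = Dom C k" "Cod C h = Cod C k"
    "h \<odot> f = k \<odot> g" "Dom C k = Dom C g2" "Cod C k = Dom C h2" "Cod C g2 = Dom C k2" "Cod C h2 = Cod C k2"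
    "h2 \<odot> k = k2 \<odot> g2"
    using c1 c2 by (auto simp: comm_square_def)
  have "(h2 \<odot> h) \<odot> f = h2 \<odot> (k \<odot> g)" using t by (simp add: comp_assoc)
  also have "\<dots> = (h2 \<odot> k) \<odot> g" using t by (intro comp_assoc[symmetric]) simp_all
  also have "\<dots> = k2 \<odot> (g2 \<odot> g)" using t by (simp add: comp_assoc)
  finally have eq: "(h2 \<odot> h) \<odot> f = k2 \<odot> (g2 \<odot> g)" .
  show c: "comm_square C f (g2 \<odot> g) (h2 \<odot> h) k2"
    unfolding comm_square_def using t eq by simp
  show "\<exists>u\<in>Arr C. Dom C u = Cod C (h2 \<odot> h) \<and> Cod C u = Cod C h' \<and> u \<odot> (h2 \<odot> h) = h' \<and> u \<odot> k2 = k'"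
    if s: "comm_square C f (g2 \<odot> g) h' k'" for h' k'
  proof -
    have s': "h' \<in> Arr C" "k' \<in> Arr C" "Dom C h' = Cod C f" "Dom C k' = Cod C g2" "Cod C h' = Cod C k'"
      "h' \<odot> f = k' \<odot> (g2 \<odot> g)"
      using s t by (auto simp: comm_square_def)
    have "comm_square C f g h' (k' \<odot> g2)"
      unfolding comm_square_def using s' t by (simp add: comp_assoc)
    then obtain v where v: "v \<in> Arr C" "Dom C v = Cod C h" "Cod C v = Cod C h'" "v \<odot> h = h'" "v \<odot> k = k' \<odot> g2"
      using pushout_obtain[OF p1] by blast
    have "comm_square C k g2 v k'"
      unfolding comm_square_def using s' t v by simp
    then obtain w where w: "w \<in> Arr C" "Dom C w = Cod C h2" "Cod C w = Cod C v" "w \<odot> h2 = v" "w \<odot> k2 = k'"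
      using pushout_obtain[OF p2] by blast
    have "w \<odot> (h2 \<odot> h) = h'" using w v t by (simp add: comp_assoc[symmetric])
    with w v t show ?thesis by (intro bexI[of _ w]) simp_all
  qed
  show "jointly_epic C (h2 \<odot> h) k2"
    unfolding jointly_epic_def
  proof (intro conjI ballI impI)
    show "h2 \<odot> h \<in> Arr C" "k2 \<in> Arr C" "Cod C (h2 \<odot> h) = Cod C k2" using t by simp_all
    fix u v assume u: "u \<in> Arr C" and v: "v \<in> Arr C"
      and a: "Cod C u = Cod C v \<and> Dom C u = Cod C (h2 \<odot> h) \<and> Dom C v = Cod C (h2 \<odot> h) \<and>
        u \<odot> (h2 \<odot> h) = v \<odot> (h2 \<odot> h) \<and> u \<odot> k2 = v \<odot> k2"
    have ud: "Dom C u = Cod C h2" "Dom C v = Cod C h2" using a t by simp_all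
    have e: "(u \<odot> h2) \<odot> h = (v \<odot> h2) \<odot> h" using a u v t ud by (simp add: comp_assoc)
    have "(u \<odot> h2) \<odot> k = (u \<odot> k2) \<odot> g2" using u t ud by (simp add: comp_assoc)
    moreover have "(v \<odot> h2) \<odot> k = (v \<odot> k2) \<odot> g2" using v t ud by (simp add: comp_assoc)
    ultimately have e': "(u \<odot> h2) \<odot> k = (v \<odot> h2) \<odot> k" using a by simp
    have "u \<odot> h2 = v \<odot> h2"
      by (rule pushout_unique[OF p1 _ _ _ _ _ e e']) (use u v a t ud in simp_all)
    then show "u = v" using pushout_unique[OF p2 u v] a ud by blast
  qed
qed

lemma pushout_decompose:
  assumes p1: "is_pushout C f g h k" and p: "is_pushout C f (g2 \<odot> g) (h2 \<odot> h) k2"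
    and c2: "comm_square C k g2 h2 k2"
  shows "is_pushout C k g2 h2 k2"
proof (rule pushoutI)
  have c1: "comm_square C f g h k" 
    using p1 by (auto intro: pushout_comm)
  note [simp] = comp_arr comp_dom comp_cod
  have t: "f \<in> Arr C" "g \<in> Arr C" "h \<in> Arr C" "k \<in> Arr C" "g2 \<in> Arr C" "h2 \<in> Arr C" "k2 \<in> Arr C"
    "Dom C f = Dom C g" "Cod C f = Dom C h" "Cod C g = Dom C k" "Cod C h = Cod C k"
    "h \<odot> f = k \<odot> g" "Dom C k = Dom C g2" "Cod C k = Dom C h2" "Cod C g2 = Dom C k2" "Cod C h2 = Cod C k2"
    "h2 \<odot> k = k2 \<odot> g2"
    using c1 c2 by (auto simp: comm_square_def)
  show "comm_square C k g2 h2 k2" by (fact c2)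
  show "\<exists>u\<in>Arr C. Dom C u = Cod C h2 \<and> Cod C u = Cod C h' \<and> u \<odot> h2 = h' \<and> u \<odot> k2 = k'"
    if s: "comm_square C k g2 h' k'" for h' k'
  proof -
    have s': "h' \<in> Arr C" "k' \<in> Arr C" "Dom C h' = Cod C k" "Dom C k' = Cod C g2" "Cod C h' = Cod C k'"
      "h' \<odot> k = k' \<odot> g2"
      using s t by (auto simp: comm_square_def)
    have "(h' \<odot> h) \<odot> f = h' \<odot> (k \<odot> g)" using s' t by (simp add: comp_assoc)
    also have "\<dots> = (h' \<odot> k) \<odot> g" using s' t by (intro comp_assoc[symmetric]) simp_all
    also have "\<dots> = k' \<odot> (g2 \<odot> g)" using s' t by (simp add: comp_assoc)
    finally have "comm_square C f (g2 \<odot> g) (h' \<odot> h) k'"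
      unfolding comm_square_def using s' t by simp
    then obtain w where w: "w \<in> Arr C" "Dom C w = Cod C (h2 \<odot> h)" "Cod C w = Cod C (h' \<odot> h)"
        "w \<odot> (h2 \<odot> h) = h' \<odot> h" "w \<odot> k2 = k'"
      using pushout_obtain[OF p] by blast
    have wd: "Dom C w = Cod C h2" "Cod C w = Cod C h'" using w s' t by simp_all
    have e: "(w \<odot> h2) \<odot> h = h' \<odot> h" using w wd t by (simp add: comp_assoc)
    have "(w \<odot> h2) \<odot> k = (w \<odot> k2) \<odot> g2"
      using comp_assoc[of k h2 w] comp_assoc[of g2 k2 w] w wd t by simp
    then have e': "(w \<odot> h2) \<odot> k = h' \<odot> k" using w s' by simp
    have "w \<odot> h2 = h'"
      by (rule pushout_unique[OF p1 _ _ _ _ _ e e']) (use w wd s' t in simp_all)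
    with w wd show ?thesis by blast
  qed
  show "jointly_epic C h2 k2"
    unfolding jointly_epic_def
  proof (intro conjI ballI impI)
    show "h2 \<in> Arr C" "k2 \<in> Arr C" "Cod C h2 = Cod C k2" using t by simp_all
    fix u v assume u: "u \<in> Arr C" and v: "v \<in> Arr C"
      and a: "Cod C u = Cod C v \<and> Dom C u = Cod C h2 \<and> Dom C v = Cod C h2 \<and>
        u \<odot> h2 = v \<odot> h2 \<and> u \<odot> k2 = v \<odot> k2"
    have e: "u \<odot> (h2 \<odot> h) = v \<odot> (h2 \<odot> h)"
      using comp_assoc[of h h2 u] comp_assoc[of h h2 v] a u v t by simp
    show "u = v" by (rule pushout_unique[OF p u v _ _ _ e]) (use a t in simp_all)
  qed
qed

lemma pullback_mono_triangle:
  assumes "is_mono C m" "e \<in> Arr C" "Cod C e = Dom C m"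
  shows "is_pullback C e (Id C (Dom C e)) m (m \<odot> e)"
  unfolding is_pullback_def
proof (intro conjI allI impI)
  note [simp] = comp_arr comp_dom comp_cod id_arr id_dom id_cod id_left id_right dom_obj
  have m: "m \<in> Arr C" using assms by (simp add: is_mono_def)
  show "comm_square C e (Id C (Dom C e)) m (m \<odot> e)"
    unfolding comm_square_def using assms m id_right[of "m \<odot> e"] by simp
  fix f' g' assume "comm_square C f' g' m (m \<odot> e)"
  then have s: "f' \<in> Arr C" "g' \<in> Arr C" "Dom C f' = Dom C g'" "Cod C f' = Dom C m" "Cod C g' = Dom C e"
    "m \<odot> f' = (m \<odot> e) \<odot> g'" using assms m by (auto simp: comm_square_def)
  have "m \<odot> f' = m \<odot> (e \<odot> g')" using s m assms by (simp add: comp_assoc)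
  moreover have "e \<odot> g' \<in> Arr C" "Dom C (e \<odot> g') = Dom C f'" "Cod C (e \<odot> g') = Dom C m"
    using s assms by simp_all
  ultimately have "f' = e \<odot> g'" using assms(1) s unfolding is_mono_def by metis
  show "\<exists>!u. u \<in> hom C (Dom C f') (Dom C e) \<and> e \<odot> u = f' \<and> Id C (Dom C e) \<odot> u = g'"
  proof (rule ex1I[of _ g'])
    show "g' \<in> hom C (Dom C f') (Dom C e) \<and> e \<odot> g' = f' \<and> Id C (Dom C e) \<odot> g' = g'"
      using s \<open>f' = e \<odot> g'\<close>[symmetric] id_left'[of g'] by (simp add: hom_def)
    fix u assume "u \<in> hom C (Dom C f') (Dom C e) \<and> e \<odot> u = f' \<and> Id C (Dom C e) \<odot> u = g'"
    then show "u = g'" using id_left'[of u] by (auto simp: hom_def)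
  qed
qed

lemma comm_square_sym: "comm_square C f g h k \<longleftrightarrow> comm_square C g f k h"
  unfolding comm_square_def by auto

lemma pullback_sym:
  assumes "is_pullback C f g h k"
  shows "is_pullback C g f k h"
  unfolding is_pullback_def
proof (intro conjI allI impI)
  show "comm_square C g f k h" using pullback_comm[OF assms] by (simp add: comm_square_sym)
  fix g' f' assume *: "comm_square C g' f' k h"
  then have "comm_square C f' g' h k" by (simp add: comm_square_sym)
  then have "\<exists>!u. u \<in> hom C (Dom C f') (Dom C f) \<and> f \<odot> u = f' \<and> g \<odot> u = g'"
    using assms unfolding is_pullback_def by blast
  moreover have "Dom C f' = Dom C g'" "Dom C f = Dom C g"
    using * pullback_comm[OF assms] by (auto simp: comm_square_def)
  ultimately show "\<exists>!u. u \<in> hom C (Dom C g') (Dom C g) \<and> g \<odot> u = g' \<and> f \<odot> u = f'"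
    by (simp add: conj_commute)
qed

lemma pushout_sym:
  assumes "is_pushout C f g h k"
  shows "is_pushout C g f k h"
  unfolding is_pushout_def
proof (intro conjI allI impI)
  show "comm_square C g f k h" using pushout_comm[OF assms] by (simp add: comm_square_sym)
  fix k' h' assume *: "comm_square C g f k' h'"
  then have "comm_square C f g h' k'" by (simp add: comm_square_sym)
  then have "\<exists>!u. u \<in> hom C (Cod C h) (Cod C h') \<and> u \<odot> h = h' \<and> u \<odot> k = k'"
    using assms unfolding is_pushout_def by blast
  moreover have "Cod C h' = Cod C k'" "Cod C h = Cod C k"
    using * pushout_comm[OF assms] by (auto simp: comm_square_def)
  ultimately show "\<exists>!u. u \<in> hom C (Cod C k) (Cod C k') \<and> u \<odot> k = k' \<and> u \<odot> h = h'"
    by (simp add: conj_commute)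
qed

lemma id_mono: "X \<in> Obj C \<Longrightarrow> is_mono C (Id C X)"
  unfolding is_mono_def by (metis id_arr id_dom id_left)

lemma id_iso: "X \<in> Obj C \<Longrightarrow> is_iso C (Id C X)"
  unfolding is_iso_def hom_def
  using id_left'[of "Id C X" X] by (auto simp: id_arr id_dom id_cod intro!: exI[of _ "Id C X"])

lemma pullback_id_right:
  assumes "g \<in> Arr C"
  shows "is_pullback C g (Id C (Dom C g)) (Id C (Cod C g)) g"
  using pullback_mono_triangle[OF id_mono[OF cod_obj[OF assms]] assms] assms
  by (simp add: id_dom id_left cod_obj)

lemma pushout_id:
  assumes "g \<in> Arr C"
  shows "is_pushout C (Id C (Dom C g)) g g (Id C (Cod C g))"
proof (rule pushoutI)
  note [simp] = id_arr id_dom id_cod dom_obj cod_obj id_left id_right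
  show "comm_square C (Id C (Dom C g)) g g (Id C (Cod C g))"
    using assms by (simp add: comm_square_def)
  show "\<exists>u\<in>Arr C. Dom C u = Cod C g \<and> Cod C u = Cod C h' \<and> u \<odot> g = h' \<and> u \<odot> Id C (Cod C g) = k'"
    if "comm_square C (Id C (Dom C g)) g h' k'" for h' k'
    using that assms id_right[of k'] id_right[of h'] unfolding comm_square_def
    by (intro bexI[of _ k']) auto
  show "jointly_epic C g (Id C (Cod C g))"
    unfolding jointly_epic_def using assms by (simp, metis id_right)
qed

lemma pushout_id_iso:
  assumes po: "is_pushout C (Id C X) t h p" and tA: "t \<in> Arr C" "Dom C t = X"
  shows "is_iso C p"
proof -
  have X: "X \<in> Obj C" using tA dom_obj by blast
  have c: "comm_square C (Id C X) t h p" using po by (rule pushout_comm)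
  have a: "h \<in> Arr C" "p \<in> Arr C" "Dom C h = X" "Dom C p = Cod C t" "Cod C h = Cod C p"
    using c X by (simp_all add: comm_square_def id_cod)
  have hpt: "p \<odot> t = h" using c id_right'[OF a(1,3)] by (simp add: comm_square_def)
  have "comm_square C (Id C X) t t (Id C (Cod C t))"
    using pushout_comm[OF pushout_id[OF tA(1)]] tA by simp
  then obtain u where u: "u \<in> Arr C" "Dom C u = Cod C h" "Cod C u = Cod C t" "u \<odot> h = t" "u \<odot> p = Id C (Cod C t)"
    using pushout_obtain[OF po] by blast
  have pu: "p \<odot> u \<in> Arr C" "Dom C (p \<odot> u) = Cod C h" "Cod C (p \<odot> u) = Cod C p"
    using u a by (simp_all add: comp_arr comp_dom comp_cod)
  have O: "Cod C p \<in> Obj C" using a cod_obj by blast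
  have e: "(p \<odot> u) \<odot> h = Id C (Cod C p) \<odot> h"
    using comp_assoc[of h u p] u a hpt id_left'[of h "Cod C p"] by simp
  have e': "(p \<odot> u) \<odot> p = Id C (Cod C p) \<odot> p"
    using comp_assoc[of p u p] u a id_right'[of p "Cod C t"] id_left'[of p "Cod C p"] by simp
  have "p \<odot> u = Id C (Cod C p)"
    by (rule pushout_unique[OF po _ _ _ _ _ e e'])
      (use pu a O in \<open>simp_all add: id_arr id_dom id_cod\<close>)
  then show ?thesis unfolding is_iso_def hom_def using u a by auto
qed

end

context M_adhesive_category
begin

lemma M_arr: "f \<in> M \<Longrightarrow> f \<in> Arr C"
  using M_mono by (auto simp: is_mono_def)

lemma pushout_along_M_is_pullback:
  assumes po: "is_pushout C f g h k" and f: "f \<in> M"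
  shows "is_pullback C f g h k"
proof -
  note [simp] = id_arr id_dom id_cod dom_obj cod_obj id_left id_right
  have c: "comm_square C f g h k" using po by (rule pushout_comm)
  have t: "f \<in> Arr C" "g \<in> Arr C" "h \<in> Arr C" "k \<in> Arr C" "Dom C f = Dom C g" "Cod C f = Dom C h"
    "Cod C g = Dom C k" "Cod C h = Cod C k" "h \<odot> f = k \<odot> g" using c by (auto simp: comm_square_def)
  have k: "k \<in> M" using M_pushout_stable[OF po f] .
  define a where "a = Id C (Dom C g)"
  define b where "b = Id C (Cod C g)"
  have ab: "a \<in> M" "b \<in> M" using t by (auto simp: a_def b_def intro!: M_iso id_iso)
  have vk: "M_van_Kampen C M f g h k" using M_VK[OF po f] .
  have 1: "is_pushout C a g g b" using pushout_id[OF t(2)] by (simp add: a_def b_def)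
  have 2: "is_pullback C a a f f"
    using pullback_mono_triangle[OF M_mono[OF f], of a] t id_right[of f] by (simp add: a_def)
  have 3: "is_pullback C g a b g"
    using pullback_id_right[OF t(2)] by (simp add: a_def b_def)
  have 4: "comm_square C g f k h" "comm_square C b b k k"
    using t id_right[of k] by (auto simp: comm_square_def b_def)
  have "is_pullback C g f k h"
    using vk[unfolded M_van_Kampen_def, rule_format, OF ab(1) f ab(2) k, of a g g b] 
      1 2 3 4 pushout_comm[OF 1] by blast
  then show ?thesis by (rule pullback_sym)
qed

lemma pushout_pullback_decompose:
  assumes po: "is_pushout C l (d1 \<odot> e) (q \<odot> a) y" and l: "l \<in> M"
    and pb: "is_pullback C y' d1 q y" and q: "q \<in> M"
    and comm: "comm_square C l e a y'"
  shows "is_pushout C l e a y'" "is_pushout C y' d1 q y"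
proof -
  note [simp] = id_arr id_dom id_cod dom_obj cod_obj id_left id_right comp_arr comp_dom comp_cod
  have t: "l \<in> Arr C" "e \<in> Arr C" "a \<in> Arr C" "y' \<in> Arr C" "d1 \<in> Arr C" "q \<in> Arr C" "y \<in> Arr C"
    "Dom C l = Dom C e" "Cod C l = Dom C a" "Cod C e = Dom C y'" "Cod C a = Cod C y'" "a \<odot> l = y' \<odot> e"
    "Dom C y' = Dom C d1" "Cod C y' = Dom C q" "Cod C d1 = Dom C y" "Cod C q = Cod C y" "q \<odot> y' = y \<odot> d1"
    using comm pullback_comm[OF pb] by (auto simp: comm_square_def)
  have d1: "d1 \<in> M" using M_pullback_stable[OF pb q] .
  define i where "i = Id C (Dom C l)"
  define j where "j = Id C (Cod C l)"
  have ij: "i \<in> M" "j \<in> M" using t by (auto simp: i_def j_def intro!: M_iso id_iso)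
  have 1: "is_pullback C l i j l" using pullback_id_right[OF t(1)] by (simp add: i_def j_def)
  have 2: "is_pullback C e i d1 (d1 \<odot> e)"
    using pullback_mono_triangle[OF M_mono[OF d1], of e] t by (simp add: i_def)
  have 3: "is_pullback C a j q (q \<odot> a)"
    using pullback_mono_triangle[OF M_mono[OF q], of a] t by (simp add: j_def)
  show *: "is_pushout C l e a y'"
    using M_VK[OF po l, unfolded M_van_Kampen_def, rule_format, OF ij(1) ij(2) d1 q, of l e a y']
      1 2 3 pb comm pullback_comm by blast
  show "is_pushout C y' d1 q y"
    using pushout_decompose[OF * po pullback_comm[OF pb]] .
qed

lemma pushout_complement_pullback_iso:
  assumes po1: "is_pushout C l e1 a y1" and po2: "is_pushout C l e2 a y2" and l: "l \<in> M"
    and pb: "is_pullback C p1 p2 y1 y2"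
    and t: "t \<in> Arr C" "Cod C t = Dom C p1" "p1 \<odot> t = e1" "p2 \<odot> t = e2"
  shows "is_iso C p2"
proof -
  note [simp] = id_arr id_dom id_cod dom_obj cod_obj id_left id_right comp_arr comp_dom comp_cod
  have y: "y1 \<in> M" "y2 \<in> M" using M_pushout_stable po1 po2 l by auto
  have p: "p1 \<in> M" "p2 \<in> M" using M_pullback_stable[OF pb y(1)] M_pullback_stable[OF pullback_sym[OF pb] y(2)] by auto
  have c1: "comm_square C l e1 a y1" and c2: "comm_square C l e2 a y2" and c: "comm_square C p1 p2 y1 y2"
    using po1 po2 pb by (auto intro: pushout_comm pullback_comm)
  have td: "Dom C t = Dom C l" using c1 t c by (auto simp: comm_square_def)
  define i where "i = Id C (Dom C l)"
  have lA: "l \<in> Arr C" using l by (rule M_arr)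
  have iM: "i \<in> M" using lA by (auto simp: i_def intro!: M_iso id_iso)
  have 1: "is_pullback C i i l l"
    using pullback_mono_triangle[OF M_mono[OF l], of i] lA by (simp add: i_def)
  have 2: "is_pullback C t i p1 e1"
    using pullback_mono_triangle[OF M_mono[OF p(1)] t(1,2)] t td by (simp add: i_def)
  have 3: "is_pullback C e2 l y2 a"
    using pushout_along_M_is_pullback[OF po2 l] by (rule pullback_sym)
  have 4: "is_pullback C p2 p1 y2 y1" using pb by (rule pullback_sym)
  have 5: "comm_square C i t e2 p2"
    using c2 c t td lA by (auto simp: comm_square_def i_def)
  have "is_pushout C i t e2 p2"
    using M_VK[OF po1 l, unfolded M_van_Kampen_def, rule_format, OF iM l p(1) y(2), of i t e2 p2]
      1 2 3 4 5 pullback_comm by blast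
  then show ?thesis using pushout_id_iso t td by (simp add: i_def)
qed

lemma iso_inverse:
  assumes "is_iso C f"
  obtains g where "g \<in> Arr C" "Dom C g = Cod C f" "Cod C g = Dom C f"
    "g \<odot> f = Id C (Dom C f)" "f \<odot> g = Id C (Cod C f)"
  using assms unfolding is_iso_def hom_def by blast

lemma pushout_complement_decompose:
  assumes po: "is_pushout C l d (q \<odot> a) y" and l: "l \<in> M"
    and q: "q \<in> M" and a: "a \<in> Arr C" "Cod C a = Dom C q" "Dom C a = Cod C l"
  shows "has_pushout_complement C l a"
    and "is_pushout C l e a y' \<Longrightarrow>
      \<exists>d1\<in>Arr C. Dom C d1 = Dom C y' \<and> d1 \<odot> e = d \<and> is_pushout C y' d1 q y"
proof -
  note [simp] = id_arr id_dom id_cod dom_obj cod_obj id_left id_right comp_arr comp_dom comp_cod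
  have qA: "q \<in> Arr C" and lA: "l \<in> Arr C" using q l by (auto intro: M_arr)
  have c: "comm_square C l d (q \<odot> a) y" using po by (rule pushout_comm)
  have t: "d \<in> Arr C" "y \<in> Arr C" "Dom C l = Dom C d" "Cod C d = Dom C y" "Cod C q = Cod C y"
    "q \<odot> (a \<odot> l) = y \<odot> d" using c a qA lA by (auto simp: comm_square_def comp_assoc)
  obtain y0 d0 where pb: "is_pullback C y0 d0 q y" using M_pullback_ex[OF q t(2) t(5)] by blast
  have cb: "comm_square C y0 d0 q y" using pb by (rule pullback_comm)
  have "comm_square C (a \<odot> l) d q y" using t a qA lA by (simp add: comm_square_def)
  then obtain e0 where e0: "e0 \<in> Arr C" "Dom C e0 = Dom C (a \<odot> l)" "Cod C e0 = Dom C y0"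
      "y0 \<odot> e0 = a \<odot> l" "d0 \<odot> e0 = d"
    using pullback_obtain[OF pb] by blast
  have c0: "comm_square C l e0 a y0" using e0 a lA cb by (auto simp: comm_square_def)
  have po': "is_pushout C l (d0 \<odot> e0) (q \<odot> a) y" using po e0 by simp
  note dec = pushout_pullback_decompose[OF po' l pb q c0]
  show "has_pushout_complement C l a" using dec(1) unfolding has_pushout_complement_def by blast
  assume poe: "is_pushout C l e a y'"
  have ce: "comm_square C l e a y'" using poe by (rule pushout_comm)
  have y0: "y0 \<in> M" using M_pushout_stable[OF dec(1) l] .
  have y': "y' \<in> Arr C" "Cod C y' = Cod C y0" "Dom C y' = Cod C e" "e \<in> Arr C"
    using ce c0 by (auto simp: comm_square_def)
  obtain p1 p2 where pp: "is_pullback C p1 p2 y0 y'"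
    using M_pullback_ex[OF y0 y'(1)] y' by force
  have cp: "comm_square C p1 p2 y0 y'" using pp by (rule pullback_comm)
  have "comm_square C e0 e y0 y'" using c0 ce cp by (auto simp: comm_square_def)
  then obtain t where tt: "t \<in> Arr C" "Cod C t = Dom C p1" "p1 \<odot> t = e0" "p2 \<odot> t = e" "Dom C t = Dom C e0"
    using pullback_obtain[OF pp] by metis
  have i2: "is_iso C p2" using pushout_complement_pullback_iso[OF dec(1) poe l pp tt(1-4)] .
  obtain s where s: "s \<in> Arr C" "Dom C s = Cod C p2" "Cod C s = Dom C p2"
    "s \<odot> p2 = Id C (Dom C p2)" "p2 \<odot> s = Id C (Cod C p2)" using iso_inverse[OF i2] .
  have ap: "p1 \<in> Arr C" "p2 \<in> Arr C" "Dom C p1 = Dom C p2" "Cod C p1 = Dom C y0" "Cod C p2 = Dom C y'"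
    "y0 \<in> Arr C" "y0 \<odot> p1 = y' \<odot> p2" "d0 \<in> Arr C" "Dom C d0 = Dom C y0" "Cod C y0 = Dom C q"
    "Cod C d0 = Dom C y" "q \<odot> y0 = y \<odot> d0"
    using cp cb by (auto simp: comm_square_def)
  define d1 where "d1 = d0 \<odot> (p1 \<odot> s)"
  have ps: "p1 \<odot> s \<in> Arr C" "Dom C (p1 \<odot> s) = Dom C y'" "Cod C (p1 \<odot> s) = Dom C y0"
    using s ap by (simp_all add: comp_arr comp_dom comp_cod)
  have tp: "Cod C t = Dom C p2" using tt(2) ap(3) by simp
  have "s \<odot> e = (s \<odot> p2) \<odot> t" using comp_assoc[OF tt(1) ap(2) s(1) tp s(2)[symmetric]] tt(4) by simp
  then have "s \<odot> e = t" using s(4) id_left'[OF tt(1) tp] by simp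
  moreover have "(p1 \<odot> s) \<odot> e = p1 \<odot> (s \<odot> e)"
    by (rule comp_assoc) (use s ap y' in simp_all)
  ultimately have pse: "(p1 \<odot> s) \<odot> e = e0" using tt(3) by simp
  have "d1 \<odot> e = d0 \<odot> ((p1 \<odot> s) \<odot> e)" unfolding d1_def
    by (rule comp_assoc) (use ps ap y' in simp_all)
  then have de: "d1 \<odot> e = d" unfolding pse using e0(5) by simp
  have "y0 \<odot> (p1 \<odot> s) = (y0 \<odot> p1) \<odot> s"
    by (rule comp_assoc[symmetric]) (use s ap in simp_all)
  also have "\<dots> = y' \<odot> (p2 \<odot> s)" unfolding ap(7)
    by (rule comp_assoc) (use s ap y' in simp_all)
  also have "\<dots> = y'" unfolding s(5) by (rule id_right') (use ap y' in simp_all)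
  finally have yy: "y0 \<odot> (p1 \<odot> s) = y'" .
  have d1A: "d1 \<in> Arr C" "Dom C d1 = Dom C y'" "Cod C d1 = Dom C y"
    unfolding d1_def using ps ap by (simp_all add: comp_arr comp_dom comp_cod)
  have "q \<odot> (y0 \<odot> (p1 \<odot> s)) = (q \<odot> y0) \<odot> (p1 \<odot> s)"
    by (rule comp_assoc[symmetric]) (use ps ap qA in simp_all)
  also have "\<dots> = y \<odot> (d0 \<odot> (p1 \<odot> s))" unfolding ap(12)
    by (rule comp_assoc) (use ps ap t in simp_all)
  finally have "q \<odot> y' = y \<odot> d1" unfolding yy d1_def .
  then have "comm_square C y' d1 q y" using d1A y' ap qA t by (auto simp: comm_square_def)
  then have "is_pushout C y' d1 q y" using pushout_decompose[OF poe, of d1 q y] po de by simp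
  then show "\<exists>d1\<in>Arr C. Dom C d1 = Dom C y' \<and> d1 \<odot> e = d \<and> is_pushout C y' d1 q y"
    using d1A de by blast
qed

lemma pushout_factor:
  assumes po: "is_pushout C i d m x" and i: "i \<in> M"
    and po': "is_pushout C i e a y'"
    and d1: "d1 \<in> Arr C" "Dom C d1 = Cod C e" "d1 \<odot> e = d"
  shows "\<exists>g. is_pushout C y' d1 g x \<and> g \<odot> a = m \<and> Cod C a = Dom C g"
proof -
  note [simp] = comp_arr comp_dom comp_cod
  have c: "comm_square C i d m x" and c': "comm_square C i e a y'"
    using po po' by (auto intro: pushout_comm)
  have t: "i \<in> Arr C" "d \<in> Arr C" "m \<in> Arr C" "x \<in> Arr C" "e \<in> Arr C" "a \<in> Arr C" "y' \<in> Arr C"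
    "Dom C x = Cod C d" "Cod C m = Cod C x" "Dom C i = Dom C d" "Dom C i = Dom C e" "Cod C i = Dom C m"
    "Cod C i = Dom C a" "Dom C y' = Cod C e" "Cod C a = Cod C y'" "m \<odot> i = x \<odot> d" "a \<odot> i = y' \<odot> e"
    using c c' by (auto simp: comm_square_def)
  have d: "Cod C d1 = Cod C d" using d1 t by auto
  have "comm_square C i e m (x \<odot> d1)" using t d d1 by (simp add: comm_square_def comp_assoc)
  then obtain g where g: "g \<in> Arr C" "Dom C g = Cod C a" "Cod C g = Cod C m" "g \<odot> a = m" "g \<odot> y' = x \<odot> d1"
    using pushout_obtain[OF po'] by blast
  have "comm_square C y' d1 g x" using g t d d1 by (simp add: comm_square_def)
  then have "is_pushout C y' d1 g x" using pushout_decompose[OF po', of d1 g x] po d1 g by simp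
  then show ?thesis using g by auto
qed

lemma some_pushout_complement:
  assumes "has_pushout_complement C f h" "some_pushout_complement C f h = (g, k)"
  shows "is_pushout C f g h k"
proof -
  have "\<exists>z. case z of (g, k) \<Rightarrow> is_pushout C f g h k"
    using assms(1) by (auto simp: has_pushout_complement_def)
  from someI_ex[OF this] show ?thesis
    using assms(2) by (simp add: some_pushout_complement_def)
qed

lemma some_pushout:
  assumes "f \<in> M" "g \<in> Arr C" "Dom C f = Dom C g" "some_pushout C f g = (h, k)"
  shows "is_pushout C f g h k"
proof -
  have "\<exists>z. case z of (h, k) \<Rightarrow> is_pushout C f g h k"
    using M_pushout_ex[OF assms(1-3)] by auto
  from someI_ex[OF this] show ?thesis
    using assms(4) by (simp add: some_pushout_def)
qed

theorem sat_transport: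
  assumes "linear_rule C M r" "cond_over C M c (rule_output C r)"
    and "dpo_match C M r m" "dpo_comatch C r m m'"
  shows "sat C M (transport C c r) m \<longleftrightarrow> sat C M c m'"
  using assms
proof (induction c arbitrary: r m m')
  case (CExists a c)
  obtain l i where r: "r = (l, i)" by fastforce
  have li: "l \<in> M" "i \<in> M" "Dom C l = Dom C i" using CExists.prems r by (auto simp: linear_rule_def)
  have m: "m \<in> M" "Dom C m = Cod C i" using CExists.prems r by (auto simp: dpo_match_def)
  have a: "a \<in> M" "Dom C a = Cod C l" "cond_over C M c (Cod C a)" using CExists.prems r by auto
  obtain d x y where po: "is_pushout C i d m x" and po': "is_pushout C l d m' y"
    using CExists.prems r by (auto simp: dpo_comatch_def)
  have d: "d \<in> Arr C" "m' \<in> Arr C" "m \<in> Arr C" using pushout_comm[OF po] pushout_comm[OF po'] by (auto simp: comm_square_def)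
  have iA: "i \<in> Arr C" "a \<in> Arr C" using li a by (auto intro: M_arr)
  show ?case
  proof (cases "has_pushout_complement C l a")
    case False
    have "\<not> sat C M (CExists a c) m'"
    proof
      assume "sat C M (CExists a c) m'"
      then obtain q where q: "q \<in> M" "Dom C q = Cod C a" "q \<odot> a = m'" by auto
      have "has_pushout_complement C l a"
        by (rule pushout_complement_decompose(1)[of l d q a y]) (use po' q li a iA in auto)
      with False show False ..
    qed
    with False r show ?thesis by simp
  next
    case True
    obtain e l' where e: "some_pushout_complement C l a = (e, l')" by fastforce
    obtain a' i' where a': "some_pushout C i e = (a', i')" by fastforce
    have pe: "is_pushout C l e a l'" using some_pushout_complement[OF True e] .
    have ce: "e \<in> Arr C" "Dom C e = Dom C i" "Dom C l' = Cod C e" "Cod C l' = Cod C a"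
      using pushout_comm[OF pe] li by (auto simp: comm_square_def)
    have pa: "is_pushout C i e a' i'"
      using some_pushout[OF li(2) ce(1) _ a'] ce by simp
    have ca: "a' \<in> Arr C" "Dom C a' = Cod C i" "Dom C i' = Cod C e" "Cod C i' = Cod C a'"
      using pushout_comm[OF pa] by (auto simp: comm_square_def)
    have l'M: "l' \<in> M" "i' \<in> M" using M_pushout_stable[OF pe] M_pushout_stable[OF pa] li by auto
    have lr: "linear_rule C M (l', i')" using l'M ce ca by (auto simp: linear_rule_def)
    have tr: "transport C (CExists a c) r = CExists a' (transport C c (l', i'))"
      using True r e a' by simp
    have ih: "sat C M (transport C c (l', i')) g \<longleftrightarrow> sat C M c q"
      if g: "g \<in> M" and pg: "is_pushout C i' d1 g x" and pq: "is_pushout C l' d1 q y" for g q d1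
    proof (rule CExists.IH[OF lr])
      show "cond_over C M c (rule_output C (l', i'))" using a ce by simp
      show "dpo_match C M (l', i') g" unfolding dpo_match_def has_pushout_complement_def
        using g pg pushout_comm[OF pg] by (auto simp: comm_square_def)
      show "dpo_comatch C (l', i') g q" using pg pq by (auto simp: dpo_comatch_def)
    qed
    show ?thesis
    proof
      assume "sat C M (transport C (CExists a c) r) m"
      then obtain g where g: "g \<in> M" "Dom C g = Cod C a'" "g \<odot> a' = m" "sat C M (transport C c (l', i')) g"
        unfolding tr by auto
      have "\<exists>d1\<in>Arr C. Dom C d1 = Dom C i' \<and> d1 \<odot> e = d \<and> is_pushout C i' d1 g x"
        by (rule pushout_complement_decompose(2)[of i d g a']) (use po g li ca pa in auto)
      then obtain d1 where d1: "d1 \<in> Arr C" "Dom C d1 = Dom C i'" "d1 \<odot> e = d" "is_pushout C i' d1 g x" by blast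
      obtain q where q: "is_pushout C l' d1 q y" "q \<odot> a = m'" "Cod C a = Dom C q"
        using pushout_factor[OF po' li(1) pe d1(1) _ d1(3)] d1 ca by auto
      have "d1 \<in> M" using M_pullback_stable[OF pushout_along_M_is_pullback[OF d1(4) l'M(2)] g(1)] .
      then have "q \<in> M" using M_pushout_stable[OF pushout_sym[OF q(1)]] by blast
      moreover have "sat C M c q" using ih[OF g(1) d1(4) q(1)] g by simp
      ultimately show "sat C M (CExists a c) m'" using q by auto
    next
      assume "sat C M (CExists a c) m'"
      then obtain q where q: "q \<in> M" "Dom C q = Cod C a" "q \<odot> a = m'" "sat C M c q" by auto
      have "\<exists>d1\<in>Arr C. Dom C d1 = Dom C l' \<and> d1 \<odot> e = d \<and> is_pushout C l' d1 q y"
        by (rule pushout_complement_decompose(2)[of l d q a]) (use po' q li a iA pe in auto)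
      then obtain d1 where d1: "d1 \<in> Arr C" "Dom C d1 = Dom C l'" "d1 \<odot> e = d" "is_pushout C l' d1 q y" by blast
      obtain g where g: "is_pushout C i' d1 g x" "g \<odot> a' = m" "Cod C a' = Dom C g"
        using pushout_factor[OF po li(2) pa d1(1) _ d1(3)] d1 ce by auto
      have "d1 \<in> M" using M_pullback_stable[OF pushout_along_M_is_pullback[OF d1(4) l'M(1)] q(1)] .
      then have gM: "g \<in> M" using M_pushout_stable[OF pushout_sym[OF g(1)]] by blast
      moreover have "sat C M (transport C c (l', i')) g" using ih[OF gM g(1) d1(4)] q by simp
      ultimately show "sat C M (transport C (CExists a c) r) m" unfolding tr using g by auto
    qed
  qed
next
  case (CConj J F)
  have "sat C M (transport C (F j) r) m \<longleftrightarrow> sat C M (F j) m'" if "j \<in> J" for j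
    by (rule CConj.IH) (use CConj.prems that in auto)
  then show ?case by auto
qed auto

end

context rewriting_category
begin

theorem sat_shift:
  assumes "cond_over C M c (Dom C p)" "p \<in> M" "n \<in> M" "Dom C n = Cod C p"
  shows "sat C M (shift C M c p) n \<longleftrightarrow> sat C M c (n \<odot> p)"
  using assms
proof (induction c arbitrary: p n)
  case (CExists a c)
  note [simp] = comp_arr comp_dom comp_cod
  have a: "a \<in> M" "Dom C a = Dom C p" "cond_over C M c (Cod C a)" using CExists.prems by auto
  have A: "p \<in> Arr C" "n \<in> Arr C" "a \<in> Arr C" using CExists.prems a by (auto intro: M_arr)
  have sh: "sat C M (shift C M (CExists a c) p) n \<longleftrightarrow>
    (\<exists>(a', p') \<in> shift_squares C M p a. \<exists>q\<in>M. Dom C q = Cod C a' \<and> q \<odot> a' = n \<and> sat C M (shift C M c p') q)"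
    by (simp add: CDisj_def case_prod_beta) blast
  have ih: "sat C M (shift C M c p') q \<longleftrightarrow> sat C M c (q \<odot> p')"
    if "(a', p') \<in> shift_squares C M p a" "q \<in> M" "Dom C q = Cod C a'" for a' p' q
    by (rule CExists.IH) (use that a in \<open>auto simp: shift_squares_def comm_square_def\<close>)
  show ?case unfolding sh
  proof
    assume "\<exists>(a', p') \<in> shift_squares C M p a. \<exists>q\<in>M. Dom C q = Cod C a' \<and> q \<odot> a' = n \<and> sat C M (shift C M c p') q"
    then obtain a' p' q where s: "(a', p') \<in> shift_squares C M p a"
      and q: "q \<in> M" "Dom C q = Cod C a'" "q \<odot> a' = n" "sat C M c (q \<odot> p')"
      using ih by blast
    have s': "a' \<in> Arr C" "p' \<in> M" "p' \<in> Arr C" "Dom C p' = Cod C a" "Cod C a' = Cod C p'" "a' \<odot> p = p' \<odot> a"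
      "Dom C a' = Cod C p"
      using s by (auto simp: shift_squares_def comm_square_def)
    have qA: "q \<in> Arr C" using q by (auto intro: M_arr)
    have "(q \<odot> p') \<odot> a = (q \<odot> a') \<odot> p"
      using comp_assoc[of a p' q] comp_assoc[of p a' q] s' A q qA by simp
    then have "(q \<odot> p') \<odot> a = n \<odot> p" using q by simp
    moreover have "q \<odot> p' \<in> M" using M_comp[of p' q] s' q by simp
    moreover have "Dom C (q \<odot> p') = Cod C a" using s' q qA by simp
    ultimately show "sat C M (CExists a c) (n \<odot> p)" using q(4) by auto
  next
    assume "sat C M (CExists a c) (n \<odot> p)"
    then obtain q where q: "q \<in> M" "Dom C q = Cod C a" "q \<odot> a = n \<odot> p" "sat C M c q" by auto
    have qA: "q \<in> Arr C" using q by (auto intro: M_arr)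
    have cod: "Cod C n = Cod C q" using q A qA CExists.prems by (metis comp_cod)
    obtain f g where pb: "is_pullback C f g n q" using M_pullback_ex[OF CExists.prems(3) qA cod] by blast
    have cpb: "comm_square C f g n q" using pb by (rule pullback_comm)
    have fg: "f \<in> M" "g \<in> M" using M_pullback_stable[OF pb] M_pullback_stable[OF pullback_sym[OF pb]] CExists.prems q by auto
    have fgA: "g \<in> Arr C" "Dom C f = Dom C g" using cpb by (auto simp: comm_square_def)
    obtain a' p' where po: "is_pushout C f g a' p'" using M_pushout_ex[OF fg(1) fgA] by blast
    have cpo: "comm_square C f g a' p'" using po by (rule pushout_comm)
    obtain u where u: "u \<in> Arr C" "Dom C u = Cod C a'" "Cod C u = Cod C n" "u \<odot> a' = n" "u \<odot> p' = q"
      using pushout_obtain[OF po cpb] by blast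
    have uM: "u \<in> M"
      using effective_unions[unfolded M_effective_unions_def, rule_format, of n q f g a' p' u]
        CExists.prems q pb po u by (auto simp: hom_def)
    have s: "a' \<in> Arr C" "p' \<in> Arr C" "Cod C a' = Cod C p'" "Dom C a' = Dom C n" "Dom C p' = Dom C q"
      using cpo cpb by (auto simp: comm_square_def)
    have M': "a' \<in> M" "p' \<in> M"
      using M_decomp[of a' u] M_decomp[of p' u] uM u s CExists.prems q by auto
    have "comm_square C p a n q" using A qA q a CExists.prems cod by (auto simp: comm_square_def)
    then obtain t where t: "t \<in> Arr C" "Dom C t = Dom C p" "Cod C t = Dom C f" "f \<odot> t = p" "g \<odot> t = a"
      using pullback_obtain[OF pb] by metis
    have "comm_square C (f \<odot> t) (g \<odot> t) a' p'" using comm_square_pre[OF cpo] t by blast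
    then have "comm_square C p a a' p'" using t by simp
    then have ss: "(a', p') \<in> shift_squares C M p a"
      using M' pushout_jointly_epic[OF po] by (simp add: shift_squares_def)
    moreover have "sat C M (shift C M c p') u" using ih[OF ss uM u(2)] u q by simp
    ultimately show "\<exists>(a', p') \<in> shift_squares C M p a. \<exists>q\<in>M. Dom C q = Cod C a' \<and> q \<odot> a' = n \<and> sat C M (shift C M c p') q"
      using uM u by blast
  qed
next
  case (CConj J F)
  have "sat C M (shift C M (F j) p) n \<longleftrightarrow> sat C M (F j) (n \<odot> p)" if "j \<in> J" for j
    by (rule CConj.IH) (use CConj.prems that in auto)
  then show ?case by auto
qed auto

end

end

theory Submission
  imports Defs
begin

text \<open>
  A pair of matches on either side amounts to one derivation \<open>A \<Rightarrow> B\<close> by the middle rule together with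
  \<open>M\<close>-morphisms \<open>O1 \<rightarrow> A\<close> and \<open>I3 \<rightarrow> B\<close>, such that \<open>A \<Rightarrow> B\<close> is generated by \<open>O1\<close>, \<open>I2\<close>, \<open>O2\<close>, \<open>I3\<close>. On the
  left the generation condition says that \<open>I3\<close> and the rewritten union of \<open>O1\<close> and \<open>I2\<close> cover \<open>B\<close>; on the
  right, that \<open>O1\<close> and the back-rewritten union of \<open>O2\<close> and \<open>I3\<close> cover \<open>A\<close>. These agree because rewriting
  identifies the subobjects of \<open>A\<close> above \<open>I2\<close> with those of \<open>B\<close> above \<open>O2\<close>, both being given by
  subobjects of the common context.

  The composite conditions agree even for matches that are not DPO-admissible, which is needed because
  admissibility of a span quantifies over all \<open>M\<close>-morphisms. For a match \<open>h\<close> into \<open>X\<close>, the subobjects of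
  \<open>X\<close> through which \<open>h\<close> becomes DPO-admissible are closed under effective unions; as \<open>X\<close> is
  finite there is a largest one, and transported conditions only depend on it.
\<close>

section \<open>Squares and isomorphisms\<close>

text \<open>Matches are classes of spans, while \<open>composite\<close> works along the
  \<open>SOME\<close> representative of a class with \<open>SOME\<close>-chosen pushouts, pullbacks
  and complements. The second match of a pair is a span over an object of that particular composite,
  so second matches can be compared only after the first representatives agree. Hence the
  correspondence is a relation on concrete spans, proved total and single-valued in both directions,
  and partners are always produced as the chosen representatives of their own classes. Much of the
  right-bracketed side is obtained from the left-bracketed one by reversing rules with
  \<open>prod.swap\<close>. The hypotheses enter at few places: effective unions underlie
  \<open>sat_shift\<close>, embed \<open>N21\<close> into \<open>A\<close> and join admissible
  subobjects; balancedness turns a jointly epic pair of \<open>M\<close>-morphisms into a pushout;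
  the van Kampen property carries generation from \<open>B\<close> to the common context and glues
  the contexts of successive rules.\<close>

context category
begin

declare comp_arr [simp] comp_dom [simp] comp_cod [simp]

lemma comm_assoc:
  assumes "comm_square C f g h k" "t \<in> Arr C" "Cod C t = Dom C f"
  shows "h \<odot> (f \<odot> t) = k \<odot> (g \<odot> t)"
  using assms comp_assoc[of t f h] comp_assoc[of t g k] by (simp add: comm_square_def)

lemma comp_assoc_eq:
  assumes "a \<odot> b = c" "a \<in> Arr C" "b \<in> Arr C" "Cod C b = Dom C a" "t \<in> Arr C" "Cod C t = Dom C b"
  shows "a \<odot> (b \<odot> t) = c \<odot> t"
  using assms comp_assoc[of t b a] by simp

lemma is_isoI:
  assumes "f \<in> Arr C" "g \<in> Arr C" "Dom C g = Cod C f" "Cod C g = Dom C f"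
    "g \<odot> f = Id C (Dom C f)" "f \<odot> g = Id C (Cod C f)"
  shows "is_iso C f"
  using assms unfolding is_iso_def hom_def by blast

lemma iso_arr: "is_iso C f \<Longrightarrow> f \<in> Arr C"
  by (simp add: is_iso_def)

lemma iso_obtain_inverse:
  assumes "is_iso C f"
  obtains g where "is_iso C g" "g \<in> Arr C" "Dom C g = Cod C f" "Cod C g = Dom C f"
    "g \<odot> f = Id C (Dom C f)" "f \<odot> g = Id C (Cod C f)"
proof -
  obtain g where g: "g \<in> Arr C" "Dom C g = Cod C f" "Cod C g = Dom C f"
    "g \<odot> f = Id C (Dom C f)" "f \<odot> g = Id C (Cod C f)"
    using assms unfolding is_iso_def hom_def by blast
  moreover have "is_iso C g" using is_isoI[of g f] g assms by (simp add: iso_arr)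
  ultimately show thesis using that by blast
qed

lemma iso_inverse_left:
  assumes "g \<odot> f = Id C (Dom C f)" "f \<in> Arr C" "g \<in> Arr C" "Cod C f = Dom C g" "t \<in> Arr C" "Cod C t = Dom C f"
  shows "g \<odot> (f \<odot> t) = t"
  using assms comp_assoc[of t f g] id_left'[of t] by simp

lemma iso_comp:
  assumes "is_iso C f" "is_iso C g" "Cod C f = Dom C g"
  shows "is_iso C (g \<odot> f)"
proof -
  obtain f' where f': "f' \<in> Arr C" "Dom C f' = Cod C f" "Cod C f' = Dom C f"
    "f' \<odot> f = Id C (Dom C f)" "f \<odot> f' = Id C (Cod C f)" using assms(1) by (rule iso_obtain_inverse)
  obtain g' where g': "g' \<in> Arr C" "Dom C g' = Cod C g" "Cod C g' = Dom C g"
    "g' \<odot> g = Id C (Dom C g)" "g \<odot> g' = Id C (Cod C g)" using assms(2) by (rule iso_obtain_inverse)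
  have a: "f \<in> Arr C" "g \<in> Arr C" using assms by (auto intro: iso_arr)
  show ?thesis
  proof (rule is_isoI[of _ "f' \<odot> g'"])
    show "(f' \<odot> g') \<odot> (g \<odot> f) = Id C (Dom C (g \<odot> f))"
      using comp_assoc[of "g \<odot> f" g' f'] iso_inverse_left[of g' g f] f' g' a assms(3) by simp
    show "(g \<odot> f) \<odot> (f' \<odot> g') = Id C (Cod C (g \<odot> f))"
      using comp_assoc[of "f' \<odot> g'" f g] iso_inverse_left[of f f' g'] f' g' a assms(3) by simp
  qed (use f' g' a assms(3) in simp_all)
qed

lemma monoD:
  assumes "is_mono C f" "f \<odot> u = f \<odot> v" "u \<in> Arr C" "v \<in> Arr C" "Dom C u = Dom C v" "Cod C u = Dom C f" "Cod C v = Dom C f"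
  shows "u = v"
  using assms unfolding is_mono_def by blast

lemma iso_mono:
  assumes "is_iso C f"
  shows "is_mono C f"
  unfolding is_mono_def
proof (intro conjI ballI impI)
  obtain g where g: "g \<in> Arr C" "Dom C g = Cod C f" "Cod C g = Dom C f" "g \<odot> f = Id C (Dom C f)"
    using assms by (rule iso_obtain_inverse)
  show f: "f \<in> Arr C" using assms by (rule iso_arr)
  fix u v assume "u \<in> Arr C" "v \<in> Arr C"
    "Dom C u = Dom C v \<and> Cod C u = Dom C f \<and> Cod C v = Dom C f \<and> f \<odot> u = f \<odot> v"
  then show "u = v"
    using iso_inverse_left[of g f u] iso_inverse_left[of g f v] f g by metis
qed

lemma jointly_epicD:
  assumes "jointly_epic C a b" "u \<odot> a = v \<odot> a" "u \<odot> b = v \<odot> b" "u \<in> Arr C" "v \<in> Arr C" "Cod C u = Cod C v"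
    "Dom C u = Cod C a" "Dom C v = Cod C a"
  shows "u = v"
  using assms unfolding jointly_epic_def by blast

lemma pullback_unique:
  assumes "is_pullback C f g h k" "u \<in> Arr C" "v \<in> Arr C" "Dom C u = Dom C v"
    "Cod C u = Dom C f" "Cod C v = Dom C f" "f \<odot> u = f \<odot> v" "g \<odot> u = g \<odot> v"
  shows "u = v"
proof -
  have "comm_square C (f \<odot> u) (g \<odot> u) h k"
    using comm_square_pre[OF pullback_comm[OF assms(1)]] assms by simp
  then have "\<exists>!w. w \<in> hom C (Dom C (f \<odot> u)) (Dom C f) \<and> f \<odot> w = f \<odot> u \<and> g \<odot> w = g \<odot> u"
    using assms(1) unfolding is_pullback_def by blast
  moreover have "Dom C (f \<odot> u) = Dom C u"
    using assms pullback_comm[OF assms(1)] by (intro comp_dom) (auto simp: comm_square_def)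
  ultimately show ?thesis using assms by (auto simp: hom_def)
qed

lemma pullbackI:
  assumes "comm_square C f g h k"
    and "\<And>f' g'. comm_square C f' g' h k \<Longrightarrow>
      \<exists>u\<in>Arr C. Dom C u = Dom C f' \<and> Cod C u = Dom C f \<and> f \<odot> u = f' \<and> g \<odot> u = g'"
    and "\<And>u v. \<lbrakk>u \<in> Arr C; v \<in> Arr C; Dom C u = Dom C v; Cod C u = Dom C f; Cod C v = Dom C f;
      f \<odot> u = f \<odot> v; g \<odot> u = g \<odot> v\<rbrakk> \<Longrightarrow> u = v"
  shows "is_pullback C f g h k"
  unfolding is_pullback_def
proof (intro conjI allI impI)
  fix f' g' assume "comm_square C f' g' h k"
  then obtain u where u: "u \<in> Arr C" "Dom C u = Dom C f'" "Cod C u = Dom C f" "f \<odot> u = f'" "g \<odot> u = g'"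
    using assms(2) by blast
  show "\<exists>!u. u \<in> hom C (Dom C f') (Dom C f) \<and> f \<odot> u = f' \<and> g \<odot> u = g'"
    by (rule ex1I[of _ u]) (use u assms(3) in \<open>auto simp: hom_def\<close>)
qed (fact assms(1))

lemma pullback_compose:
  assumes p1: "is_pullback C f g h k" and p2: "is_pullback C k g2 h2 k2"
  shows "is_pullback C f (g2 \<odot> g) (h2 \<odot> h) k2"
proof (rule pullbackI)
  have c1: "comm_square C f g h k" and c2: "comm_square C k g2 h2 k2"
    using p1 p2 by (auto intro: pullback_comm)
  have t: "f \<in> Arr C" "g \<in> Arr C" "h \<in> Arr C" "k \<in> Arr C" "g2 \<in> Arr C" "h2 \<in> Arr C" "k2 \<in> Arr C"
    "Dom C f = Dom C g" "Cod C f = Dom C h" "Cod C g = Dom C k" "Cod C h = Cod C k"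
    "h \<odot> f = k \<odot> g" "Dom C k = Dom C g2" "Cod C k = Dom C h2" "Cod C g2 = Dom C k2" "Cod C h2 = Cod C k2"
    "h2 \<odot> k = k2 \<odot> g2"
    using c1 c2 by (auto simp: comm_square_def)
  show "comm_square C f (g2 \<odot> g) (h2 \<odot> h) k2"
    unfolding comm_square_def using t comm_assoc[OF c2, of g] by (simp add: comp_assoc)
  show "\<exists>u\<in>Arr C. Dom C u = Dom C f' \<and> Cod C u = Dom C f \<and> f \<odot> u = f' \<and> (g2 \<odot> g) \<odot> u = g'"
    if s: "comm_square C f' g' (h2 \<odot> h) k2" for f' g'
  proof -
    have "comm_square C (h \<odot> f') g' h2 k2"
      using s t comp_assoc[of f' h h2] by (auto simp: comm_square_def)
    then obtain v where v: "v \<in> Arr C" "Dom C v = Dom C (h \<odot> f')" "Cod C v = Dom C k" "k \<odot> v = h \<odot> f'" "g2 \<odot> v = g'"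
      using pullback_obtain[OF p2] by blast
    have "comm_square C f' v h k" using v s t by (simp add: comm_square_def)
    then obtain w where w: "w \<in> Arr C" "Dom C w = Dom C f'" "Cod C w = Dom C f" "f \<odot> w = f'" "g \<odot> w = v"
      using pullback_obtain[OF p1] by blast
    then show ?thesis using v t by (intro bexI[of _ w]) (simp_all add: comp_assoc)
  qed
  fix u v assume u: "u \<in> Arr C" "v \<in> Arr C" "Dom C u = Dom C v" "Cod C u = Dom C f" "Cod C v = Dom C f"
      "f \<odot> u = f \<odot> v" "(g2 \<odot> g) \<odot> u = (g2 \<odot> g) \<odot> v"
  have "g \<odot> u = g \<odot> v"
  proof (rule pullback_unique[OF p2])
    show "k \<odot> (g \<odot> u) = k \<odot> (g \<odot> v)" using comm_assoc[OF c1, of u] comm_assoc[OF c1, of v] u by simp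
  qed (use u t in \<open>simp_all add: comp_assoc\<close>)
  then show "u = v" using pullback_unique[OF p1] u by blast
qed

lemma pullback_decompose:
  assumes p2: "is_pullback C k g2 h2 k2" and p: "is_pullback C f (g2 \<odot> g) (h2 \<odot> h) k2"
    and c1: "comm_square C f g h k"
  shows "is_pullback C f g h k"
proof (rule pullbackI)
  have c2: "comm_square C k g2 h2 k2" using p2 by (rule pullback_comm)
  have t: "f \<in> Arr C" "g \<in> Arr C" "h \<in> Arr C" "k \<in> Arr C" "g2 \<in> Arr C" "h2 \<in> Arr C" "k2 \<in> Arr C"
    "Dom C f = Dom C g" "Cod C f = Dom C h" "Cod C g = Dom C k" "Cod C h = Cod C k"
    "h \<odot> f = k \<odot> g" "Dom C k = Dom C g2" "Cod C k = Dom C h2" "Cod C g2 = Dom C k2" "Cod C h2 = Cod C k2"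
    "h2 \<odot> k = k2 \<odot> g2"
    using c1 c2 by (auto simp: comm_square_def)
  show "comm_square C f g h k" by (fact c1)
  show "\<exists>u\<in>Arr C. Dom C u = Dom C f' \<and> Cod C u = Dom C f \<and> f \<odot> u = f' \<and> g \<odot> u = g'"
    if s: "comm_square C f' g' h k" for f' g'
  proof -
    have s': "f' \<in> Arr C" "g' \<in> Arr C" "Dom C f' = Dom C g'" "Cod C f' = Dom C h" "Cod C g' = Dom C k" "h \<odot> f' = k \<odot> g'"
      using s by (auto simp: comm_square_def)
    have "comm_square C f' (g2 \<odot> g') (h2 \<odot> h) k2"
      unfolding comm_square_def using s' t comm_assoc[OF c2, of g'] by (simp add: comp_assoc)
    then obtain w where w: "w \<in> Arr C" "Dom C w = Dom C f'" "Cod C w = Dom C f" "f \<odot> w = f'" "(g2 \<odot> g) \<odot> w = g2 \<odot> g'"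
      using pullback_obtain[OF p] by blast
    have "g \<odot> w = g'"
    proof (rule pullback_unique[OF p2])
      show "k \<odot> (g \<odot> w) = k \<odot> g'" using comm_assoc[OF c1, of w] w s' by simp
    qed (use w s' t in \<open>simp_all add: comp_assoc\<close>)
    then show ?thesis using w by blast
  qed
  fix u v assume "u \<in> Arr C" "v \<in> Arr C" "Dom C u = Dom C v" "Cod C u = Dom C f" "Cod C v = Dom C f"
      "f \<odot> u = f \<odot> v" "g \<odot> u = g \<odot> v"
  then show "u = v" using pullback_unique[OF p, of u v] t by (simp add: comp_assoc)
qed

lemma pushout_iso_unique:
  assumes p: "is_pushout C f g h k" and p': "is_pushout C f g h' k'"
  obtains \<phi> where "is_iso C \<phi>" "\<phi> \<in> Arr C" "Dom C \<phi> = Cod C h" "Cod C \<phi> = Cod C h'" "\<phi> \<odot> h = h'" "\<phi> \<odot> k = k'"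
proof -
  note [simp] = id_arr id_dom id_cod cod_obj id_left id_left'
  have c: "comm_square C f g h k" and c': "comm_square C f g h' k'" using p p' by (auto intro: pushout_comm)
  have t: "h \<in> Arr C" "k \<in> Arr C" "h' \<in> Arr C" "k' \<in> Arr C" "Cod C h = Cod C k" "Cod C h' = Cod C k'"
    using c c' by (auto simp: comm_square_def)
  obtain \<phi> where \<phi>: "\<phi> \<in> Arr C" "Dom C \<phi> = Cod C h" "Cod C \<phi> = Cod C h'" "\<phi> \<odot> h = h'" "\<phi> \<odot> k = k'"
    using pushout_obtain[OF p c'] .
  obtain \<psi> where \<psi>: "\<psi> \<in> Arr C" "Dom C \<psi> = Cod C h'" "Cod C \<psi> = Cod C h" "\<psi> \<odot> h' = h" "\<psi> \<odot> k' = k"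
    using pushout_obtain[OF p' c] .
  have "\<psi> \<odot> \<phi> = Id C (Cod C h)"
  proof (rule pushout_unique[OF p])
    show "(\<psi> \<odot> \<phi>) \<odot> k = Id C (Cod C h) \<odot> k" using \<phi> \<psi> t by (simp add: comp_assoc)
  qed (use \<phi> \<psi> t in \<open>simp_all add: comp_assoc\<close>)
  moreover have "\<phi> \<odot> \<psi> = Id C (Cod C h')"
  proof (rule pushout_unique[OF p'])
    show "(\<phi> \<odot> \<psi>) \<odot> k' = Id C (Cod C h') \<odot> k'" using \<phi> \<psi> t by (simp add: comp_assoc)
  qed (use \<phi> \<psi> t in \<open>simp_all add: comp_assoc\<close>)
  ultimately have "is_iso C \<phi>" using is_isoI[of \<phi> \<psi>] \<phi> \<psi> by simp
  then show thesis using that \<phi> by blast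
qed

lemma pullback_iso_unique:
  assumes p: "is_pullback C f g h k" and p': "is_pullback C f' g' h k"
  obtains \<phi> where "is_iso C \<phi>" "\<phi> \<in> Arr C" "Dom C \<phi> = Dom C f" "Cod C \<phi> = Dom C f'" "f' \<odot> \<phi> = f" "g' \<odot> \<phi> = g"
proof -
  note [simp] = id_arr id_dom id_cod dom_obj
  have c: "comm_square C f g h k" and c': "comm_square C f' g' h k" using p p' by (auto intro: pullback_comm)
  have t: "f \<in> Arr C" "g \<in> Arr C" "f' \<in> Arr C" "g' \<in> Arr C" "Dom C f = Dom C g" "Dom C f' = Dom C g'"
    using c c' by (auto simp: comm_square_def)
  obtain \<phi> where \<phi>: "\<phi> \<in> Arr C" "Dom C \<phi> = Dom C f" "Cod C \<phi> = Dom C f'" "f' \<odot> \<phi> = f" "g' \<odot> \<phi> = g"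
    using pullback_obtain[OF p' c] .
  obtain \<psi> where \<psi>: "\<psi> \<in> Arr C" "Dom C \<psi> = Dom C f'" "Cod C \<psi> = Dom C f" "f \<odot> \<psi> = f'" "g \<odot> \<psi> = g'"
    using pullback_obtain[OF p c'] .
  have "\<psi> \<odot> \<phi> = Id C (Dom C f)"
  proof (rule pullback_unique[OF p])
    show "f \<odot> (\<psi> \<odot> \<phi>) = f \<odot> Id C (Dom C f)"
      using comp_assoc_eq[OF \<psi>(4), of \<phi>] id_right'[of f] \<phi> \<psi> t by simp
    show "g \<odot> (\<psi> \<odot> \<phi>) = g \<odot> Id C (Dom C f)"
      using comp_assoc_eq[OF \<psi>(5), of \<phi>] id_right'[of g] \<phi> \<psi> t by simp
  qed (use \<phi> \<psi> t in simp_all)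
  moreover have "\<phi> \<odot> \<psi> = Id C (Dom C f')"
  proof (rule pullback_unique[OF p'])
    show "f' \<odot> (\<phi> \<odot> \<psi>) = f' \<odot> Id C (Dom C f')"
      using comp_assoc_eq[OF \<phi>(4), of \<psi>] id_right'[of f'] \<phi> \<psi> t by simp
    show "g' \<odot> (\<phi> \<odot> \<psi>) = g' \<odot> Id C (Dom C f')"
      using comp_assoc_eq[OF \<phi>(5), of \<psi>] id_right'[of g'] \<phi> \<psi> t by simp
  qed (use \<phi> \<psi> t in simp_all)
  ultimately have "is_iso C \<phi>" using is_isoI[of \<phi> \<psi>] \<phi> \<psi> by simp
  then show thesis using that \<phi> by blast
qed

text \<open>With \<open>g'\<close> and \<open>h'\<close> the inverses,
  \<open>k = h \<odot> (f \<odot> g')\<close> and the mediating arrow is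
  \<open>h1 \<odot> h'\<close>. Pasting such a square onto a pushout moves one of its corners along
  an isomorphism, which is how \<open>pushout_post_iso\<close>, \<open>pushout_pre_iso\<close> and
  \<open>pushout_context_iso\<close> are obtained.\<close>

lemma iso_square_pushout:
  assumes c: "comm_square C f g h k" and g: "is_iso C g" and h: "is_iso C h"
  shows "is_pushout C f g h k"
proof (rule pushoutI[OF c])
  obtain g' where g': "g' \<in> Arr C" "Dom C g' = Cod C g" "Cod C g' = Dom C g"
    "g' \<odot> g = Id C (Dom C g)" "g \<odot> g' = Id C (Cod C g)" using g by (rule iso_obtain_inverse)
  obtain h' where h': "h' \<in> Arr C" "Dom C h' = Cod C h" "Cod C h' = Dom C h"
    "h' \<odot> h = Id C (Dom C h)" "h \<odot> h' = Id C (Cod C h)" using h by (rule iso_obtain_inverse)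
  have t: "f \<in> Arr C" "g \<in> Arr C" "h \<in> Arr C" "k \<in> Arr C" "Dom C f = Dom C g" "Cod C f = Dom C h" "Cod C g = Dom C k"
    "Cod C h = Cod C k" "h \<odot> f = k \<odot> g" using c by (auto simp: comm_square_def)
  have kk: "k = h \<odot> (f \<odot> g')"
    using comm_assoc[OF c, of g'] g' t id_right'[of k] by simp
  have cancel: "(u \<odot> h) \<odot> h' = u" if "u \<in> Arr C" "Dom C u = Cod C h" for u
    using that comp_assoc[of h' h u] h' t id_right'[of u] by simp
  show "\<exists>u\<in>Arr C. Dom C u = Cod C h \<and> Cod C u = Cod C h1 \<and> u \<odot> h = h1 \<and> u \<odot> k = k1"
    if c1: "comm_square C f g h1 k1" for h1 k1
  proof -
    have t1: "h1 \<in> Arr C" "k1 \<in> Arr C" "Dom C h1 = Dom C h" "Dom C k1 = Cod C g" "Cod C h1 = Cod C k1" "h1 \<odot> f = k1 \<odot> g"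
      using c1 t by (auto simp: comm_square_def)
    have 1: "(h1 \<odot> h') \<odot> h = h1" using t1 t h' id_right'[of h1] by (simp add: comp_assoc)
    have "(h1 \<odot> h') \<odot> k = ((h1 \<odot> h') \<odot> h) \<odot> (f \<odot> g')"
      unfolding kk using comp_assoc[of "f \<odot> g'" h "h1 \<odot> h'"] t t1 g' h' by simp
    also have "\<dots> = k1" using 1 comm_assoc[OF c1, of g'] t t1 g' id_right'[of k1] by simp
    finally show ?thesis using 1 t t1 h' by (intro bexI[of _ "h1 \<odot> h'"]) simp_all
  qed
  show "jointly_epic C h k" unfolding jointly_epic_def using t cancel by metis
qed

lemma pushout_post_iso:
  assumes p: "is_pushout C f g h k" and i: "is_iso C \<phi>" "Dom C \<phi> = Cod C h"
  shows "is_pushout C f g (\<phi> \<odot> h) (\<phi> \<odot> k)"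
proof -
  note [simp] = id_arr id_dom id_cod dom_obj cod_obj id_left
  have t: "k \<in> Arr C" "h \<in> Arr C" "g \<in> Arr C" "Cod C h = Cod C k" "Cod C g = Dom C k" using pushout_comm[OF p] by (auto simp: comm_square_def)
  have "is_pushout C k (Id C (Dom C k)) \<phi> (\<phi> \<odot> k)"
    by (rule iso_square_pushout)
      (use t i iso_arr[OF i(1)] id_right'[of "\<phi> \<odot> k"] in \<open>auto simp: comm_square_def id_iso\<close>)
  from pushout_compose[OF p this] show ?thesis using t id_left'[of g "Dom C k"] by simp
qed

lemma pushout_pre_iso:
  assumes p: "is_pushout C f g h k" and i: "is_iso C \<phi>" "Cod C \<phi> = Dom C f"
  shows "is_pushout C (f \<odot> \<phi>) (g \<odot> \<phi>) h k"
proof -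
  note [simp] = id_arr id_dom id_cod dom_obj cod_obj id_left
  have t: "f \<in> Arr C" "h \<in> Arr C" "Dom C h = Cod C f" using pushout_comm[OF p] by (auto simp: comm_square_def)
  have "is_pushout C (f \<odot> \<phi>) \<phi> (Id C (Cod C f)) f"
    by (rule iso_square_pushout)
      (use t i iso_arr[OF i(1)] id_left'[of "f \<odot> \<phi>"] in \<open>auto simp: comm_square_def id_iso\<close>)
  from pushout_compose[OF this p] show ?thesis using t id_right'[of h "Cod C f"] by simp
qed

lemma pullback_pre_iso:
  assumes p: "is_pullback C f g h k" and i: "is_iso C \<phi>" "Cod C \<phi> = Dom C f"
  shows "is_pullback C (f \<odot> \<phi>) (g \<odot> \<phi>) h k"
proof (rule pullbackI)
  obtain \<psi> where \<psi>: "\<psi> \<in> Arr C" "Dom C \<psi> = Cod C \<phi>" "Cod C \<psi> = Dom C \<phi>"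
    "\<psi> \<odot> \<phi> = Id C (Dom C \<phi>)" "\<phi> \<odot> \<psi> = Id C (Cod C \<phi>)" using i(1) by (rule iso_obtain_inverse)
  have ph: "\<phi> \<in> Arr C" using i by (auto intro: iso_arr)
  have c: "comm_square C f g h k" using p by (rule pullback_comm)
  have t: "f \<in> Arr C" "g \<in> Arr C" "Dom C g = Dom C f" using c by (auto simp: comm_square_def)
  show "comm_square C (f \<odot> \<phi>) (g \<odot> \<phi>) h k" using comm_square_pre[OF c] i ph by simp
  show "\<exists>u\<in>Arr C. Dom C u = Dom C f' \<and> Cod C u = Dom C (f \<odot> \<phi>) \<and> (f \<odot> \<phi>) \<odot> u = f' \<and> (g \<odot> \<phi>) \<odot> u = g'"
    if s: "comm_square C f' g' h k" for f' g'
  proof -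
    obtain u where u: "u \<in> Arr C" "Dom C u = Dom C f'" "Cod C u = Dom C f" "f \<odot> u = f'" "g \<odot> u = g'"
      using pullback_obtain[OF p s] .
    have "\<phi> \<odot> (\<psi> \<odot> u) = u" using comp_assoc_eq[OF \<psi>(5), of u] u \<psi> ph i id_left'[of u] by simp
    then show ?thesis using u \<psi> ph i t by (intro bexI[of _ "\<psi> \<odot> u"]) (simp_all add: comp_assoc)
  qed
  fix u v assume u: "u \<in> Arr C" "v \<in> Arr C" "Dom C u = Dom C v" "Cod C u = Dom C (f \<odot> \<phi>)" "Cod C v = Dom C (f \<odot> \<phi>)"
      "(f \<odot> \<phi>) \<odot> u = (f \<odot> \<phi>) \<odot> v" "(g \<odot> \<phi>) \<odot> u = (g \<odot> \<phi>) \<odot> v"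
  have "\<phi> \<odot> u = \<phi> \<odot> v"
    by (rule pullback_unique[OF p]) (use u t ph i in \<open>simp_all add: comp_assoc\<close>)
  then show "u = v" using monoD[OF iso_mono[OF i(1)]] u t ph i by simp
qed

lemma pullback_post_mono:
  assumes p: "is_pullback C f g h k" and u: "is_mono C u" "Dom C u = Cod C h"
  shows "is_pullback C f g (u \<odot> h) (u \<odot> k)"
proof (rule pullbackI)
  have c: "comm_square C f g h k" using p by (rule pullback_comm)
  have uA: "u \<in> Arr C" using u by (simp add: is_mono_def)
  have t: "h \<in> Arr C" "k \<in> Arr C" "Cod C k = Cod C h" using c by (auto simp: comm_square_def)
  show "comm_square C f g (u \<odot> h) (u \<odot> k)" using comm_square_post[OF c] u uA by simp
  show "\<exists>w\<in>Arr C. Dom C w = Dom C f' \<and> Cod C w = Dom C f \<and> f \<odot> w = f' \<and> g \<odot> w = g'"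
    if s: "comm_square C f' g' (u \<odot> h) (u \<odot> k)" for f' g'
  proof -
    have s': "f' \<in> Arr C" "g' \<in> Arr C" "Dom C f' = Dom C g'" "Cod C f' = Dom C h" "Cod C g' = Dom C k" "u \<odot> (h \<odot> f') = u \<odot> (k \<odot> g')"
      using s t u uA by (auto simp: comm_square_def comp_assoc)
    have "h \<odot> f' = k \<odot> g'" using monoD[OF u(1) s'(6)] s' t u by simp
    then have "comm_square C f' g' h k" using s' t by (simp add: comm_square_def)
    then show ?thesis using pullback_obtain[OF p] by metis
  qed
qed (use pullback_unique[OF p] in blast)

text \<open>The pushout over \<open>a\<close> induces \<open>y\<close> out of its corner, and
  cancelling it from the outer rectangle leaves the square over \<open>b\<close>. In this way a
  pushout complement for a composite leg is broken into stages.\<close>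

lemma pushout_split:
  assumes p: "is_pushout C (b \<odot> a) k h n" and p1: "is_pushout C a k f z" and b: "b \<in> Arr C" "Dom C b = Cod C a"
  obtains y where "y \<in> Arr C" "Dom C y = Cod C z" "y \<odot> z = n" "y \<odot> f = h \<odot> b" "is_pushout C b f h y"
proof -
  have c: "comm_square C (b \<odot> a) k h n" and c1: "comm_square C a k f z" using p p1 by (auto intro: pushout_comm)
  have t: "a \<in> Arr C" "k \<in> Arr C" "h \<in> Arr C" "n \<in> Arr C" "f \<in> Arr C" "z \<in> Arr C" "Dom C a = Dom C k" "Cod C a = Dom C f"
    "Cod C k = Dom C z" "Cod C f = Cod C z" "Cod C b = Dom C h" "Dom C n = Dom C z" "Cod C h = Cod C n" "h \<odot> (b \<odot> a) = n \<odot> k"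
    using c c1 b by (auto simp: comm_square_def)
  have "comm_square C a k (h \<odot> b) n" using t b by (simp add: comm_square_def comp_assoc)
  then obtain y where y: "y \<in> Arr C" "Dom C y = Cod C f" "Cod C y = Cod C h" "y \<odot> f = h \<odot> b" "y \<odot> z = n"
    using pushout_obtain[OF p1] t b by (metis comp_cod)
  have "is_pushout C f b y h"
    by (rule pushout_decompose[OF pushout_sym[OF p1], of b y h])
      (use y t b pushout_sym[OF p] in \<open>simp_all add: comm_square_def\<close>)
  then show thesis using that y t pushout_sym by simp
qed

end

section \<open>Pushout complements in M-adhesive categories\<close>

context category
begin

lemma pushout_compose_sym:
  assumes "is_pushout C a k f z" "is_pushout C b f h y"
  shows "is_pushout C (b \<odot> a) k h (y \<odot> z)"
  using pushout_sym[OF pushout_compose[OF pushout_sym[OF assms(1)] pushout_sym[OF assms(2)]]] .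

lemma pullback_compose_sym:
  assumes "is_pullback C a k f z" "is_pullback C b f h y"
  shows "is_pullback C (b \<odot> a) k h (y \<odot> z)"
  using pullback_sym[OF pullback_compose[OF pullback_sym[OF assms(1)] pullback_sym[OF assms(2)]]] .

text \<open>The first two pushouts paste to one over \<open>n2 \<odot> u2\<close>; rewriting this
  leg as \<open>n1 \<odot> u1\<close> lets the rectangle be split along \<open>u1\<close>. In a
  composition diagram this passes a context of the composite rule from the second rule's side to the
  first rule's side.\<close>

lemma pushout_analysis:
  assumes "is_pushout C u2 k f z2" "is_pushout C n2 f u x2" "is_pushout C u1 k f1 z1"
    and "n2 \<odot> u2 = n1 \<odot> u1" "n1 \<in> Arr C" "Dom C n1 = Cod C u1"
  obtains y1 where "y1 \<in> Arr C" "Dom C y1 = Cod C z1" "y1 \<odot> z1 = x2 \<odot> z2" "is_pushout C n1 f1 u y1"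
proof -
  have "is_pushout C (n1 \<odot> u1) k u (x2 \<odot> z2)"
    using pushout_compose_sym[OF assms(1,2)] assms(4) by simp
  from pushout_split[OF this assms(3,5,6)] that show thesis by metis
qed

lemma has_pushout_complement_post_iso:
  assumes "has_pushout_complement C f h" "is_iso C \<phi>" "Dom C \<phi> = Cod C h"
  shows "has_pushout_complement C f (\<phi> \<odot> h)"
  using assms pushout_post_iso unfolding has_pushout_complement_def by blast

lemma has_pushout_complement_comm:
  assumes "has_pushout_complement C f h"
  shows "f \<in> Arr C" "h \<in> Arr C" "Dom C h = Cod C f"
  using assms pushout_comm unfolding has_pushout_complement_def comm_square_def by fastforce+

lemma has_pushout_complement_Id:
  assumes "f \<in> Arr C"
  shows "has_pushout_complement C f (Id C (Cod C f))"
  using pushout_sym[OF pushout_id[OF assms]] unfolding has_pushout_complement_def by blast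

end

context M_adhesive_category
begin

lemma M_pushout_stable':
  "is_pushout C f g h k \<Longrightarrow> g \<in> M \<Longrightarrow> h \<in> M"
  using M_pushout_stable pushout_sym by blast

lemma M_pullback_stable':
  "is_pullback C f g h k \<Longrightarrow> k \<in> M \<Longrightarrow> f \<in> M"
  using M_pullback_stable pullback_sym by blast

lemma M_pushout_complement_stable:
  "is_pushout C f g h k \<Longrightarrow> f \<in> M \<Longrightarrow> h \<in> M \<Longrightarrow> g \<in> M"
  using M_pullback_stable pushout_along_M_is_pullback by blast

lemma M_cancel:
  assumes "u \<in> M" "u \<odot> s = u \<odot> t" "s \<in> Arr C" "t \<in> Arr C" "Dom C s = Dom C t" "Cod C s = Dom C u" "Cod C t = Dom C u"
  shows "s = t"
  using monoD[OF M_mono[OF assms(1)] assms(2-)] .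

text \<open>Both projections of the pullback of \<open>k\<close> and \<open>k'\<close> are
  isomorphisms by \<open>pushout_complement_pullback_iso\<close>, applied in both orders;
  \<open>\<delta>\<close> inverts the first projection and follows the second.\<close>

lemma pushout_complement_unique:
  assumes p: "is_pushout C f g h k" and p': "is_pushout C f g' h k'" and f: "f \<in> M"
  obtains \<delta> where "is_iso C \<delta>" "\<delta> \<in> Arr C" "Dom C \<delta> = Cod C g" "Cod C \<delta> = Cod C g'" "\<delta> \<odot> g = g'" "k' \<odot> \<delta> = k"
proof -
  have c: "comm_square C f g h k" and c': "comm_square C f g' h k'" using p p' by (auto intro: pushout_comm)
  have t: "g \<in> Arr C" "g' \<in> Arr C" "k \<in> Arr C" "k' \<in> Arr C" "Cod C k = Cod C k'" "Dom C k = Cod C g" "Dom C k' = Cod C g'"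
    "k \<odot> g = k' \<odot> g'" "Dom C g = Dom C g'"
    using c c' by (auto simp: comm_square_def)
  obtain p1 p2 where pb: "is_pullback C p1 p2 k k'"
    using M_pullback_ex[OF M_pushout_stable[OF p f] t(4,5)] by blast
  have pt: "p1 \<in> Arr C" "p2 \<in> Arr C" "Dom C p1 = Dom C p2" "Cod C p1 = Dom C k" "Cod C p2 = Dom C k'" "k \<odot> p1 = k' \<odot> p2"
    using pullback_comm[OF pb] by (auto simp: comm_square_def)
  have "comm_square C g g' k k'" using t by (auto simp: comm_square_def)
  then obtain s where s: "s \<in> Arr C" "Dom C s = Dom C g" "Cod C s = Dom C p1" "p1 \<odot> s = g" "p2 \<odot> s = g'"
    using pullback_obtain[OF pb] by blast
  have i2: "is_iso C p2" using pushout_complement_pullback_iso[OF p p' f pb] s by simp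
  have i1: "is_iso C p1" using pushout_complement_pullback_iso[OF p' p f pullback_sym[OF pb]] s pt by simp
  obtain q where q: "is_iso C q" "q \<in> Arr C" "Dom C q = Cod C p1" "Cod C q = Dom C p1" "q \<odot> p1 = Id C (Dom C p1)" "p1 \<odot> q = Id C (Cod C p1)"
    using i1 by (rule iso_obtain_inverse)
  show thesis
  proof (rule that[of "p2 \<odot> q"])
    show "is_iso C (p2 \<odot> q)" using iso_comp[OF q(1) i2] q pt by simp
    have "q \<odot> g = s" using iso_inverse_left[OF q(5), of s] q pt s by simp
    then show "(p2 \<odot> q) \<odot> g = g'" using comp_assoc[of g q p2] q pt s t by simp
    have "k' \<odot> (p2 \<odot> q) = k \<odot> (p1 \<odot> q)" using comm_assoc[OF pullback_comm[OF pb], of q] q by simp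
    then show "k' \<odot> (p2 \<odot> q) = k" using q pt t id_right'[of k "Cod C g"] by simp
  qed (use q pt t in simp_all)
qed

text \<open>The pushout \<open>p2\<close> is the bottom of a cube with vertical edges
  \<open>u2\<close>, \<open>n1\<close>, \<open>z2\<close>, \<open>y1\<close>. All side faces are
  pullbacks, so the van Kampen property makes the top a pushout.\<close>

lemma pushout_along_pullback:
  assumes pb: "is_pullback C u2 u1 n2 n1" and p2: "is_pushout C n2 f u x2" and p1: "is_pullback C n1 f1 u y1"
    and M: "n2 \<in> M" "n1 \<in> M" "y1 \<in> M" and pz: "is_pullback C z2 z1 x2 y1"
    and k: "k \<in> Arr C" "Dom C k = Dom C u2" "Cod C k = Dom C z2" "z2 \<odot> k = f \<odot> u2" "z1 \<odot> k = f1 \<odot> u1"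
  shows "is_pushout C u1 k f1 z1"
proof -
  have c: "comm_square C u2 u1 n2 n1" "comm_square C n2 f u x2" "comm_square C n1 f1 u y1" "comm_square C z2 z1 x2 y1"
    using pb p2 p1 pz by (auto intro: pushout_comm pullback_comm)
  have t: "u2 \<in> Arr C" "u1 \<in> Arr C" "n2 \<in> Arr C" "n1 \<in> Arr C" "f \<in> Arr C" "u \<in> Arr C" "x2 \<in> Arr C" "f1 \<in> Arr C" "y1 \<in> Arr C"
    "z2 \<in> Arr C" "z1 \<in> Arr C" "Dom C u2 = Dom C u1" "Cod C u2 = Dom C n2" "Cod C u1 = Dom C n1" "Cod C n2 = Dom C u" "Cod C n1 = Dom C u"
    "Dom C n2 = Dom C f" "Dom C n1 = Dom C f1" "Cod C f = Dom C x2" "Cod C f1 = Dom C y1" "Cod C u = Cod C x2" "Cod C x2 = Cod C y1"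
    "Dom C z2 = Dom C z1" "Cod C z2 = Dom C x2" "Cod C z1 = Dom C y1" "u \<odot> n2 = x2 \<odot> f" "n2 \<odot> u2 = n1 \<odot> u1"
    using c by (auto simp: comm_square_def)
  have M': "u2 \<in> M" "z2 \<in> M"
    using M_pullback_stable'[OF pb] M_pullback_stable'[OF pz] M by auto
  have outer: "is_pullback C (f1 \<odot> u1) u2 y1 (u \<odot> n2)"
    using pullback_compose_sym[OF pullback_sym[OF pb] pullback_sym[OF p1]] .
  \<comment> \<open>The second back face is a pullback by cancelling \<open>pz\<close> from the
    rectangle pasted from \<open>pb\<close> and \<open>p1\<close>.\<close>
  have back_face: "is_pullback C k u2 z2 f"
  proof -
    have "comm_square C u2 k f z2" using t k by (simp add: comm_square_def)
    then have "is_pullback C u2 k f z2"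
      by (intro pullback_decompose[OF pz, of u2 k f]) (use outer t k in \<open>simp_all add: pullback_sym\<close>)
    then show ?thesis by (rule pullback_sym)
  qed
  have "comm_square C u1 k f1 z1" using t k by (simp add: comm_square_def)
  then show ?thesis
    using M_VK[OF p2 M(1), unfolded M_van_Kampen_def, rule_format, OF M'(1) M(2) M'(2) M(3), of u1 k f1 z1]
      pullback_sym[OF pb] back_face pullback_sym[OF p1] pullback_sym[OF pz] by (auto intro: pullback_comm)
qed

text \<open>Intersecting the contexts \<open>x2\<close> and \<open>y1\<close> of two successive
  steps gives the context of the composite step, and \<open>k\<close> is the arrow induced into it.
  \<open>pushout_along_pullback\<close> is used once per step with the roles exchanged; this is the
  converse of \<open>pushout_analysis\<close>.\<close>

lemma pushout_synthesis:
  assumes pb: "is_pullback C u2 u1 n2 n1" and p2: "is_pushout C n2 f u x2" and p1: "is_pushout C n1 f1 u y1"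
    and M: "n2 \<in> M" "n1 \<in> M" and pz: "is_pullback C z2 z1 x2 y1"
  obtains k where "is_pushout C u2 k f z2" "is_pushout C u1 k f1 z1"
proof -
  have c: "comm_square C u2 u1 n2 n1" "comm_square C n2 f u x2" "comm_square C n1 f1 u y1" "comm_square C z2 z1 x2 y1"
    using pb p2 p1 pz by (auto intro: pushout_comm pullback_comm)
  have t: "u2 \<in> Arr C" "u1 \<in> Arr C" "n2 \<in> Arr C" "n1 \<in> Arr C" "f \<in> Arr C" "u \<in> Arr C" "x2 \<in> Arr C" "f1 \<in> Arr C" "y1 \<in> Arr C"
    "z2 \<in> Arr C" "z1 \<in> Arr C" "Dom C u2 = Dom C u1" "Cod C u2 = Dom C n2" "Cod C u1 = Dom C n1" "Cod C n2 = Dom C u" "Cod C n1 = Dom C u"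
    "Dom C n2 = Dom C f" "Dom C n1 = Dom C f1" "Cod C f = Dom C x2" "Cod C f1 = Dom C y1" "Cod C u = Cod C x2" "Cod C x2 = Cod C y1"
    "Dom C z2 = Dom C z1" "Cod C z2 = Dom C x2" "Cod C z1 = Dom C y1" "n2 \<odot> u2 = n1 \<odot> u1"
    using c by (auto simp: comm_square_def)
  have "x2 \<odot> (f \<odot> u2) = y1 \<odot> (f1 \<odot> u1)"
    using comm_assoc[OF c(2), of u2] comm_assoc[OF c(3), of u1] t by simp
  then have "comm_square C (f \<odot> u2) (f1 \<odot> u1) x2 y1" using t by (simp add: comm_square_def)
  then obtain k where k: "k \<in> Arr C" "Dom C k = Dom C (f \<odot> u2)" "Cod C k = Dom C z2" "z2 \<odot> k = f \<odot> u2" "z1 \<odot> k = f1 \<odot> u1"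
    using pullback_obtain[OF pz] by blast
  have xy: "x2 \<in> M" "y1 \<in> M" using M_pushout_stable p2 p1 M by auto
  have "is_pushout C u1 k f1 z1"
    by (rule pushout_along_pullback[OF pb p2 pushout_along_M_is_pullback[OF p1 M(2)] M xy(2) pz])
      (use k t in simp_all)
  moreover have "is_pushout C u2 k f z2"
    by (rule pushout_along_pullback[OF pullback_sym[OF pb] p1 pushout_along_M_is_pullback[OF p2 M(1)] M(2,1) xy(1) pullback_sym[OF pz]])
      (use k t in simp_all)
  ultimately show thesis using that by blast
qed

lemma cond_over_transport:
  assumes "linear_rule C M r" "cond_over C M c (rule_output C r)"
  shows "cond_over C M (transport C c r) (rule_input C r)"
  using assms
proof (induction c arbitrary: r)
  case (CExists a c)
  obtain l i where r: "r = (l, i)" by fastforce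
  have li: "l \<in> M" "i \<in> M" "Dom C l = Dom C i" using CExists.prems r by (auto simp: linear_rule_def)
  have a: "a \<in> M" "Dom C a = Cod C l" "cond_over C M c (Cod C a)" using CExists.prems r by auto
  show ?case
  proof (cases "has_pushout_complement C l a")
    case True
    obtain e l' where e: "some_pushout_complement C l a = (e, l')" by fastforce
    obtain a' i' where a': "some_pushout C i e = (a', i')" by fastforce
    have pe: "is_pushout C l e a l'" using some_pushout_complement[OF True e] .
    have ce: "e \<in> Arr C" "Dom C e = Dom C i" "Dom C l' = Cod C e" "Cod C l' = Cod C a"
      using pushout_comm[OF pe] li by (auto simp: comm_square_def)
    have pa: "is_pushout C i e a' i'" using some_pushout[OF li(2) ce(1) _ a'] ce by simp
    have ca: "Dom C a' = Cod C i" "Dom C i' = Cod C e" "Cod C i' = Cod C a'"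
      using pushout_comm[OF pa] by (auto simp: comm_square_def)
    have "e \<in> M" using M_pushout_complement_stable[OF pe li(1) a(1)] .
    then have M': "l' \<in> M" "i' \<in> M" "a' \<in> M"
      using M_pushout_stable[OF pe] M_pushout_stable[OF pa] M_pushout_stable'[OF pa] li by auto
    then show ?thesis using True e a' r CExists.IH[of "(l', i')"] ce ca a by (simp add: linear_rule_def)
  qed (use li r in \<open>simp add: M_arr cod_obj\<close>)
qed (auto simp: linear_rule_def M_arr cod_obj)

lemma cond_over_shift:
  assumes "cond_over C M c (Dom C p)" "p \<in> M"
  shows "cond_over C M (shift C M c p) (Cod C p)"
  using assms
proof (induction c arbitrary: p)
  case (CExists a c)
  have "cond_over C M (shift C M c p') (Cod C a')" if "(a', p') \<in> shift_squares C M p a" for a' p'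
  proof -
    have "Dom C p' = Cod C a" "Cod C a' = Cod C p'" "p' \<in> M"
      using that by (auto simp: shift_squares_def comm_square_def)
    then show ?thesis using CExists.IH[of p'] CExists.prems by simp
  qed
  then show ?case using CExists.prems
    by (auto simp: CDisj_def M_arr cod_obj shift_squares_def comm_square_def)
qed (auto simp: M_arr cod_obj)

lemma comatch_obtain:
  assumes r: "linear_rule C M r" and m: "dpo_match C M r m"
  obtains m' where "dpo_comatch C r m m'" "m' \<in> M" "Dom C m' = rule_output C r"
proof -
  obtain d x where p: "is_pushout C (snd r) d m x" using m unfolding dpo_match_def has_pushout_complement_def by blast
  have M': "fst r \<in> M" "snd r \<in> M" "m \<in> M" "Dom C (fst r) = Dom C (snd r)"
    using r m by (auto simp: linear_rule_def dpo_match_def)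
  have d: "d \<in> M" using M_pushout_complement_stable[OF p] M' by blast
  have "Dom C (fst r) = Dom C d" using pushout_comm[OF p] M' by (auto simp: comm_square_def)
  then obtain m' y where p': "is_pushout C (fst r) d m' y" using M_pushout_ex[OF M'(1) M_arr[OF d]] by blast
  have "m' \<in> M" using M_pushout_stable'[OF p' d] .
  moreover have "Dom C m' = Cod C (fst r)" using pushout_comm[OF p'] by (auto simp: comm_square_def)
  ultimately show thesis using that p p' unfolding dpo_comatch_def by blast
qed

section \<open>Transport along matches that are not DPO-admissible\<close>

text \<open>
  A match \<open>h\<close> that is not DPO-admissible factors as \<open>h = u \<odot> h0\<close> through the largest subobject \<open>u\<close>
  for which \<open>h0\<close> is admissible, and \<open>transport\<close> only sees \<open>h0\<close>.
\<close>

definition largest_complemented :: "'m \<Rightarrow> 'm \<Rightarrow> 'm \<Rightarrow> bool" where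
  "largest_complemented i u h0 \<longleftrightarrow> u \<in> M \<and> h0 \<in> M \<and> Cod C h0 = Dom C u \<and> has_pushout_complement C i h0 \<and>
    (\<forall>q\<in>M. \<forall>g. Cod C g = Dom C q \<and> q \<odot> g = u \<odot> h0 \<and> has_pushout_complement C i g \<longrightarrow>
      (\<exists>t\<in>Arr C. Dom C t = Dom C q \<and> Cod C t = Dom C u \<and> u \<odot> t = q))"

text \<open>Induction with \<open>u\<close> fixed. At an existential, a solution \<open>q\<close>
  over \<open>u \<odot> h0\<close> is itself a subobject through which an admissible match factors,
  because \<open>a'\<close> has a pushout complement for \<open>i\<close>; hence \<open>q\<close>
  lies below \<open>u\<close>. The arrow through which it factors is again the admissible part of a
  largest factorization for the derived rule \<open>(l', i')\<close>, so the induction hypothesis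
  applies.\<close>

lemma sat_transport_largest:
  assumes "linear_rule C M r" "cond_over C M c (rule_output C r)" "largest_complemented (snd r) u h0"
  shows "sat C M (transport C c r) (u \<odot> h0) \<longleftrightarrow> sat C M (transport C c r) h0"
  using assms
proof (induction c arbitrary: r h0)
  case (CExists a c)
  obtain l i where r: "r = (l, i)" by fastforce
  have li: "l \<in> M" "i \<in> M" "Dom C l = Dom C i" using CExists.prems r by (auto simp: linear_rule_def)
  have a: "a \<in> M" "Dom C a = Cod C l" "cond_over C M c (Cod C a)" using CExists.prems r by auto
  have u: "u \<in> M" "h0 \<in> M" "Cod C h0 = Dom C u" "has_pushout_complement C i h0"
    "\<And>q g. \<lbrakk>q \<in> M; Cod C g = Dom C q; q \<odot> g = u \<odot> h0; has_pushout_complement C i g\<rbrakk> \<Longrightarrow>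
      \<exists>t\<in>Arr C. Dom C t = Dom C q \<and> Cod C t = Dom C u \<and> u \<odot> t = q"
    using CExists.prems r by (auto simp: largest_complemented_def)
  obtain d x where po: "is_pushout C i d h0 x" using u(4) unfolding has_pushout_complement_def by blast
  have dh: "Dom C h0 = Cod C i" using pushout_comm[OF po] by (simp add: comm_square_def)
  have uA: "u \<in> Arr C" "h0 \<in> Arr C" using u by (auto intro: M_arr)
  show ?case
  proof (cases "has_pushout_complement C l a")
    case True
    obtain e l' where e: "some_pushout_complement C l a = (e, l')" by fastforce
    obtain a' i' where a': "some_pushout C i e = (a', i')" by fastforce
    have pe: "is_pushout C l e a l'" using some_pushout_complement[OF True e] .
    have ce: "e \<in> Arr C" "Dom C e = Dom C i" "Dom C l' = Cod C e" "Cod C l' = Cod C a"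
      using pushout_comm[OF pe] li by (auto simp: comm_square_def)
    have pa: "is_pushout C i e a' i'"
      using some_pushout[OF li(2) ce(1) _ a'] ce by simp
    have ca: "a' \<in> Arr C" "Dom C a' = Cod C i" "Dom C i' = Cod C e" "Cod C i' = Cod C a'"
      using pushout_comm[OF pa] by (auto simp: comm_square_def)
    have l'M: "l' \<in> M" "i' \<in> M" using M_pushout_stable[OF pe] M_pushout_stable[OF pa] li by auto
    have lr: "linear_rule C M (l', i')" using l'M ce ca by (auto simp: linear_rule_def)
    have tr: "transport C (CExists a c) r = CExists a' (transport C c (l', i'))"
      using True r e a' by simp
    have ih: "sat C M (transport C c (l', i')) (u \<odot> t) \<longleftrightarrow> sat C M (transport C c (l', i')) t"
      if t: "t \<in> M" "Dom C t = Cod C a'" "t \<odot> a' = h0" "Cod C t = Dom C u" for t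
    proof (rule CExists.IH[OF lr])
      show "cond_over C M c (rule_output C (l', i'))" using a ce by simp
      have tA: "t \<in> Arr C" using t by (auto intro: M_arr)
      have "is_pushout C i d (t \<odot> a') x" using po t by simp
      from pushout_complement_decompose(2)[OF this li(2) t(1) ca(1) t(2)[symmetric] ca(2) pa]
      have "has_pushout_complement C i' t" unfolding has_pushout_complement_def by blast
      \<comment> \<open>A complement of \<open>i'\<close> for \<open>g\<close> pastes onto
        \<open>pa\<close> to one of \<open>i\<close> for \<open>g \<odot> a'\<close>, so maximality
        of \<open>u\<close> is inherited.\<close>
      moreover have "\<exists>s\<in>Arr C. Dom C s = Dom C q \<and> Cod C s = Dom C u \<and> u \<odot> s = q"
        if q: "q \<in> M" "Cod C g = Dom C q" "q \<odot> g = u \<odot> t" "has_pushout_complement C i' g" for q g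
      proof (rule u(5)[OF q(1)])
        have g: "g \<in> Arr C" "Dom C g = Cod C a'" "q \<in> Arr C"
          using has_pushout_complement_comm[OF q(4)] ca q by (auto intro: M_arr)
        show "Cod C (g \<odot> a') = Dom C q" using g ca q by simp
        show "q \<odot> (g \<odot> a') = u \<odot> h0"
          using comp_assoc_eq[OF q(3), of a'] g q ca t tA uA by (simp add: comp_assoc)
        show "has_pushout_complement C i (g \<odot> a')"
          using q(4) pushout_compose[OF pa] unfolding has_pushout_complement_def by blast
      qed
      ultimately show "largest_complemented (snd (l', i')) u t"
        unfolding largest_complemented_def using t u by auto
    qed
    show ?thesis
    proof
      assume "sat C M (transport C (CExists a c) r) (u \<odot> h0)"
      then obtain q where q: "q \<in> M" "Dom C q = Cod C a'" "q \<odot> a' = u \<odot> h0" "sat C M (transport C c (l', i')) q"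
        unfolding tr by auto
      have "has_pushout_complement C i a'" using pa unfolding has_pushout_complement_def by blast
      then obtain t where t: "t \<in> Arr C" "Dom C t = Dom C q" "Cod C t = Dom C u" "u \<odot> t = q"
        using u(5)[OF q(1)] q by auto
      have tM: "t \<in> M" using M_decomp[OF t(1) u(1) t(3)] t q by simp
      have "t \<odot> a' = h0"
        by (rule M_cancel[OF u(1)]) (use t q ca uA dh u comp_assoc_eq[OF t(4), of a'] in simp_all)
      then show "sat C M (transport C (CExists a c) r) h0"
        unfolding tr using ih[of t] t tM q by auto
    next
      assume "sat C M (transport C (CExists a c) r) h0"
      then obtain t where t: "t \<in> M" "Dom C t = Cod C a'" "t \<odot> a' = h0" "sat C M (transport C c (l', i')) t"
        unfolding tr by auto
      have tA: "t \<in> Arr C" using t by (auto intro: M_arr)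
      have tc: "Cod C t = Dom C u" using t u ca tA comp_cod[of a' t] by simp
      have "u \<odot> t \<in> M" using M_comp[OF t(1) u(1) tc] .
      moreover have "(u \<odot> t) \<odot> a' = u \<odot> h0" using comp_assoc[of a' t u] t tc uA tA ca by simp
      ultimately show "sat C M (transport C (CExists a c) r) (u \<odot> h0)"
        unfolding tr using ih[of t] t tc uA tA by (auto intro!: bexI[of _ "u \<odot> t"])
    qed
  qed (use r in simp)
next
  case (CConj J F)
  have "sat C M (transport C (F j) r) (u \<odot> h0) \<longleftrightarrow> sat C M (transport C (F j) r) h0" if "j \<in> J" for j
    by (rule CConj.IH) (use CConj.prems that in auto)
  then show ?case by auto
qed auto

end

section \<open>Unions of subobjects and the largest admissible part of a match\<close>

context rewriting_category
begin

lemma effective_union: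
  assumes "h \<in> M" "k \<in> M" "is_pullback C f g h k" "is_pushout C f g p q"
  obtains u where "u \<in> M" "Dom C u = Cod C p" "Cod C u = Cod C h" "u \<odot> p = h" "u \<odot> q = k"
proof -
  obtain u where u: "u \<in> Arr C" "Dom C u = Cod C p" "Cod C u = Cod C h" "u \<odot> p = h" "u \<odot> q = k"
    using pushout_obtain[OF assms(4) pullback_comm[OF assms(3)]] .
  then have "u \<in> M"
    using effective_unions[unfolded M_effective_unions_def, rule_format, of h k f g p q u] assms by (auto simp: hom_def)
  with u that show thesis by blast
qed

text \<open>The union of \<open>h\<close> and \<open>k\<close> embeds by some \<open>u\<close> in
  \<open>M\<close>, and joint epicness makes \<open>u\<close> epi; balancedness turns it into an
  isomorphism. Statements about generation thereby become statements about pushouts.\<close>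

lemma jointly_epic_pushout:
  assumes "h \<in> M" "k \<in> M" "is_pullback C f g h k" "jointly_epic C h k"
  shows "is_pushout C f g h k"
proof -
  have t: "f \<in> Arr C" "g \<in> Arr C" "Dom C f = Dom C g" using pullback_comm[OF assms(3)] by (auto simp: comm_square_def)
  have "f \<in> M" using M_pullback_stable'[OF assms(3,2)] .
  then obtain p q where p: "is_pushout C f g p q" using M_pushout_ex t by blast
  obtain u where u: "u \<in> M" "Dom C u = Cod C p" "Cod C u = Cod C h" "u \<odot> p = h" "u \<odot> q = k"
    using effective_union[OF assms(1-3) p] .
  have pq: "p \<in> Arr C" "q \<in> Arr C" "Cod C q = Cod C p" using pushout_comm[OF p] by (auto simp: comm_square_def)
  have uA: "u \<in> Arr C" using u by (auto intro: M_arr)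
  have "is_epi C u" unfolding is_epi_def
  proof (intro conjI ballI impI)
    fix v w assume vw: "v \<in> Arr C" "w \<in> Arr C" "Cod C v = Cod C w \<and> Dom C v = Cod C u \<and> Dom C w = Cod C u \<and> v \<odot> u = w \<odot> u"
    show "v = w"
    proof (rule jointly_epicD[OF assms(4)])
      show "v \<odot> h = w \<odot> h" using comp_assoc[of p u v] comp_assoc[of p u w] vw u uA pq by simp
      show "v \<odot> k = w \<odot> k" using comp_assoc[of q u v] comp_assoc[of q u w] vw u uA pq by simp
    qed (use vw u in simp_all)
  qed (fact uA)
  then have "is_iso C u" using balanced M_mono[OF u(1)] unfolding balanced_def by blast
  from pushout_post_iso[OF p this u(2)] u show ?thesis by simp
qed

text \<open>On the intersection of \<open>q1\<close> and \<open>q2\<close> both matches restrict to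
  \<open>g0\<close>, whose context maps to the contexts of \<open>g1\<close> and \<open>g2\<close>.
  The pushout of these two contexts over it is the context for the union.\<close>

lemma complemented_union:
  assumes i: "i \<in> M" and q: "q1 \<in> M" "q2 \<in> M" and g: "Cod C g1 = Dom C q1" "Cod C g2 = Dom C q2"
    and eq: "q1 \<odot> g1 = q2 \<odot> g2" and pc: "has_pushout_complement C i g1" "has_pushout_complement C i g2"
  obtains u g t1 t2 where "u \<in> M" "t1 \<in> Arr C" "t2 \<in> Arr C" "Cod C t1 = Dom C u" "Cod C t2 = Dom C u" "Dom C t1 = Dom C q1" "Dom C t2 = Dom C q2"
    "u \<odot> t1 = q1" "u \<odot> t2 = q2" "Cod C g = Dom C u" "u \<odot> g = q1 \<odot> g1" "has_pushout_complement C i g"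
proof -
  have gA: "g1 \<in> Arr C" "g2 \<in> Arr C" "Dom C g1 = Cod C i" "Dom C g2 = Cod C i" "i \<in> Arr C" "q1 \<in> Arr C" "q2 \<in> Arr C"
    using has_pushout_complement_comm pc i q by (auto intro: M_arr)
  have qc: "Cod C q1 = Cod C q2" using comp_cod[of g1 q1] comp_cod[of g2 q2] gA g eq by simp
  obtain a1 a2 where pb: "is_pullback C a1 a2 q1 q2" using M_pullback_ex[OF q(1) gA(7) qc] by blast
  have aM: "a1 \<in> M" "a2 \<in> M" using M_pullback_stable[OF pb] M_pullback_stable'[OF pb] q by auto
  have at: "a1 \<in> Arr C" "a2 \<in> Arr C" "Dom C a1 = Dom C a2" "Cod C a1 = Dom C q1" "Cod C a2 = Dom C q2"
    using pullback_comm[OF pb] by (auto simp: comm_square_def)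
  have "comm_square C g1 g2 q1 q2" using gA g qc eq by (simp add: comm_square_def)
  then obtain g0 where g0: "g0 \<in> Arr C" "Dom C g0 = Dom C g1" "Cod C g0 = Dom C a1" "a1 \<odot> g0 = g1" "a2 \<odot> g0 = g2"
    using pullback_obtain[OF pb] by blast
  obtain t1 t2 where po: "is_pushout C a1 a2 t1 t2" using M_pushout_ex[OF aM(1) at(2,3)] by blast
  have tt: "t1 \<in> Arr C" "t2 \<in> Arr C" "Dom C t1 = Cod C a1" "Dom C t2 = Cod C a2" "Cod C t1 = Cod C t2" using pushout_comm[OF po] by (auto simp: comm_square_def)
  obtain u where u: "u \<in> M" "Dom C u = Cod C t1" "Cod C u = Cod C q1" "u \<odot> t1 = q1" "u \<odot> t2 = q2"
    using effective_union[OF q pb po] .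
  have uA: "u \<in> Arr C" using u by (auto intro: M_arr)
  obtain d1 y1 where p1: "is_pushout C i d1 (a1 \<odot> g0) y1" using pc g0 unfolding has_pushout_complement_def by auto
  obtain d2 y2 where p2: "is_pushout C i d2 (a2 \<odot> g0) y2" using pc g0 unfolding has_pushout_complement_def by auto
  obtain e l where pe: "is_pushout C i e g0 l"
    using pushout_complement_decompose(1)[OF p1 i aM(1) g0(1)] g0 gA unfolding has_pushout_complement_def by auto
  obtain d1' where d1': "d1' \<in> Arr C" "Dom C d1' = Dom C l" "d1' \<odot> e = d1" "is_pushout C l d1' a1 y1"
    using pushout_complement_decompose(2)[OF p1 i aM(1) g0(1) g0(3) _ pe] g0 gA by auto
  obtain d2' where d2': "d2' \<in> Arr C" "Dom C d2' = Dom C l" "is_pushout C l d2' a2 y2"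
    using pushout_complement_decompose(2)[OF p2 i aM(2) g0(1) _ _ pe] g0 gA at by auto
  have "d1' \<in> M" using M_pushout_complement_stable[OF d1'(4) M_pushout_stable[OF pe i] aM(1)] .
  then obtain s1 s2 where ps: "is_pushout C d1' d2' s1 s2" using M_pushout_ex[of d1' d2'] d1' d2' by auto
  have "is_pushout C (a1 \<odot> l) d2' t1 (t2 \<odot> y2)"
    using pushout_sym[OF pushout_compose[OF pushout_sym[OF d2'(3)] pushout_sym[OF po]]] .
  \<comment> \<open>The rectangle built along \<open>a1 \<odot> l\<close> is reread along
    \<open>y1 \<odot> d1'\<close>, so that splitting off the pushout of the contexts leaves a square
    to paste onto \<open>p1\<close>.\<close>
  moreover have "a1 \<odot> l = y1 \<odot> d1'" using pushout_comm[OF d1'(4)] by (simp add: comm_square_def)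
  ultimately have "is_pushout C (y1 \<odot> d1') d2' t1 (t2 \<odot> y2)" by simp
  then obtain y where "is_pushout C y1 s1 t1 y"
    using pushout_split[OF _ ps, of y1 t1 "t2 \<odot> y2"] pushout_comm[OF d1'(4)] by (auto simp: comm_square_def)
  from pushout_compose[OF p1 this]
  have "has_pushout_complement C i (t1 \<odot> g1)" unfolding has_pushout_complement_def using g0 by auto
  moreover have "u \<odot> (t1 \<odot> g1) = q1 \<odot> g1" using comp_assoc_eq[OF u(4), of g1] u uA tt at g gA by simp
  moreover have "Cod C (t1 \<odot> g1) = Dom C u" "Cod C t2 = Dom C u" "Dom C t1 = Dom C q1" "Dom C t2 = Dom C q2"
    using u tt at g gA by auto
  ultimately show thesis
    using that[of u t1 t2 "t1 \<odot> g1"] u tt by metis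
qed

lemma largest_complemented_ex:
  assumes i: "i \<in> M" and h: "h \<in> M" "Dom C h = Cod C i"
  obtains u h0 where "largest_complemented i u h0" "u \<odot> h0 = h" "Cod C u = Cod C h"
proof -
  define Q where "Q = {q \<in> M. Cod C q = Cod C h \<and> (\<exists>g. Cod C g = Dom C q \<and> q \<odot> g = h \<and> has_pushout_complement C i g)}"
  define W where "W = {m \<in> M. Cod C m = Cod C h} // subobject_iso C"
  define le where "le = (\<lambda>q q'. \<exists>t\<in>Arr C. Dom C t = Dom C q \<and> Cod C t = Dom C q' \<and> q' \<odot> t = q)"
  \<comment> \<open>Being below is only a preorder on arrows, so size is measured by the number of
    subobject classes with a member below \<open>q\<close>; this grows along \<open>le\<close> and
    is bounded by \<open>card W\<close>.\<close>
  define D where "D q = {c \<in> W. \<exists>q'\<in>c. le q' q}" for q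
  have hA: "h \<in> Arr C" "i \<in> Arr C" using h i by (auto intro: M_arr)
  have fin: "finite W" unfolding W_def using finite_objects[of "Cod C h"] hA by (simp add: finite_object_def cod_obj)
  have le_trans: "le q q''" if "le q q'" "le q' q''" "q'' \<in> M" for q q' q''
  proof -
    from that(1,2) obtain t t' where t: "t \<in> Arr C" "Dom C t = Dom C q" "Cod C t = Dom C q'" "q' \<odot> t = q"
      "t' \<in> Arr C" "Dom C t' = Dom C q'" "Cod C t' = Dom C q''" "q'' \<odot> t' = q'" unfolding le_def by blast
    then have "q'' \<odot> (t' \<odot> t) = q" using comp_assoc_eq[OF t(8), of t] M_arr[OF that(3)] by simp
    then show ?thesis unfolding le_def using t by (intro bexI[of _ "t' \<odot> t"]) simp_all
  qed
  \<comment> \<open>\<open>h\<close> factors through itself by an identity, for which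
    \<open>i\<close> always has a complement; so there is something to maximize over.\<close>
  have hQ: "h \<in> Q"
    unfolding Q_def using h hA has_pushout_complement_Id[of i] id_right'[of h] by (auto intro!: exI[of _ "Id C (Cod C i)"] simp: id_cod cod_obj)
  have "\<forall>q. q \<in> Q \<longrightarrow> card (D q) < Suc (card W)"
    using fin by (auto simp: D_def less_Suc_eq_le intro!: card_mono)
  then obtain q where q: "q \<in> Q" "\<And>q'. q' \<in> Q \<Longrightarrow> card (D q') \<le> card (D q)"
    using ex_has_greatest_nat[of "\<lambda>q. q \<in> Q" h "\<lambda>q. card (D q)"] hQ by blast
  then obtain g where g: "q \<in> M" "Cod C q = Cod C h" "Cod C g = Dom C q" "q \<odot> g = h" "has_pushout_complement C i g"
    unfolding Q_def by blast
  have gA: "g \<in> Arr C" "q \<in> Arr C" using has_pushout_complement_comm[OF g(5)] g(1) by (auto intro: M_arr)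
  have gM: "g \<in> M" using M_decomp[OF gA(1) g(1,3)] g h by simp
  have "le q2 q" if q2: "q2 \<in> M" "Cod C g2 = Dom C q2" "q2 \<odot> g2 = q \<odot> g" "has_pushout_complement C i g2" for q2 g2
  proof -
    obtain u g' t1 t2 where u: "u \<in> M" "t1 \<in> Arr C" "t2 \<in> Arr C" "Cod C t1 = Dom C u" "Cod C t2 = Dom C u" "Dom C t1 = Dom C q" "Dom C t2 = Dom C q2"
      "u \<odot> t1 = q" "u \<odot> t2 = q2" "Cod C g' = Dom C u" "u \<odot> g' = q \<odot> g" "has_pushout_complement C i g'"
      using complemented_union[OF i g(1) q2(1) g(3) q2(2) q2(3)[symmetric] g(5) q2(4)] by metis
    have le: "le q u" "le q2 u" unfolding le_def using u by auto
    have uA: "u \<in> Arr C" using u by (auto intro: M_arr)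
    have uc: "Cod C u = Cod C h" using g u uA comp_cod[of t1 u] by simp
    have uQ: "u \<in> Q" unfolding Q_def using u g uc by auto
    have sub: "D q \<subseteq> D u" unfolding D_def using le_trans[OF _ le(1) u(1)] by auto
    have finD: "finite (D u)" unfolding D_def using fin by simp
    \<comment> \<open>Maximality forces equality. The class of \<open>u\<close> is counted for
      \<open>u\<close>, hence also for \<open>q\<close>, and this puts \<open>u\<close> below
      \<open>q\<close>.\<close>
    have "D q = D u" using card_seteq[OF finD sub] q(2)[OF uQ] by simp
    moreover have "subobject_iso C `` {u} \<in> D u"
    proof -
      have "(u, u) \<in> subobject_iso C"
        unfolding subobject_iso_def hom_def using uA
        by (auto intro!: exI[of _ "Id C (Dom C u)"] simp: id_arr id_dom id_cod dom_obj id_iso id_right)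
      moreover have "le u u"
        unfolding le_def using uA by (auto intro!: bexI[of _ "Id C (Dom C u)"] simp: id_arr id_dom id_cod dom_obj id_right)
      ultimately show ?thesis unfolding D_def W_def using u uc by (auto intro!: quotientI)
    qed
    ultimately have "subobject_iso C `` {u} \<in> D q" by simp
    then obtain q' where q': "(u, q') \<in> subobject_iso C" "le q' q" by (auto simp: D_def)
    have "le u q'" using q'(1) unfolding subobject_iso_def hom_def le_def by auto
    then have "le u q" using le_trans q' g(1) by blast
    with le(2) le_trans g(1) show ?thesis by blast
  qed
  then have "largest_complemented i q g"
    unfolding largest_complemented_def using g gM unfolding le_def by auto
  then show thesis using that g by blast
qed

text \<open>Extends \<open>sat_transport\<close> to matches that need not be admissible: the comatch
  is the one of the largest admissible part \<open>h0\<close>. Both \<open>transport_cong\<close>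
  and \<open>transport_shift\<close> evaluate their two sides at such comatches.\<close>

lemma sat_transport_via_largest:
  assumes r: "linear_rule C M r" "cond_over C M c (rule_output C r)" and u: "largest_complemented (snd r) u h0"
    and m: "dpo_comatch C r h0 m'"
  shows "sat C M (transport C c r) (u \<odot> h0) \<longleftrightarrow> sat C M c m'"
proof -
  have "dpo_match C M r h0"
    using u has_pushout_complement_comm unfolding largest_complemented_def dpo_match_def by auto
  then show ?thesis using sat_transport_largest[OF r u] sat_transport[OF r _ m] by simp
qed

lemma transport_cong:
  assumes r: "linear_rule C M r" and c: "cond_over C M c (rule_output C r)" "cond_over C M c' (rule_output C r)"
    and eq: "cond_equiv C M (rule_output C r) c c'"
  shows "cond_equiv C M (rule_input C r) (transport C c r) (transport C c' r)"
  unfolding cond_equiv_def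
proof (intro ballI impI)
  fix h assume h: "h \<in> M" "Dom C h = rule_input C r"
  obtain u h0 where u: "largest_complemented (snd r) u h0" "u \<odot> h0 = h"
    using largest_complemented_ex[of "snd r" h] h r unfolding linear_rule_def by blast
  have "dpo_match C M r h0"
    using u has_pushout_complement_comm unfolding largest_complemented_def dpo_match_def by auto
  then obtain m' where m': "dpo_comatch C r h0 m'" "m' \<in> M" "Dom C m' = rule_output C r"
    using comatch_obtain[OF r] by blast
  show "sat C M (transport C c r) h \<longleftrightarrow> sat C M (transport C c' r) h"
    using sat_transport_via_largest[OF r c(1) u(1) m'(1)] sat_transport_via_largest[OF r c(2) u(1) m'(1)]
      eq m' u unfolding cond_equiv_def by auto
qed

text \<open>As \<open>p\<close> itself has a complement for \<open>i\<close>, the arrow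
  \<open>h\<close> lies below the largest subobject \<open>u\<close> for \<open>h \<odot> p\<close>,
  and this \<open>u\<close> is then also largest for \<open>h\<close> and \<open>i'\<close>. Both
  sides therefore become satisfaction of \<open>c\<close> at \<open>m' \<odot> n\<close>. This
  commutes \<open>shift\<close> with \<open>transport\<close> along the derivation that carries the
  span \<open>(l, i)\<close> to \<open>(l', i')\<close>.\<close>

lemma transport_shift:
  assumes li: "l \<in> M" "i \<in> M" "Dom C l = Dom C i" and p: "p \<in> M"
    and po_i: "is_pushout C i f p i'" and pl: "is_pushout C l f n l'"
    and c: "cond_over C M c (Cod C l)" and h: "h \<in> M" "Dom C h = Cod C p"
  shows "sat C M (transport C (shift C M c n) (l', i')) h \<longleftrightarrow> sat C M (transport C c (l, i)) (h \<odot> p)"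
proof -
  have f: "f \<in> M" using M_pushout_complement_stable[OF po_i li(2) p] .
  have M': "i' \<in> M" "l' \<in> M" "n \<in> M"
    using M_pushout_stable[OF po_i] M_pushout_stable[OF pl] M_pushout_stable'[OF pl f] li by auto
  have t: "p \<in> Arr C" "h \<in> Arr C" "Cod C f = Dom C i'" "Cod C f = Dom C l'" "Cod C p = Cod C i'" "Cod C n = Cod C l'" "Dom C n = Cod C l"
    "Dom C p = Cod C i"
    using pushout_comm[OF po_i] pushout_comm[OF pl] h by (auto simp: comm_square_def intro: M_arr)
  have r': "linear_rule C M (l', i')" using M' t by (simp add: linear_rule_def)
  have r: "linear_rule C M (l, i)" using li by (simp add: linear_rule_def)
  have c': "cond_over C M (shift C M c n) (Cod C l')" using cond_over_shift[of c n] c t M' by simp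
  obtain u h1 where u: "largest_complemented i u h1" "u \<odot> h1 = h \<odot> p"
    using largest_complemented_ex[OF li(2) M_comp[OF p h(1)]] h t by (metis comp_dom)
  have u': "u \<in> M" "u \<in> Arr C" "h1 \<in> M" "Cod C h1 = Dom C u"
    "\<And>q g. \<lbrakk>q \<in> M; Cod C g = Dom C q; q \<odot> g = h \<odot> p; has_pushout_complement C i g\<rbrakk> \<Longrightarrow>
      \<exists>t\<in>Arr C. Dom C t = Dom C q \<and> Cod C t = Dom C u \<and> u \<odot> t = q"
    using u by (auto simp: largest_complemented_def intro: M_arr)
  have "has_pushout_complement C i p" using po_i unfolding has_pushout_complement_def by blast
  then obtain s where s: "s \<in> Arr C" "Dom C s = Dom C h" "Cod C s = Dom C u" "u \<odot> s = h" using u'(5)[OF h(1), of p] h by auto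
  have sM: "s \<in> M" using M_decomp[OF s(1) u'(1) s(3)] s h by simp
  have h1A: "h1 \<in> Arr C" "Dom C h1 = Cod C i" using u has_pushout_complement_comm unfolding largest_complemented_def by auto
  have sp: "s \<odot> p = h1"
    by (rule M_cancel[OF u'(1)]) (use comp_assoc_eq[OF s(4), of p] u u' s t h h1A in simp_all)
  obtain d x where po: "is_pushout C i d (s \<odot> p) x"
    using u sp unfolding largest_complemented_def has_pushout_complement_def by auto
  obtain d1 where d1: "d1 \<in> Arr C" "Dom C d1 = Dom C i'" "is_pushout C i' d1 s x"
    using pushout_complement_decompose(2)[OF po li(2) sM t(1) _ _ po_i] s h t by auto
  have big': "largest_complemented i' u s"
    unfolding largest_complemented_def
  proof (intro conjI ballI allI impI)
    show "has_pushout_complement C i' s" using d1 unfolding has_pushout_complement_def by blast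
    fix q g assume q: "q \<in> M" and "Cod C g = Dom C q \<and> q \<odot> g = u \<odot> s \<and> has_pushout_complement C i' g"
    then have g: "Cod C g = Dom C q" "q \<odot> g = h" "has_pushout_complement C i' g" using s by auto
    have gA: "g \<in> Arr C" "Dom C g = Cod C p" using has_pushout_complement_comm[OF g(3)] t by auto
    have "has_pushout_complement C i (g \<odot> p)"
      using g(3) pushout_compose[OF po_i] unfolding has_pushout_complement_def by blast
    moreover have "q \<odot> (g \<odot> p) = h \<odot> p" using comp_assoc_eq[OF g(2), of p] g gA t M_arr[OF q] by simp
    ultimately show "\<exists>t\<in>Arr C. Dom C t = Dom C q \<and> Cod C t = Dom C u \<and> u \<odot> t = q"
      using u'(5)[OF q, of "g \<odot> p"] g gA t by simp
  qed (use u' s sM in simp_all)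
  obtain m' y where pm: "is_pushout C l' d1 m' y" using M_pushout_ex[OF M'(2) d1(1)] d1 t by auto
  have mM: "m' \<in> M" "Dom C m' = Cod C n"
    using M_pushout_stable'[OF pm] M_pushout_complement_stable[OF d1(3) M'(1) sM] pushout_comm[OF pm] t by (auto simp: comm_square_def)
  have "sat C M (transport C (shift C M c n) (l', i')) h \<longleftrightarrow> sat C M (shift C M c n) m'"
    using sat_transport_via_largest[OF r', of "shift C M c n" u s m'] c' big' pm d1 s unfolding dpo_comatch_def by auto
  also have "\<dots> \<longleftrightarrow> sat C M c (m' \<odot> n)" using sat_shift[of c n m'] c t M' mM by simp
  also have "\<dots> \<longleftrightarrow> sat C M (transport C c (l, i)) (u \<odot> h1)"
  proof -
    \<comment> \<open>Pasting the two layers of pushouts shows that the original rule has comatch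
      \<open>m' \<odot> n\<close> at \<open>h1\<close>.\<close>
    have "dpo_comatch C (l, i) h1 (m' \<odot> n)"
      unfolding dpo_comatch_def using pushout_compose[OF po_i d1(3)] pushout_compose[OF pl pm] sp by auto
    then show ?thesis using sat_transport_via_largest[OF r, of c u h1] c u by simp
  qed
  finally show ?thesis using u by simp
qed

end

section \<open>Transport along composite rules\<close>

lemma (in category) pushout_context_iso:
  assumes p: "is_pushout C f g h k" and d: "is_iso C \<delta>" "Dom C \<delta> = Cod C g"
    and k': "k' \<in> Arr C" "Dom C k' = Cod C \<delta>" "k' \<odot> \<delta> = k"
  shows "is_pushout C f (\<delta> \<odot> g) h k'"
proof -
  note [simp] = id_arr id_dom id_cod dom_obj cod_obj id_left
  have t: "h \<in> Arr C" "k \<in> Arr C" "Cod C h = Cod C k" "Dom C k = Cod C g" "\<delta> \<in> Arr C"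
    using pushout_comm[OF p] d by (auto simp: comm_square_def iso_arr)
  have "Cod C k' = Cod C k" using k' t by auto
  then have "is_pushout C k \<delta> (Id C (Cod C k)) k'"
    by (intro iso_square_pushout) (use t d k' in \<open>auto simp: comm_square_def id_iso\<close>)
  from pushout_compose[OF p this] show ?thesis using t id_left'[of h] by simp
qed

context M_adhesive_category
begin

lemma some_pushout_obtain:
  assumes "f \<in> M" "g \<in> Arr C" "Dom C f = Dom C g"
  obtains h k where "some_pushout C f g = (h, k)" "is_pushout C f g h k"
  using some_pushout[OF assms] by (metis surj_pair)

end

context rewriting_category
begin

text \<open>An identity on the context gives pushout squares over both \<open>i\<close> and
  \<open>l\<close>, so this is an instance of \<open>transport_shift\<close> with a shift along an
  identity; \<open>transport_cong\<close> then removes that shift.\<close>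

lemma transport_post_iso:
  assumes li: "l \<in> M" "i \<in> M" "Dom C l = Dom C i" and \<phi>: "is_iso C \<phi>" "Dom C \<phi> = Cod C i"
    and c: "cond_over C M c (Cod C l)" and h: "h \<in> M" "Dom C h = Cod C \<phi>"
  shows "sat C M (transport C c (l, \<phi> \<odot> i)) h \<longleftrightarrow> sat C M (transport C c (l, i)) (h \<odot> \<phi>)"
proof -
  note [simp] = id_arr id_dom id_cod dom_obj cod_obj
  have A: "l \<in> Arr C" "i \<in> Arr C" "\<phi> \<in> Arr C" "\<phi> \<in> M" using li \<phi> by (auto intro: M_arr M_iso iso_arr)
  have IM: "Id C (Cod C l) \<in> M" using A by (intro M_iso id_iso) simp
  have po1: "is_pushout C i (Id C (Dom C i)) \<phi> (\<phi> \<odot> i)"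
    by (rule iso_square_pushout) (use A li \<phi> id_right'[of "\<phi> \<odot> i"] in \<open>simp_all add: comm_square_def id_iso\<close>)
  have po2: "is_pushout C l (Id C (Dom C i)) (Id C (Cod C l)) l"
    by (rule iso_square_pushout) (use A li \<phi> id_right'[of l] id_left'[of l] in \<open>simp_all add: comm_square_def id_iso\<close>)
  have 1: "sat C M (transport C (shift C M c (Id C (Cod C l))) (l, \<phi> \<odot> i)) h \<longleftrightarrow> sat C M (transport C c (l, i)) (h \<odot> \<phi>)"
    using transport_shift[OF li A(4) po1 po2 c h] .
  have i': "\<phi> \<odot> i \<in> M" using M_comp[OF li(2) A(4)] \<phi> by simp
  have r: "linear_rule C M (l, \<phi> \<odot> i)" unfolding linear_rule_def using li A \<phi> i' by simp
  have c': "cond_over C M (shift C M c (Id C (Cod C l))) (Cod C l)"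
    using cond_over_shift[of c "Id C (Cod C l)"] c A IM by simp
  have "cond_equiv C M (Cod C l) (shift C M c (Id C (Cod C l))) c"
    unfolding cond_equiv_def using sat_shift[of c "Id C (Cod C l)"] c IM A id_right' by (auto simp: M_arr)
  with transport_cong[OF r, of "shift C M c (Id C (Cod C l))" c] c c'
  show ?thesis using 1 h A \<phi> unfolding cond_equiv_def by simp
qed

text \<open>The existential case carries the weight: its arrow must be rewritten through both rules
  in turn. A complement for the composite leg exists exactly if both stages have one, by
  \<open>pushout_analysis\<close> in one direction and \<open>pushout_synthesis\<close> in the
  other. The chosen complements and pushouts differ from the synthesized ones only by isomorphisms,
  which \<open>transport_post_iso\<close> absorbs.\<close>

theorem transport_comp:
  assumes "linear_rule C M (y1, x1)" "linear_rule C M (y2, x2)" "Cod C y1 = Cod C x2"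
    and "is_pullback C z2 z1 x2 y1" "cond_over C M c (Cod C y2)"
    and "h \<in> M" "Dom C h = Cod C x1"
  shows "sat C M (transport C c (y2 \<odot> z2, x1 \<odot> z1)) h \<longleftrightarrow> sat C M (transport C (transport C c (y2, x2)) (y1, x1)) h"
  using assms
proof (induction c arbitrary: y1 x1 y2 x2 z2 z1 h)
  case (CExists a c)
  have M': "y1 \<in> M" "x1 \<in> M" "y2 \<in> M" "x2 \<in> M" "Dom C y1 = Dom C x1" "Dom C y2 = Dom C x2" "Cod C y1 = Cod C x2"
    using CExists.prems by (auto simp: linear_rule_def)
  have pb: "is_pullback C z2 z1 x2 y1" by fact
  have a: "a \<in> M" "Dom C a = Cod C y2" "cond_over C M c (Cod C a)" using CExists.prems by auto
  have zM: "z1 \<in> M" "z2 \<in> M" using M_pullback_stable[OF pb] M_pullback_stable'[OF pb] M' by auto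
  have z: "z1 \<in> Arr C" "z2 \<in> Arr C" "Dom C z1 = Dom C z2" "Cod C z1 = Dom C x1" "Cod C z2 = Dom C x2" "x2 \<odot> z2 = y1 \<odot> z1"
    using pullback_comm[OF pb] M' by (auto simp: comm_square_def)
  have A: "y1 \<in> Arr C" "x1 \<in> Arr C" "y2 \<in> Arr C" "x2 \<in> Arr C" using M' by (auto intro: M_arr)
  have lM: "y2 \<odot> z2 \<in> M" "x1 \<odot> z1 \<in> M" using M_comp zM M' z by auto
  show ?case
  proof (cases "has_pushout_complement C y2 a")
    case False
    have "\<not> has_pushout_complement C (y2 \<odot> z2) a"
    proof
      assume "has_pushout_complement C (y2 \<odot> z2) a"
      then obtain e l' where pe: "is_pushout C (y2 \<odot> z2) e a l'" unfolding has_pushout_complement_def by blast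
      have "e \<in> Arr C" "Dom C z2 = Dom C e" using pushout_comm[OF pe] z A M' by (auto simp: comm_square_def)
      then obtain f w where "is_pushout C z2 e f w" using M_pushout_ex[OF zM(2)] by blast
      from pushout_split[OF pe this] A z M' False show False unfolding has_pushout_complement_def by metis
    qed
    then show ?thesis using False by simp
  next
    case True
    obtain e2 l2 where e2: "some_pushout_complement C y2 a = (e2, l2)" by fastforce
    have pe2: "is_pushout C y2 e2 a l2" using some_pushout_complement[OF True e2] .
    have e2A: "e2 \<in> Arr C" "Dom C x2 = Dom C e2" using pushout_comm[OF pe2] M' by (auto simp: comm_square_def)
    obtain a2 i2 where a2: "some_pushout C x2 e2 = (a2, i2)" and pa2: "is_pushout C x2 e2 a2 i2"
      using some_pushout_obtain[OF M'(4) e2A] .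
    have e2M: "e2 \<in> M" using M_pushout_complement_stable[OF pe2 M'(3) a(1)] .
    have lM2: "l2 \<in> M" "i2 \<in> M" "a2 \<in> M" using M_pushout_stable[OF pe2] M_pushout_stable[OF pa2] M_pushout_stable'[OF pa2 e2M] M' by auto
    have t2: "Dom C l2 = Cod C e2" "Dom C i2 = Cod C e2" "Cod C l2 = Cod C a" "Cod C i2 = Cod C a2" "Dom C a2 = Cod C x2" "i2 \<in> Arr C" "l2 \<in> Arr C" "a2 \<in> Arr C"
      using pushout_comm[OF pe2] pushout_comm[OF pa2] by (auto simp: comm_square_def)
    have r2': "linear_rule C M (l2, i2)" using lM2 t2 by (simp add: linear_rule_def)
    have tr2: "transport C (CExists a c) (y2, x2) = CExists a2 (transport C c (l2, i2))"
      using True e2 a2 by simp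
    show ?thesis
    proof (cases "has_pushout_complement C y1 a2")
      case False
      have "\<not> has_pushout_complement C (y2 \<odot> z2) a"
      proof
        assume "has_pushout_complement C (y2 \<odot> z2) a"
        then obtain e l' where pe: "is_pushout C (y2 \<odot> z2) e a l'" unfolding has_pushout_complement_def by blast
        have e: "e \<in> Arr C" "Dom C z2 = Dom C e" using pushout_comm[OF pe] z A M' by (auto simp: comm_square_def)
        then obtain f w where fw: "is_pushout C z2 e f w" using M_pushout_ex[OF zM(2)] by blast
        obtain y where y: "is_pushout C y2 f a y" using pushout_split[OF pe fw] A z M' by metis
        \<comment> \<open>The complement found by splitting need not be the chosen
          \<open>e2\<close>; it is moved there so that the analysis applies to the chosen pushout
          with leg \<open>a2\<close>.\<close>
        obtain \<delta> where \<delta>: "is_iso C \<delta>" "Dom C \<delta> = Cod C f" "\<delta> \<odot> f = e2"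
          using pushout_complement_unique[OF y pe2 M'(3)] by metis
        have fw2: "is_pushout C z2 e e2 (\<delta> \<odot> w)" using pushout_post_iso[OF fw \<delta>(1,2)] \<delta> by simp
        obtain f1 w1 where "is_pushout C z1 e f1 w1" using M_pushout_ex[OF zM(1) e(1)] e z by auto
        from pushout_analysis[OF fw2 pa2 this z(6)] False A z M' show False unfolding has_pushout_complement_def by metis
      qed
      then show ?thesis unfolding tr2 using False by simp
    next
      case True1: True
      obtain e1 l1 where e1: "some_pushout_complement C y1 a2 = (e1, l1)" by fastforce
      have pe1: "is_pushout C y1 e1 a2 l1" using some_pushout_complement[OF True1 e1] .
      have e1A: "e1 \<in> Arr C" "Dom C x1 = Dom C e1" using pushout_comm[OF pe1] M' by (auto simp: comm_square_def)
      obtain a1 i1 where a1: "some_pushout C x1 e1 = (a1, i1)" and pa1: "is_pushout C x1 e1 a1 i1"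
        using some_pushout_obtain[OF M'(2) e1A] .
      have e1M: "e1 \<in> M" using M_pushout_complement_stable[OF pe1 M'(1) lM2(3)] .
      have lM1: "l1 \<in> M" "i1 \<in> M" "a1 \<in> M" using M_pushout_stable[OF pe1] M_pushout_stable[OF pa1] M_pushout_stable'[OF pa1 e1M] M' by auto
      have t1: "Dom C l1 = Cod C e1" "Dom C i1 = Cod C e1" "Cod C l1 = Cod C a2" "Cod C i1 = Cod C a1" "Dom C a1 = Cod C x1" "i1 \<in> Arr C" "l1 \<in> Arr C" "a1 \<in> Arr C"
        using pushout_comm[OF pe1] pushout_comm[OF pa1] by (auto simp: comm_square_def)
      have r1': "linear_rule C M (l1, i1)" using lM1 t1 by (simp add: linear_rule_def)
      have tr1: "transport C (transport C (CExists a c) (y2, x2)) (y1, x1) = CExists a1 (transport C (transport C c (l2, i2)) (l1, i1))"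
        unfolding tr2 using True1 e1 a1 by simp
      obtain v2 v1 where pv: "is_pullback C v2 v1 i2 l1" using M_pullback_ex[OF lM2(2) t1(7)] t1 t2 by auto
      obtain k where k: "is_pushout C z2 k e2 v2" "is_pushout C z1 k e1 v1"
        using pushout_synthesis[OF pb pa2 pe1 M'(4,1) pv] .
      have pk2: "is_pushout C (y2 \<odot> z2) k a (l2 \<odot> v2)" using pushout_compose_sym[OF k(1) pe2] .
      have pk1: "is_pushout C (x1 \<odot> z1) k a1 (i1 \<odot> v1)" using pushout_compose_sym[OF k(2) pa1] .
      have True12: "has_pushout_complement C (y2 \<odot> z2) a" using pk2 unfolding has_pushout_complement_def by blast
      obtain e l where e: "some_pushout_complement C (y2 \<odot> z2) a = (e, l)" by fastforce
      have pe: "is_pushout C (y2 \<odot> z2) e a l" using some_pushout_complement[OF True12 e] .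
      have eA: "e \<in> Arr C" "Dom C (x1 \<odot> z1) = Dom C e" using pushout_comm[OF pe] z A M' by (auto simp: comm_square_def)
      obtain a' i where a': "some_pushout C (x1 \<odot> z1) e = (a', i)" and pa: "is_pushout C (x1 \<odot> z1) e a' i"
        using some_pushout_obtain[OF lM(2) eA] .
      have tr: "transport C (CExists a c) (y2 \<odot> z2, x1 \<odot> z1) = CExists a' (transport C c (l, i))"
        using True12 e a' by simp
      have eM: "e \<in> M" using M_pushout_complement_stable[OF pe lM(1) a(1)] .
      have lM0: "l \<in> M" "i \<in> M" "a' \<in> M" using M_pushout_stable[OF pe] M_pushout_stable[OF pa] M_pushout_stable'[OF pa eM] lM by auto
      have t: "Dom C l = Cod C e" "Dom C i = Cod C e" "Cod C l = Cod C a" "Cod C i = Cod C a'" "Dom C a' = Cod C x1" "i \<in> Arr C" "l \<in> Arr C" "a' \<in> Arr C"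
        using pushout_comm[OF pe] pushout_comm[OF pa] A z M' by (auto simp: comm_square_def)
      obtain \<delta> where \<delta>: "is_iso C \<delta>" "\<delta> \<in> Arr C" "Dom C \<delta> = Cod C k" "\<delta> \<odot> k = e" "l \<odot> \<delta> = l2 \<odot> v2" "Cod C \<delta> = Cod C e"
        using pushout_complement_unique[OF pk2 pe lM(1)] by metis
      obtain \<epsilon> where \<epsilon>: "is_iso C \<epsilon>" "\<epsilon> \<in> Arr C" "Dom C \<epsilon> = Cod C e" "Cod C \<epsilon> = Cod C k" "\<epsilon> \<odot> \<delta> = Id C (Cod C k)" "\<delta> \<odot> \<epsilon> = Id C (Cod C e)"
        using iso_obtain_inverse[OF \<delta>(1)] \<delta> by metis
      have v: "v1 \<in> Arr C" "v2 \<in> Arr C" "Cod C v1 = Cod C e1" "Cod C v2 = Cod C e2" "Dom C v1 = Cod C k" "Dom C v2 = Cod C k" "k \<in> Arr C"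
        using pushout_comm[OF k(1)] pushout_comm[OF k(2)] by (auto simp: comm_square_def)
      \<comment> \<open>Moving the apex to the chosen context makes \<open>l = l2 \<odot> w2\<close>
        an equality, as the induction hypothesis requires a span of the form
        \<open>(l2 \<odot> w2, i1 \<odot> w1)\<close>. Only the input side then still differs, by
        \<open>\<phi>\<close>.\<close>
      define w2 where "w2 = v2 \<odot> \<epsilon>"
      define w1 where "w1 = v1 \<odot> \<epsilon>"
      have w: "w1 \<in> Arr C" "w2 \<in> Arr C" "Cod C w1 = Cod C e1" "Cod C w2 = Cod C e2" "Dom C w1 = Cod C e" "Dom C w2 = Cod C e"
        unfolding w1_def w2_def using v \<epsilon> by auto
      have pw: "is_pullback C w2 w1 i2 l1" unfolding w1_def w2_def using pullback_pre_iso[OF pv \<epsilon>(1)] \<epsilon> v by simp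
      have "l2 \<odot> w2 = (l \<odot> \<delta>) \<odot> \<epsilon>" unfolding w2_def \<delta>(5) using comp_assoc[of \<epsilon> v2 l2] v \<epsilon> t2 by simp
      then have l: "l = l2 \<odot> w2" using comp_assoc[of \<epsilon> \<delta> l] \<delta> \<epsilon> t id_right'[of l] by simp
      have iw: "(i1 \<odot> w1) \<odot> \<delta> = i1 \<odot> v1"
        unfolding w1_def using comp_assoc[of \<delta> \<epsilon> v1] comp_assoc[of \<delta> "v1 \<odot> \<epsilon>" i1] v \<epsilon> \<delta> t1 id_right'[of v1] by simp
      have "is_pushout C (x1 \<odot> z1) (\<delta> \<odot> k) a1 (i1 \<odot> w1)"
        by (rule pushout_context_iso[OF pk1 \<delta>(1) _ _ _ iw]) (use \<delta> w t1 in simp_all)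
      then have "is_pushout C (x1 \<odot> z1) e a1 (i1 \<odot> w1)" using \<delta> by simp
      then obtain \<phi> where \<phi>: "is_iso C \<phi>" "\<phi> \<in> Arr C" "Dom C \<phi> = Cod C a'" "Cod C \<phi> = Cod C a1" "\<phi> \<odot> a' = a1" "\<phi> \<odot> i = i1 \<odot> w1"
        using pushout_iso_unique[OF pa] by metis
      have ih: "sat C M (transport C (transport C c (l2, i2)) (l1, i1)) q \<longleftrightarrow> sat C M (transport C c (l, i)) (q \<odot> \<phi>)"
        if q: "q \<in> M" "Dom C q = Cod C a1" for q
      proof -
        have "sat C M (transport C c (l2 \<odot> w2, i1 \<odot> w1)) q \<longleftrightarrow> sat C M (transport C (transport C c (l2, i2)) (l1, i1)) q"
          by (rule CExists.IH[OF r1' r2' _ pw _ q(1)]) (use t1 t2 a q in simp_all)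
        moreover have "sat C M (transport C c (l, \<phi> \<odot> i)) q \<longleftrightarrow> sat C M (transport C c (l, i)) (q \<odot> \<phi>)"
          by (rule transport_post_iso) (use lM0 t \<phi> a q in simp_all)
        ultimately show ?thesis using l \<phi> by simp
      qed
      obtain \<psi> where \<psi>: "is_iso C \<psi>" "\<psi> \<in> Arr C" "Dom C \<psi> = Cod C \<phi>" "Cod C \<psi> = Dom C \<phi>" "\<psi> \<odot> \<phi> = Id C (Dom C \<phi>)"
        using iso_obtain_inverse[OF \<phi>(1)] by metis
      have inv: "\<psi> \<odot> a1 = a'" using iso_inverse_left[OF \<psi>(5), of a'] \<phi> \<psi> t by simp
      show ?thesis
      proof
        assume "sat C M (transport C (CExists a c) (y2 \<odot> z2, x1 \<odot> z1)) h"
        then obtain q where q: "q \<in> M" "Dom C q = Cod C a'" "q \<odot> a' = h" "sat C M (transport C c (l, i)) q"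
          unfolding tr by auto
        have qA: "q \<in> Arr C" using q by (auto intro: M_arr)
        have 1: "q \<odot> \<psi> \<in> M" using M_comp[OF M_iso[OF \<psi>(1)] q(1)] q \<psi> \<phi> by simp
        have 2: "(q \<odot> \<psi>) \<odot> a1 = h" using comp_assoc[of a1 \<psi> q] inv q qA \<psi> \<phi> t1 by simp
        have "(q \<odot> \<psi>) \<odot> \<phi> = q" using comp_assoc[of \<phi> \<psi> q] qA \<psi> \<phi> q id_right'[of q] by simp
        then have "sat C M (transport C (transport C c (l2, i2)) (l1, i1)) (q \<odot> \<psi>)"
          using ih[OF 1] q qA \<psi> \<phi> by simp
        then show "sat C M (transport C (transport C (CExists a c) (y2, x2)) (y1, x1)) h"
          unfolding tr1 sat.simps using 1 2 qA \<psi> \<phi> q by (intro bexI[of _ "q \<odot> \<psi>"]) simp_all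
      next
        assume "sat C M (transport C (transport C (CExists a c) (y2, x2)) (y1, x1)) h"
        then obtain q where q: "q \<in> M" "Dom C q = Cod C a1" "q \<odot> a1 = h" "sat C M (transport C (transport C c (l2, i2)) (l1, i1)) q"
          unfolding tr1 by auto
        have qA: "q \<in> Arr C" using q by (auto intro: M_arr)
        have 1: "q \<odot> \<phi> \<in> M" using M_comp[OF M_iso[OF \<phi>(1)] q(1)] q \<phi> by simp
        have 2: "(q \<odot> \<phi>) \<odot> a' = h" using comp_assoc[of a' \<phi> q] q qA \<phi> t by simp
        show "sat C M (transport C (CExists a c) (y2 \<odot> z2, x1 \<odot> z1)) h"
          unfolding tr sat.simps using ih[OF q(1,2)] 1 2 qA \<phi> q by (intro bexI[of _ "q \<odot> \<phi>"]) simp_all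
      qed
    qed
  qed
next
  case (CConj J F)
  have "sat C M (transport C (F j) (y2 \<odot> z2, x1 \<odot> z1)) h \<longleftrightarrow> sat C M (transport C (transport C (F j) (y2, x2)) (y1, x1)) h" if "j \<in> J" for j
    by (rule CConj.IH) (use CConj.prems that in auto)
  then show ?case by simp
next
  case CTrue
  show ?case by simp
next
  case (CNot c)
  have "sat C M (transport C c (y2 \<odot> z2, x1 \<odot> z1)) h \<longleftrightarrow> sat C M (transport C (transport C c (y2, x2)) (y1, x1)) h"
    by (rule CNot.IH) (use CNot.prems in simp_all)
  then show ?case by simp
next
  case (CAnd c c')
  have "sat C M (transport C c (y2 \<odot> z2, x1 \<odot> z1)) h \<longleftrightarrow> sat C M (transport C (transport C c (y2, x2)) (y1, x1)) h"
    by (rule CAnd.IH(1)) (use CAnd.prems in simp_all)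
  moreover have "sat C M (transport C c' (y2 \<odot> z2, x1 \<odot> z1)) h \<longleftrightarrow> sat C M (transport C (transport C c' (y2, x2)) (y1, x1)) h"
    by (rule CAnd.IH(2)) (use CAnd.prems in simp_all)
  ultimately show ?case by simp
qed

end

section \<open>Composition diagrams\<close>

context M_adhesive_category
begin

lemma iso_square_pullback:
  assumes "comm_square C f g h k" "is_iso C g" "is_iso C h"
  shows "is_pullback C f g h k"
  using pullback_sym[OF pushout_along_M_is_pullback[OF pushout_sym[OF iso_square_pushout[OF assms]] M_iso[OF assms(2)]]] .

lemma pullback_shift_iso:
  assumes p: "is_pullback C f g h' k" and d: "is_iso C \<delta>" "Cod C f = Dom C \<delta>" and h: "h \<in> Arr C" "Dom C h = Cod C \<delta>" "h' = h \<odot> \<delta>"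
  shows "is_pullback C (\<delta> \<odot> f) g h k"
proof -
  note [simp] = id_arr id_dom id_cod dom_obj cod_obj id_left
  have t: "k \<in> Arr C" "h' \<in> Arr C" "Cod C k = Cod C h'" "Dom C h' = Cod C f" "\<delta> \<in> Arr C"
    using pullback_comm[OF p] d by (auto simp: comm_square_def iso_arr)
  have c: "Cod C h' = Cod C h" using h t d by simp
  have "is_pullback C h' \<delta> (Id C (Cod C k)) h"
    by (rule iso_square_pullback) (use t d h c id_left'[of h'] in \<open>auto simp: comm_square_def id_iso\<close>)
  from pullback_compose[OF pullback_sym[OF p] this] show ?thesis
    using t id_left'[of k] pullback_sym by simp
qed

text \<open>Undoing \<open>\<delta>\<close> presents the second pushout over the same span
  \<open>f\<close>, \<open>g\<close>, where uniqueness of pushouts applies.\<close>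

lemma pushout_iso_along:
  assumes p: "is_pushout C f g h k" and p': "is_pushout C f (\<delta> \<odot> g) h' k'" and d: "is_iso C \<delta>" "Dom C \<delta> = Cod C g"
  obtains \<pi> where "is_iso C \<pi>" "\<pi> \<in> Arr C" "Dom C \<pi> = Cod C h" "Cod C \<pi> = Cod C h'" "\<pi> \<odot> h = h'" "\<pi> \<odot> k = k' \<odot> \<delta>"
proof -
  obtain \<epsilon> where \<epsilon>: "is_iso C \<epsilon>" "\<epsilon> \<in> Arr C" "Dom C \<epsilon> = Cod C \<delta>" "Cod C \<epsilon> = Dom C \<delta>" "\<epsilon> \<odot> \<delta> = Id C (Dom C \<delta>)" "\<delta> \<odot> \<epsilon> = Id C (Cod C \<delta>)"
    using iso_obtain_inverse[OF d(1)] by metis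
  have t: "g \<in> Arr C" "k' \<in> Arr C" "Dom C k' = Cod C \<delta>" "\<delta> \<in> Arr C"
    using pushout_comm[OF p] pushout_comm[OF p'] d by (auto simp: comm_square_def iso_arr)
  have "(k' \<odot> \<delta>) \<odot> \<epsilon> = k'" using comp_assoc[of \<epsilon> \<delta> k'] \<epsilon> t id_right'[of k'] by simp
  then have "is_pushout C f (\<epsilon> \<odot> (\<delta> \<odot> g)) h' (k' \<odot> \<delta>)"
    using pushout_context_iso[OF p' \<epsilon>(1), of "k' \<odot> \<delta>"] \<epsilon> t d by simp
  then have "is_pushout C f g h' (k' \<odot> \<delta>)" using iso_inverse_left[OF \<epsilon>(5), of g] \<epsilon> t d by simp
  with pushout_iso_unique[OF p] that show thesis by metis
qed

end

text \<open>Any pushouts, complements and pullback are allowed, in contrast to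
  \<open>compose_along\<close>: the diagrams of the associativity proof arise by pasting and need
  not be the chosen ones.\<close>

definition composite_diagram where
  "composite_diagram C r2 r1 \<mu> m2 m1 k1 n1 k2 n2 p2 q2 p1 q1 u2 u1 \<longleftrightarrow>
    is_pushout C (fst \<mu>) (snd \<mu>) m2 m1 \<and>
    is_pushout C (fst r1) k1 m1 n1 \<and> is_pushout C (snd r2) k2 m2 n2 \<and>
    is_pushout C (fst r2) k2 p2 q2 \<and> is_pushout C (snd r1) k1 p1 q1 \<and>
    is_pullback C u2 u1 n2 n1"

definition composite_crule where
  "composite_crule C M c2 c1 m2 n1 q2 p1 q1 u2 u1 =
    ((q2 \<odot>\<^bsub>C\<^esub> u2, q1 \<odot>\<^bsub>C\<^esub> u1), CAnd (shift C M c1 p1) (transport C (shift C M c2 m2) (n1, q1)))"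

text \<open>
  Stronger than \<^const>\<open>crule_equiv\<close>: the conditions are compared on all \<open>M\<close>-morphisms, because that is
  what the requirement that the condition of an admissible match be satisfiable depends on.
\<close>

definition crule_iso :: "('o, 'm) category \<Rightarrow> 'm set \<Rightarrow> 'm crule \<Rightarrow> 'm crule \<Rightarrow> bool" where
  "crule_iso C M R R' \<longleftrightarrow>
    (\<exists>\<phi>O\<in>hom C (rule_output C (fst R)) (rule_output C (fst R')).
     \<exists>\<phi>K\<in>hom C (Dom C (fst (fst R))) (Dom C (fst (fst R'))).
     \<exists>\<phi>I\<in>hom C (rule_input C (fst R)) (rule_input C (fst R')).
       is_iso C \<phi>O \<and> is_iso C \<phi>K \<and> is_iso C \<phi>I \<and>
       \<phi>O \<odot>\<^bsub>C\<^esub> fst (fst R) = fst (fst R') \<odot>\<^bsub>C\<^esub> \<phi>K \<and> \<phi>I \<odot>\<^bsub>C\<^esub> snd (fst R) = snd (fst R') \<odot>\<^bsub>C\<^esub> \<phi>K \<and>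
       (\<forall>h\<in>M. Dom C h = rule_input C (fst R') \<longrightarrow> (sat C M (snd R) (h \<odot>\<^bsub>C\<^esub> \<phi>I) \<longleftrightarrow> sat C M (snd R') h)))"

context M_adhesive_category
begin

lemma crule_isoI:
  assumes "is_iso C \<phi>O" "Dom C \<phi>O = rule_output C (fst R)" "Cod C \<phi>O = rule_output C (fst R')"
    and "is_iso C \<phi>K" "Dom C \<phi>K = Dom C (fst (fst R))" "Cod C \<phi>K = Dom C (fst (fst R'))"
    and "is_iso C \<phi>I" "Dom C \<phi>I = rule_input C (fst R)" "Cod C \<phi>I = rule_input C (fst R')"
    and "\<phi>O \<odot> fst (fst R) = fst (fst R') \<odot> \<phi>K" "\<phi>I \<odot> snd (fst R) = snd (fst R') \<odot> \<phi>K"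
    and "\<And>h. \<lbrakk>h \<in> M; Dom C h = rule_input C (fst R')\<rbrakk> \<Longrightarrow> sat C M (snd R) (h \<odot> \<phi>I) \<longleftrightarrow> sat C M (snd R') h"
  shows "crule_iso C M R R'"
  unfolding crule_iso_def hom_def
  by (rule bexI[of _ \<phi>O], rule bexI[of _ \<phi>K], rule bexI[of _ \<phi>I]) (use assms in \<open>simp_all add: iso_arr\<close>)

lemma crule_isoE:
  assumes "crule_iso C M R R'"
  obtains \<phi>O \<phi>K \<phi>I where "is_iso C \<phi>O" "\<phi>O \<in> Arr C" "Dom C \<phi>O = rule_output C (fst R)" "Cod C \<phi>O = rule_output C (fst R')"
    "is_iso C \<phi>K" "\<phi>K \<in> Arr C" "Dom C \<phi>K = Dom C (fst (fst R))" "Cod C \<phi>K = Dom C (fst (fst R'))"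
    "is_iso C \<phi>I" "\<phi>I \<in> Arr C" "Dom C \<phi>I = rule_input C (fst R)" "Cod C \<phi>I = rule_input C (fst R')"
    "\<phi>O \<odot> fst (fst R) = fst (fst R') \<odot> \<phi>K" "\<phi>I \<odot> snd (fst R) = snd (fst R') \<odot> \<phi>K"
    "\<forall>h\<in>M. Dom C h = rule_input C (fst R') \<longrightarrow> (sat C M (snd R) (h \<odot> \<phi>I) \<longleftrightarrow> sat C M (snd R') h)"
  using assms unfolding crule_iso_def hom_def by blast

lemma linear_ruleD:
  assumes "linear_rule C M r"
  shows "fst r \<in> M" "snd r \<in> M" "fst r \<in> Arr C" "snd r \<in> Arr C" "Dom C (fst r) = Dom C (snd r)"
  using assms by (auto simp: linear_rule_def M_arr)

lemma linear_cruleD: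
  assumes "linear_crule C M R"
  shows "linear_rule C M (fst R)" "cond_over C M (snd R) (rule_input C (fst R))"
  using assms by (auto simp: linear_crule_def)

lemma iso_conjugate_square:
  assumes "\<phi> \<odot> a = b \<odot> \<psi>" "\<psi>' \<odot> \<psi> = Id C (Dom C \<psi>)" "\<phi>' \<odot> \<phi> = Id C (Dom C \<phi>)" "\<psi> \<odot> \<psi>' = Id C (Cod C \<psi>)"
    and "\<phi> \<in> Arr C" "\<phi>' \<in> Arr C" "\<psi> \<in> Arr C" "\<psi>' \<in> Arr C" "a \<in> Arr C" "b \<in> Arr C"
    and "Dom C \<phi> = Cod C a" "Dom C a = Dom C \<psi>" "Cod C \<psi> = Dom C b" "Cod C \<phi> = Cod C b"
    and "Dom C \<phi>' = Cod C \<phi>" "Cod C \<phi>' = Dom C \<phi>" "Dom C \<psi>' = Cod C \<psi>" "Cod C \<psi>' = Dom C \<psi>"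
  shows "\<phi>' \<odot> b = a \<odot> \<psi>'"
proof -
  have "\<phi> \<odot> (a \<odot> \<psi>') = b \<odot> (\<psi> \<odot> \<psi>')"
    using comp_assoc[of \<psi>' a \<phi>] comp_assoc[of \<psi>' \<psi> b] assms(1,5-) by metis
  also have "\<dots> = b" using assms id_right'[of b] by simp
  finally have "\<phi>' \<odot> (\<phi> \<odot> (a \<odot> \<psi>')) = \<phi>' \<odot> b" by simp
  moreover have "\<phi>' \<odot> (\<phi> \<odot> (a \<odot> \<psi>')) = a \<odot> \<psi>'"
    by (rule iso_inverse_left[OF assms(3)]) (use assms(5-) in simp_all)
  ultimately show ?thesis by simp
qed

lemma crule_iso_sym:
  assumes i: "crule_iso C M R R'" and l: "linear_rule C M (fst R)" "linear_rule C M (fst R')"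
  shows "crule_iso C M R' R"
proof -
  obtain \<phi>O \<phi>K \<phi>I where \<phi>: "is_iso C \<phi>O" "\<phi>O \<in> Arr C" "Dom C \<phi>O = rule_output C (fst R)" "Cod C \<phi>O = rule_output C (fst R')"
    "is_iso C \<phi>K" "\<phi>K \<in> Arr C" "Dom C \<phi>K = Dom C (fst (fst R))" "Cod C \<phi>K = Dom C (fst (fst R'))"
    "is_iso C \<phi>I" "\<phi>I \<in> Arr C" "Dom C \<phi>I = rule_input C (fst R)" "Cod C \<phi>I = rule_input C (fst R')"
    "\<phi>O \<odot> fst (fst R) = fst (fst R') \<odot> \<phi>K" "\<phi>I \<odot> snd (fst R) = snd (fst R') \<odot> \<phi>K"
    "\<forall>h\<in>M. Dom C h = rule_input C (fst R') \<longrightarrow> (sat C M (snd R) (h \<odot> \<phi>I) \<longleftrightarrow> sat C M (snd R') h)"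
    using crule_isoE[OF i] .
  obtain \<psi>O where O: "is_iso C \<psi>O" "\<psi>O \<in> Arr C" "Dom C \<psi>O = Cod C \<phi>O" "Cod C \<psi>O = Dom C \<phi>O" "\<psi>O \<odot> \<phi>O = Id C (Dom C \<phi>O)"
    using iso_obtain_inverse[OF \<phi>(1)] by metis
  obtain \<psi>K where K: "is_iso C \<psi>K" "\<psi>K \<in> Arr C" "Dom C \<psi>K = Cod C \<phi>K" "Cod C \<psi>K = Dom C \<phi>K" "\<psi>K \<odot> \<phi>K = Id C (Dom C \<phi>K)" "\<phi>K \<odot> \<psi>K = Id C (Cod C \<phi>K)"
    using iso_obtain_inverse[OF \<phi>(5)] by metis
  obtain \<psi>I where I: "is_iso C \<psi>I" "\<psi>I \<in> Arr C" "Dom C \<psi>I = Cod C \<phi>I" "Cod C \<psi>I = Dom C \<phi>I" "\<psi>I \<odot> \<phi>I = Id C (Dom C \<phi>I)"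
    using iso_obtain_inverse[OF \<phi>(9)] by metis
  note l = linear_ruleD[OF l(1)] linear_ruleD[OF l(2)]
  show ?thesis
  proof (rule crule_isoI[of \<psi>O _ _ \<psi>K \<psi>I])
    show "\<psi>O \<odot> fst (fst R') = fst (fst R) \<odot> \<psi>K"
      by (rule iso_conjugate_square[OF \<phi>(13) K(5) O(5) K(6)]) (use \<phi> O K l in auto)
    show "\<psi>I \<odot> snd (fst R') = snd (fst R) \<odot> \<psi>K"
      by (rule iso_conjugate_square[OF \<phi>(14) K(5) I(5) K(6)]) (use \<phi> I K l in auto)
    fix h assume h: "h \<in> M" "Dom C h = rule_input C (fst R)"
    have hA: "h \<in> Arr C" using h by (auto intro: M_arr)
    have "h \<odot> \<psi>I \<in> M" using M_comp[OF M_iso[OF I(1)] h(1)] I \<phi> h by simp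
    then have "sat C M (snd R) ((h \<odot> \<psi>I) \<odot> \<phi>I) \<longleftrightarrow> sat C M (snd R') (h \<odot> \<psi>I)"
      using \<phi>(15)[rule_format, of "h \<odot> \<psi>I"] I \<phi> h hA by simp
    moreover have "(h \<odot> \<psi>I) \<odot> \<phi>I = h" using comp_assoc[of \<phi>I \<psi>I h] I \<phi> h hA id_right'[of h] by simp
    ultimately show "sat C M (snd R') (h \<odot> \<psi>I) \<longleftrightarrow> sat C M (snd R) h" by simp
  qed (use \<phi> O K I in simp_all)
qed

lemma crule_iso_trans:
  assumes i: "crule_iso C M R R'" and i': "crule_iso C M R' R''"
    and l: "linear_rule C M (fst R)" "linear_rule C M (fst R')" "linear_rule C M (fst R'')"
  shows "crule_iso C M R R''"
proof -
  obtain \<phi>O \<phi>K \<phi>I where \<phi>: "is_iso C \<phi>O" "\<phi>O \<in> Arr C" "Dom C \<phi>O = rule_output C (fst R)" "Cod C \<phi>O = rule_output C (fst R')"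
    "is_iso C \<phi>K" "\<phi>K \<in> Arr C" "Dom C \<phi>K = Dom C (fst (fst R))" "Cod C \<phi>K = Dom C (fst (fst R'))"
    "is_iso C \<phi>I" "\<phi>I \<in> Arr C" "Dom C \<phi>I = rule_input C (fst R)" "Cod C \<phi>I = rule_input C (fst R')"
    "\<phi>O \<odot> fst (fst R) = fst (fst R') \<odot> \<phi>K" "\<phi>I \<odot> snd (fst R) = snd (fst R') \<odot> \<phi>K"
    "\<forall>h\<in>M. Dom C h = rule_input C (fst R') \<longrightarrow> (sat C M (snd R) (h \<odot> \<phi>I) \<longleftrightarrow> sat C M (snd R') h)"
    using crule_isoE[OF i] .
  obtain \<psi>O \<psi>K \<psi>I where \<psi>: "is_iso C \<psi>O" "\<psi>O \<in> Arr C" "Dom C \<psi>O = rule_output C (fst R')" "Cod C \<psi>O = rule_output C (fst R'')"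
    "is_iso C \<psi>K" "\<psi>K \<in> Arr C" "Dom C \<psi>K = Dom C (fst (fst R'))" "Cod C \<psi>K = Dom C (fst (fst R''))"
    "is_iso C \<psi>I" "\<psi>I \<in> Arr C" "Dom C \<psi>I = rule_input C (fst R')" "Cod C \<psi>I = rule_input C (fst R'')"
    "\<psi>O \<odot> fst (fst R') = fst (fst R'') \<odot> \<psi>K" "\<psi>I \<odot> snd (fst R') = snd (fst R'') \<odot> \<psi>K"
    "\<forall>h\<in>M. Dom C h = rule_input C (fst R'') \<longrightarrow> (sat C M (snd R') (h \<odot> \<psi>I) \<longleftrightarrow> sat C M (snd R'') h)"
    using crule_isoE[OF i'] .
  note l = linear_ruleD[OF l(1)] linear_ruleD[OF l(2)] linear_ruleD[OF l(3)]
  have sq: "(b \<odot> a) \<odot> f = f'' \<odot> (\<psi>K \<odot> \<phi>K)"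
    if "a \<odot> f = f' \<odot> \<phi>K" "b \<odot> f' = f'' \<odot> \<psi>K" "a \<in> Arr C" "b \<in> Arr C" "f \<in> Arr C" "f' \<in> Arr C" "f'' \<in> Arr C"
      "Dom C a = Cod C f" "Cod C a = Cod C f'" "Dom C b = Cod C f'" "Dom C f' = Dom C (fst (fst R'))" "Dom C f'' = Dom C (fst (fst R''))" for a b f f' f''
  proof -
    have "(b \<odot> a) \<odot> f = b \<odot> (f' \<odot> \<phi>K)" using that comp_assoc[of f a b] by simp
    also have "\<dots> = (f'' \<odot> \<psi>K) \<odot> \<phi>K" using comp_assoc[of \<phi>K f' b] that \<phi> by simp
    also have "\<dots> = f'' \<odot> (\<psi>K \<odot> \<phi>K)" using comp_assoc[of \<phi>K \<psi>K f''] that \<phi> \<psi> by simp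
    finally show ?thesis .
  qed
  show ?thesis
  proof (rule crule_isoI[of "\<psi>O \<odot> \<phi>O" _ _ "\<psi>K \<odot> \<phi>K" "\<psi>I \<odot> \<phi>I"])
    show "(\<psi>O \<odot> \<phi>O) \<odot> fst (fst R) = fst (fst R'') \<odot> (\<psi>K \<odot> \<phi>K)"
      by (rule sq[OF \<phi>(13) \<psi>(13)]) (use \<phi> \<psi> l in auto)
    show "(\<psi>I \<odot> \<phi>I) \<odot> snd (fst R) = snd (fst R'') \<odot> (\<psi>K \<odot> \<phi>K)"
      by (rule sq[OF \<phi>(14) \<psi>(14)]) (use \<phi> \<psi> l in auto)
    fix h assume h: "h \<in> M" "Dom C h = rule_input C (fst R'')"
    have hA: "h \<in> Arr C" using h by (auto intro: M_arr)
    have "h \<odot> \<psi>I \<in> M" using M_comp[OF M_iso[OF \<psi>(9)] h(1)] \<psi> h by simp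
    moreover have "(h \<odot> \<psi>I) \<odot> \<phi>I = h \<odot> (\<psi>I \<odot> \<phi>I)" using comp_assoc[of \<phi>I \<psi>I h] \<phi> \<psi> h hA by simp
    ultimately show "sat C M (snd R) (h \<odot> (\<psi>I \<odot> \<phi>I)) \<longleftrightarrow> sat C M (snd R'') h"
      using \<phi>(15)[rule_format, of "h \<odot> \<psi>I"] \<psi>(15)[rule_format, OF h] \<psi> h hA by simp
  qed (use \<phi> \<psi> in \<open>simp_all add: iso_comp\<close>)
qed

lemma crule_iso_not_false:
  assumes i: "crule_iso C M R R'" and e: "cond_equiv C M (rule_input C (fst R)) (snd R) CFalse"
  shows "cond_equiv C M (rule_input C (fst R')) (snd R') CFalse"
  unfolding cond_equiv_def
proof (intro ballI impI)
  fix h assume h: "h \<in> M" "Dom C h = rule_input C (fst R')"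
  obtain \<phi>I where \<phi>: "is_iso C \<phi>I" "\<phi>I \<in> Arr C" "Dom C \<phi>I = rule_input C (fst R)" "Cod C \<phi>I = rule_input C (fst R')"
    "sat C M (snd R) (h \<odot> \<phi>I) \<longleftrightarrow> sat C M (snd R') h"
    using crule_isoE[OF i] h by metis
  have "h \<odot> \<phi>I \<in> M" using M_comp[OF M_iso[OF \<phi>(1)] h(1)] \<phi> h by simp
  moreover have "Dom C (h \<odot> \<phi>I) = rule_input C (fst R)" using \<phi> h by (simp add: M_arr)
  ultimately show "sat C M (snd R') h \<longleftrightarrow> sat C M CFalse h"
    using e \<phi> unfolding cond_equiv_def by simp
qed

end

section \<open>Independence of composites from the choices made\<close>

context rewriting_category
begin

text \<open>\<open>sat_shift\<close> rephrases precomposition with \<open>\<phi>I\<close> as a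
  shift, and DPO-admissible matches are in particular \<open>M\<close>-morphisms.\<close>

lemma crule_iso_imp_equiv:
  assumes i: "crule_iso C M R R'" and l: "linear_crule C M R"
  shows "crule_equiv C M R R'"
proof -
  obtain \<phi>O \<phi>K \<phi>I where \<phi>: "is_iso C \<phi>O" "\<phi>O \<in> Arr C" "Dom C \<phi>O = rule_output C (fst R)" "Cod C \<phi>O = rule_output C (fst R')"
    "is_iso C \<phi>K" "\<phi>K \<in> Arr C" "Dom C \<phi>K = Dom C (fst (fst R))" "Cod C \<phi>K = Dom C (fst (fst R'))"
    "is_iso C \<phi>I" "\<phi>I \<in> Arr C" "Dom C \<phi>I = rule_input C (fst R)" "Cod C \<phi>I = rule_input C (fst R')"
    "\<phi>O \<odot> fst (fst R) = fst (fst R') \<odot> \<phi>K" "\<phi>I \<odot> snd (fst R) = snd (fst R') \<odot> \<phi>K"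
    "\<forall>h\<in>M. Dom C h = rule_input C (fst R') \<longrightarrow> (sat C M (snd R) (h \<odot> \<phi>I) \<longleftrightarrow> sat C M (snd R') h)"
    using crule_isoE[OF i] .
  have "dot_equiv C M (fst R') (shift C M (snd R) \<phi>I) (snd R')"
    unfolding dot_equiv_def dpo_match_def
    using \<phi> sat_shift[of "snd R" \<phi>I] M_iso linear_cruleD(2)[OF l] by auto
  with \<phi>(1-14) show ?thesis unfolding crule_equiv_def Let_def case_prod_beta hom_def
    by - (rule bexI[of _ \<phi>O], rule bexI[of _ \<phi>K], rule bexI[of _ \<phi>I], simp_all)
qed

lemma composite_diagram_typing:
  assumes l: "linear_rule C M r2" "linear_rule C M r1" and o: "overlap_span C M r2 r1 \<mu>"
    and d: "composite_diagram C r2 r1 \<mu> m2 m1 k1 n1 k2 n2 p2 q2 p1 q1 u2 u1"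
  shows "m2 \<in> M" "m1 \<in> M" "k1 \<in> M" "n1 \<in> M" "k2 \<in> M" "n2 \<in> M" "p2 \<in> M" "q2 \<in> M" "p1 \<in> M" "q1 \<in> M" "u2 \<in> M" "u1 \<in> M"
    "m2 \<in> Arr C" "m1 \<in> Arr C" "k1 \<in> Arr C" "n1 \<in> Arr C" "k2 \<in> Arr C" "n2 \<in> Arr C" "p2 \<in> Arr C" "q2 \<in> Arr C" "p1 \<in> Arr C" "q1 \<in> Arr C" "u2 \<in> Arr C" "u1 \<in> Arr C"
    "Dom C m2 = Cod C (snd r2)" "Dom C m1 = Cod C (fst r1)" "Cod C m1 = Cod C m2" "Dom C k1 = Dom C (snd r1)"
    "Dom C n1 = Cod C k1" "Cod C n1 = Cod C m2" "Dom C k2 = Dom C (snd r2)" "Dom C n2 = Cod C k2" "Cod C n2 = Cod C m2"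
    "Dom C p2 = Cod C (fst r2)" "Cod C p2 = Cod C q2" "Dom C q2 = Cod C k2" "Dom C p1 = Cod C (snd r1)" "Cod C p1 = Cod C q1"
    "Dom C q1 = Cod C k1" "Dom C u1 = Dom C u2" "Cod C u1 = Cod C k1" "Cod C u2 = Cod C k2"
proof -
  have p: "is_pushout C (fst \<mu>) (snd \<mu>) m2 m1" "is_pushout C (fst r1) k1 m1 n1" "is_pushout C (snd r2) k2 m2 n2"
    "is_pushout C (fst r2) k2 p2 q2" "is_pushout C (snd r1) k1 p1 q1" "is_pullback C u2 u1 n2 n1"
    using d by (auto simp: composite_diagram_def)
  have \<mu>: "fst \<mu> \<in> M" "snd \<mu> \<in> M" "Dom C (fst \<mu>) = Dom C (snd \<mu>)" "Cod C (fst \<mu>) = Cod C (snd r2)" "Cod C (snd \<mu>) = Cod C (fst r1)"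
    using o by (auto simp: overlap_span_def)
  note l = linear_ruleD[OF l(1)] linear_ruleD[OF l(2)]
  show m: "m2 \<in> M" "m1 \<in> M" using M_pushout_stable[OF p(1)] M_pushout_stable'[OF p(1)] \<mu> by auto
  show k: "k1 \<in> M" "k2 \<in> M" using M_pushout_complement_stable[OF p(2)] M_pushout_complement_stable[OF p(3)] l m by auto
  show n: "n1 \<in> M" "n2 \<in> M" "q1 \<in> M" "q2 \<in> M" "p1 \<in> M" "p2 \<in> M"
    using M_pushout_stable[OF p(2)] M_pushout_stable[OF p(3)] M_pushout_stable[OF p(4)] M_pushout_stable[OF p(5)]
      M_pushout_stable'[OF p(4)] M_pushout_stable'[OF p(5)] l k by auto
  show u: "u2 \<in> M" "u1 \<in> M" using M_pullback_stable[OF p(6)] M_pullback_stable'[OF p(6)] n by auto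
  show "m2 \<in> Arr C" "m1 \<in> Arr C" "k1 \<in> Arr C" "n1 \<in> Arr C" "k2 \<in> Arr C" "n2 \<in> Arr C" "p2 \<in> Arr C" "q2 \<in> Arr C" "p1 \<in> Arr C" "q1 \<in> Arr C" "u2 \<in> Arr C" "u1 \<in> Arr C"
    using m k n u by (auto intro: M_arr)
  have c: "comm_square C (fst \<mu>) (snd \<mu>) m2 m1" "comm_square C (fst r1) k1 m1 n1" "comm_square C (snd r2) k2 m2 n2"
    "comm_square C (fst r2) k2 p2 q2" "comm_square C (snd r1) k1 p1 q1" "comm_square C u2 u1 n2 n1"
    using p by (auto intro: pushout_comm pullback_comm)
  show m2: "Dom C m2 = Cod C (snd r2)" "Dom C m1 = Cod C (fst r1)" "Cod C m1 = Cod C m2"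
    using c(1) \<mu> by (auto simp: comm_square_def)
  show n1: "Dom C k1 = Dom C (snd r1)" "Dom C n1 = Cod C k1" "Cod C n1 = Cod C m2"
    using c(2) m2 l by (auto simp: comm_square_def)
  show n2: "Dom C k2 = Dom C (snd r2)" "Dom C n2 = Cod C k2" "Cod C n2 = Cod C m2"
    using c(3) by (auto simp: comm_square_def)
  show "Dom C p2 = Cod C (fst r2)" "Cod C p2 = Cod C q2" "Dom C q2 = Cod C k2"
    using c(4) by (auto simp: comm_square_def)
  show "Dom C p1 = Cod C (snd r1)" "Cod C p1 = Cod C q1" "Dom C q1 = Cod C k1"
    using c(5) by (auto simp: comm_square_def)
  show "Dom C u1 = Dom C u2" "Cod C u1 = Cod C k1" "Cod C u2 = Cod C k2"
    using c(6) n1 n2 by (auto simp: comm_square_def)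
qed

lemma composite_crule_linear:
  assumes R: "linear_crule C M R2" "linear_crule C M R1" and o: "overlap_span C M (fst R2) (fst R1) \<mu>"
    and d: "composite_diagram C (fst R2) (fst R1) \<mu> m2 m1 k1 n1 k2 n2 p2 q2 p1 q1 u2 u1"
  shows "linear_crule C M (composite_crule C M (snd R2) (snd R1) m2 n1 q2 p1 q1 u2 u1)"
proof -
  note t = composite_diagram_typing[OF linear_cruleD(1)[OF R(1)] linear_cruleD(1)[OF R(2)] o d]
  have "q2 \<odot> u2 \<in> M" "q1 \<odot> u1 \<in> M" using M_comp t by auto
  moreover have "cond_over C M (shift C M (snd R1) p1) (Cod C q1)"
    using cond_over_shift[of "snd R1" p1] linear_cruleD(2)[OF R(2)] t by simp
  moreover have "cond_over C M (transport C (shift C M (snd R2) m2) (n1, q1)) (Cod C q1)"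
    using cond_over_transport[of "(n1, q1)" "shift C M (snd R2) m2"] cond_over_shift[of "snd R2" m2] linear_cruleD(2)[OF R(1)] t
    by (simp add: linear_rule_def)
  ultimately show ?thesis
    unfolding composite_crule_def linear_crule_def linear_rule_def using t by simp
qed

text \<open>Universal properties give isomorphisms \<open>\<alpha>\<close>,
  \<open>\<delta>1\<close>, \<open>\<delta>2\<close>, \<open>\<pi>1\<close>, \<open>\<pi>2\<close>,
  \<open>\<kappa>\<close> between corresponding corners. Squares with two opposite isomorphisms are
  pushouts, so agreement of the transported conditions is a case of \<open>transport_shift\<close>
  followed by \<open>transport_cong\<close>.\<close>

theorem composite_unique:
  assumes R: "linear_crule C M R2" "linear_crule C M R1" and o: "overlap_span C M (fst R2) (fst R1) \<mu>"
    and d: "composite_diagram C (fst R2) (fst R1) \<mu> m2 m1 k1 n1 k2 n2 p2 q2 p1 q1 u2 u1"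
    and d': "composite_diagram C (fst R2) (fst R1) \<mu> m2' m1' k1' n1' k2' n2' p2' q2' p1' q1' u2' u1'"
  shows "crule_iso C M (composite_crule C M (snd R2) (snd R1) m2 n1 q2 p1 q1 u2 u1)
    (composite_crule C M (snd R2) (snd R1) m2' n1' q2' p1' q1' u2' u1')"
proof -
  note l = linear_cruleD(1)[OF R(1)] linear_cruleD(1)[OF R(2)]
  note t = composite_diagram_typing[OF l o d] and t' = composite_diagram_typing[OF l o d']
  note lD = linear_ruleD[OF l(1)] linear_ruleD[OF l(2)]
  have p: "is_pushout C (fst \<mu>) (snd \<mu>) m2 m1" "is_pushout C (fst (fst R1)) k1 m1 n1" "is_pushout C (snd (fst R2)) k2 m2 n2"
    "is_pushout C (fst (fst R2)) k2 p2 q2" "is_pushout C (snd (fst R1)) k1 p1 q1" "is_pullback C u2 u1 n2 n1"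
    using d by (auto simp: composite_diagram_def)
  have p': "is_pushout C (fst \<mu>) (snd \<mu>) m2' m1'" "is_pushout C (fst (fst R1)) k1' m1' n1'" "is_pushout C (snd (fst R2)) k2' m2' n2'"
    "is_pushout C (fst (fst R2)) k2' p2' q2'" "is_pushout C (snd (fst R1)) k1' p1' q1'" "is_pullback C u2' u1' n2' n1'"
    using d' by (auto simp: composite_diagram_def)
  obtain \<alpha> where \<alpha>: "is_iso C \<alpha>" "\<alpha> \<in> Arr C" "Dom C \<alpha> = Cod C m2" "Cod C \<alpha> = Cod C m2'" "\<alpha> \<odot> m2 = m2'" "\<alpha> \<odot> m1 = m1'"
    using pushout_iso_unique[OF p(1) p'(1)] .
  have "is_pushout C (fst (fst R1)) k1 m1' (\<alpha> \<odot> n1)" using pushout_post_iso[OF p(2) \<alpha>(1)] \<alpha> t by simp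
  then obtain \<delta>1 where \<delta>1: "is_iso C \<delta>1" "\<delta>1 \<in> Arr C" "Dom C \<delta>1 = Cod C k1" "Cod C \<delta>1 = Cod C k1'" "\<delta>1 \<odot> k1 = k1'" "n1' \<odot> \<delta>1 = \<alpha> \<odot> n1"
    using pushout_complement_unique[OF _ p'(2) lD(6)] by metis
  have "is_pushout C (snd (fst R2)) k2 m2' (\<alpha> \<odot> n2)" using pushout_post_iso[OF p(3) \<alpha>(1)] \<alpha> t by simp
  then obtain \<delta>2 where \<delta>2: "is_iso C \<delta>2" "\<delta>2 \<in> Arr C" "Dom C \<delta>2 = Cod C k2" "Cod C \<delta>2 = Cod C k2'" "\<delta>2 \<odot> k2 = k2'" "n2' \<odot> \<delta>2 = \<alpha> \<odot> n2"
    using pushout_complement_unique[OF _ p'(3) lD(2)] by metis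
  obtain \<pi>2 where \<pi>2: "is_iso C \<pi>2" "\<pi>2 \<in> Arr C" "Dom C \<pi>2 = Cod C p2" "Cod C \<pi>2 = Cod C p2'" "\<pi>2 \<odot> p2 = p2'" "\<pi>2 \<odot> q2 = q2' \<odot> \<delta>2"
    using pushout_iso_along[OF p(4) _ \<delta>2(1,3)] p'(4) \<delta>2(5) by metis
  obtain \<pi>1 where \<pi>1: "is_iso C \<pi>1" "\<pi>1 \<in> Arr C" "Dom C \<pi>1 = Cod C p1" "Cod C \<pi>1 = Cod C p1'" "\<pi>1 \<odot> p1 = p1'" "\<pi>1 \<odot> q1 = q1' \<odot> \<delta>1"
    using pushout_iso_along[OF p(5) _ \<delta>1(1,3)] p'(5) \<delta>1(5) by metis
  \<comment> \<open>The pullback is carried to the second diagram in stages: composing with the mono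
    \<open>\<alpha>\<close> preserves it, then \<open>\<delta>2\<close> and \<open>\<delta>1\<close>
    replace one leg each.\<close>
  have "is_pullback C u2 u1 (\<alpha> \<odot> n2) (\<alpha> \<odot> n1)"
    using pullback_post_mono[OF p(6) iso_mono[OF \<alpha>(1)]] \<alpha> t by simp
  from pullback_shift_iso[OF this \<delta>2(1) _ _ _ \<delta>2(6)[symmetric]]
  have "is_pullback C (\<delta>2 \<odot> u2) u1 n2' (\<alpha> \<odot> n1)" using \<delta>2(3,4) t t' by simp
  from pullback_shift_iso[OF pullback_sym[OF this] \<delta>1(1) _ _ _ \<delta>1(6)[symmetric]]
  have "is_pullback C (\<delta>1 \<odot> u1) (\<delta>2 \<odot> u2) n1' n2'" using \<delta>1(3,4) t t' by simp
  then obtain \<kappa> where \<kappa>: "is_iso C \<kappa>" "\<kappa> \<in> Arr C" "Dom C \<kappa> = Dom C (\<delta>1 \<odot> u1)" "Cod C \<kappa> = Dom C u1'" "u1' \<odot> \<kappa> = \<delta>1 \<odot> u1" "u2' \<odot> \<kappa> = \<delta>2 \<odot> u2"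
    using pullback_iso_unique[OF _ pullback_sym[OF p'(6)]] by metis
  have sq: "\<pi> \<odot> (q \<odot> u) = (q' \<odot> u') \<odot> \<kappa>"
    if "\<pi> \<odot> q = q' \<odot> \<delta>" "u' \<odot> \<kappa> = \<delta> \<odot> u" "\<pi> \<in> Arr C" "q \<in> Arr C" "q' \<in> Arr C" "\<delta> \<in> Arr C" "u \<in> Arr C" "u' \<in> Arr C"
      "Dom C \<pi> = Cod C q" "Cod C u = Dom C q" "Dom C \<delta> = Dom C q" "Cod C \<delta> = Dom C q'" "Dom C u' = Cod C \<kappa>" "Cod C u' = Dom C q'" for \<pi> q u q' u' \<delta>
  proof -
    have "\<pi> \<odot> (q \<odot> u) = (q' \<odot> \<delta>) \<odot> u" using comp_assoc[of u q \<pi>] that by simp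
    also have "\<dots> = q' \<odot> (u' \<odot> \<kappa>)" using comp_assoc[of u \<delta> q'] that by simp
    also have "\<dots> = (q' \<odot> u') \<odot> \<kappa>" using comp_assoc[of \<kappa> u' q'] that \<kappa> by simp
    finally show ?thesis .
  qed
  have "linear_rule C M (n1', q1')" using t' by (simp add: linear_rule_def)
  note tc = transport_cong[OF this]
  have c2: "cond_over C M (snd R2) (Dom C m2)" "cond_over C M (snd R1) (Dom C p1)" using R t by (auto simp: linear_crule_def)
  have \<alpha>M: "\<alpha> \<in> M" "\<pi>1 \<in> M" using \<alpha> \<pi>1 by (auto intro: M_iso)
  have s: "cond_over C M (shift C M (snd R2) m2) (Cod C m2)" "cond_over C M (shift C M (snd R2) m2') (Cod C m2')"
    using cond_over_shift[of "snd R2"] c2 t t' by auto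
  have s': "cond_over C M (shift C M (shift C M (snd R2) m2) \<alpha>) (Cod C m2')"
    using cond_over_shift[of "shift C M (snd R2) m2" \<alpha>] s \<alpha> \<alpha>M by simp
  have "cond_equiv C M (Cod C m2') (shift C M (shift C M (snd R2) m2) \<alpha>) (shift C M (snd R2) m2')"
    unfolding cond_equiv_def
  proof (intro ballI impI)
    fix h assume h: "h \<in> M" "Dom C h = Cod C m2'"
    then have hA: "h \<in> Arr C" "h \<odot> \<alpha> \<in> M" using \<alpha> \<alpha>M M_comp by (auto intro: M_arr)
    then show "sat C M (shift C M (shift C M (snd R2) m2) \<alpha>) h \<longleftrightarrow> sat C M (shift C M (snd R2) m2') h"
      using sat_shift[of "shift C M (snd R2) m2" \<alpha> h] sat_shift[of "snd R2" m2 "h \<odot> \<alpha>"] sat_shift[of "snd R2" m2' h]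
        comp_assoc[of m2 \<alpha> h] s \<alpha> \<alpha>M h c2 t t' by simp
  qed
  with tc[of "shift C M (shift C M (snd R2) m2) \<alpha>" "shift C M (snd R2) m2'"] s s' t'
  have tr: "cond_equiv C M (Cod C q1') (transport C (shift C M (shift C M (snd R2) m2) \<alpha>) (n1', q1'))
      (transport C (shift C M (snd R2) m2') (n1', q1'))" by simp
  show ?thesis
  proof (rule crule_isoI[of \<pi>2 _ _ \<kappa> \<pi>1])
    fix h assume "h \<in> M" "Dom C h = Cod C (snd (fst (composite_crule C M (snd R2) (snd R1) m2' n1' q2' p1' q1' u2' u1')))"
    then have h: "h \<in> M" "Dom C h = Cod C q1'" "h \<in> Arr C" using t' by (auto simp: composite_crule_def M_arr)
    have h1: "h \<odot> \<pi>1 \<in> M" using M_comp[OF \<alpha>M(2) h(1)] h \<pi>1 t' by simp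
    have 1: "sat C M (shift C M (snd R1) p1) (h \<odot> \<pi>1) \<longleftrightarrow> sat C M (shift C M (snd R1) p1') h"
      using sat_shift[of "snd R1" p1 "h \<odot> \<pi>1"] sat_shift[of "snd R1" p1' h] comp_assoc[of p1 \<pi>1 h] c2 t t' \<pi>1 h h1 by simp
    have po1: "is_pushout C q1 \<delta>1 \<pi>1 q1'" using \<pi>1 \<delta>1 t t' by (intro iso_square_pushout) (simp_all add: comm_square_def)
    have po2: "is_pushout C n1 \<delta>1 \<alpha> n1'" using \<alpha> \<delta>1 t t' by (intro iso_square_pushout) (simp_all add: comm_square_def)
    have "sat C M (transport C (shift C M (shift C M (snd R2) m2) \<alpha>) (n1', q1')) h \<longleftrightarrow>
      sat C M (transport C (shift C M (snd R2) m2) (n1, q1)) (h \<odot> \<pi>1)"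
      by (rule transport_shift[OF _ _ _ \<alpha>M(2) po1 po2]) (use t t' s h \<pi>1 in simp_all)
    moreover have "sat C M (transport C (shift C M (shift C M (snd R2) m2) \<alpha>) (n1', q1')) h \<longleftrightarrow>
      sat C M (transport C (shift C M (snd R2) m2') (n1', q1')) h"
      using tr h unfolding cond_equiv_def by blast
    ultimately show "sat C M (snd (composite_crule C M (snd R2) (snd R1) m2 n1 q2 p1 q1 u2 u1)) (h \<odot> \<pi>1) \<longleftrightarrow>
      sat C M (snd (composite_crule C M (snd R2) (snd R1) m2' n1' q2' p1' q1' u2' u1')) h"
      using 1 by (simp add: composite_crule_def)
  next
    show "\<pi>2 \<odot> fst (fst (composite_crule C M (snd R2) (snd R1) m2 n1 q2 p1 q1 u2 u1)) =
      fst (fst (composite_crule C M (snd R2) (snd R1) m2' n1' q2' p1' q1' u2' u1')) \<odot> \<kappa>"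
      unfolding composite_crule_def fst_conv snd_conv
      by (rule sq[OF \<pi>2(6) \<kappa>(6)]) (use t t' \<pi>2(2-4) \<delta>2(2-4) \<kappa>(2-4) in simp_all)
    show "\<pi>1 \<odot> snd (fst (composite_crule C M (snd R2) (snd R1) m2 n1 q2 p1 q1 u2 u1)) =
      snd (fst (composite_crule C M (snd R2) (snd R1) m2' n1' q2' p1' q1' u2' u1')) \<odot> \<kappa>"
      unfolding composite_crule_def fst_conv snd_conv
      by (rule sq[OF \<pi>1(6) \<kappa>(5)]) (use t t' \<pi>1(2-4) \<delta>1(2-4) \<kappa>(2-4) in simp_all)
  qed (use \<kappa> \<pi>1 \<pi>2 \<delta>1 t t' in \<open>simp_all add: composite_crule_def\<close>)
qed

end

text \<open>The intermediate values of \<open>compose_along\<close> as a relation.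
  \<open>SOME\<close> returns a value even where no complement exists, so such values are always
  available; for an overlap of linear rules they form a composition diagram once the two complements
  exist.\<close>

definition chosen_diagram where
  "chosen_diagram C r2 r1 \<mu> m2 m1 k1 n1 k2 n2 p2 q2 p1 q1 u2 u1 \<longleftrightarrow>
    some_pushout C (fst \<mu>) (snd \<mu>) = (m2, m1) \<and>
    some_pushout_complement C (fst r1) m1 = (k1, n1) \<and> some_pushout_complement C (snd r2) m2 = (k2, n2) \<and>
    some_pushout C (fst r2) k2 = (p2, q2) \<and> some_pushout C (snd r1) k1 = (p1, q1) \<and>
    some_pullback C n2 n1 = (u2, u1)"

lemma chosen_diagram_ex:
  obtains m2 m1 k1 n1 k2 n2 p2 q2 p1 q1 u2 u1
  where "chosen_diagram C r2 r1 \<mu> m2 m1 k1 n1 k2 n2 p2 q2 p1 q1 u2 u1"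
  unfolding chosen_diagram_def by (metis surj_pair)

lemma compose_along_chosen:
  assumes "chosen_diagram C (fst R2) (fst R1) \<mu> m2 m1 k1 n1 k2 n2 p2 q2 p1 q1 u2 u1"
  shows "compose_along C M R2 \<mu> R1 = composite_crule C M (snd R2) (snd R1) m2 n1 q2 p1 q1 u2 u1"
proof -
  obtain o2 i2 c2 o1 i1 c1 where R: "R2 = ((o2, i2), c2)" "R1 = ((o1, i1), c1)" by (metis surj_pair)
  show ?thesis
    using assms unfolding R chosen_diagram_def compose_along_def composite_crule_def
    by (simp add: case_prod_beta)
qed

text \<open>Pushout and pullback squares are symmetric, so inverting the spans exchanges the two
  rules together with their halves of the diagram. Only plain rules are reversed in this way;
  conditions sit on inputs and have to be treated separately.\<close>

lemma composite_diagram_reverse: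
  assumes "category C" "composite_diagram C r2 r1 \<mu> m2 m1 k1 n1 k2 n2 p2 q2 p1 q1 u2 u1"
  shows "composite_diagram C (prod.swap r1) (prod.swap r2) (prod.swap \<mu>) m1 m2 k2 n2 k1 n1 p1 q1 p2 q2 u1 u2"
  using assms category.pushout_sym[OF assms(1)] category.pullback_sym[OF assms(1)]
  unfolding composite_diagram_def by simp

lemma linear_rule_swap: "linear_rule C M (prod.swap r) \<longleftrightarrow> linear_rule C M r"
  unfolding linear_rule_def by auto

lemma overlap_span_swap: "overlap_span C M (prod.swap r1) (prod.swap r2) (prod.swap \<mu>) \<longleftrightarrow> overlap_span C M r2 r1 \<mu>"
  unfolding overlap_span_def by auto

section \<open>Spans up to isomorphism of the apex\<close>

context category
begin

lemma span_isoE: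
  assumes "(\<mu>, \<nu>) \<in> span_iso C"
  obtains \<phi> where "is_iso C \<phi>" "\<phi> \<in> Arr C" "Dom C \<phi> = Dom C (fst \<mu>)" "Cod C \<phi> = Dom C (fst \<nu>)"
    "fst \<nu> \<odot> \<phi> = fst \<mu>" "snd \<nu> \<odot> \<phi> = snd \<mu>" "is_span C \<mu>" "is_span C \<nu>"
  using assms unfolding span_iso_def hom_def by auto

lemma span_isoI:
  assumes "is_span C \<nu>" "is_iso C \<phi>" "Cod C \<phi> = Dom C (fst \<nu>)" "fst \<nu> \<odot> \<phi> = fst \<mu>" "snd \<nu> \<odot> \<phi> = snd \<mu>"
  shows "(\<mu>, \<nu>) \<in> span_iso C"
proof -
  have t: "\<phi> \<in> Arr C" "fst \<nu> \<in> Arr C" "snd \<nu> \<in> Arr C" "Dom C (snd \<nu>) = Dom C (fst \<nu>)"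
    using assms by (auto simp: is_span_def iso_arr)
  have "fst \<nu> \<odot> \<phi> \<in> Arr C" "snd \<nu> \<odot> \<phi> \<in> Arr C" "Dom C (fst \<nu> \<odot> \<phi>) = Dom C \<phi>" "Dom C (snd \<nu> \<odot> \<phi>) = Dom C \<phi>"
    using t assms(3) by simp_all
  then have "is_span C \<mu>" "Dom C (fst \<mu>) = Dom C \<phi>" unfolding is_span_def using assms by simp_all
  then show ?thesis unfolding span_iso_def hom_def using assms t by auto
qed

lemma span_iso_refl: "is_span C \<mu> \<Longrightarrow> (\<mu>, \<mu>) \<in> span_iso C"
  by (rule span_isoI[of _ "Id C (Dom C (fst \<mu>))"])
    (auto simp: is_span_def id_iso id_cod dom_obj id_right')

lemma span_iso_sym:
  assumes "(\<mu>, \<nu>) \<in> span_iso C"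
  shows "(\<nu>, \<mu>) \<in> span_iso C"
proof -
  obtain \<phi> where \<phi>: "is_iso C \<phi>" "\<phi> \<in> Arr C" "Dom C \<phi> = Dom C (fst \<mu>)" "Cod C \<phi> = Dom C (fst \<nu>)"
    "fst \<nu> \<odot> \<phi> = fst \<mu>" "snd \<nu> \<odot> \<phi> = snd \<mu>" "is_span C \<mu>" "is_span C \<nu>"
    using span_isoE[OF assms] .
  obtain \<psi> where \<psi>: "is_iso C \<psi>" "\<psi> \<in> Arr C" "Dom C \<psi> = Cod C \<phi>" "Cod C \<psi> = Dom C \<phi>" "\<phi> \<odot> \<psi> = Id C (Cod C \<phi>)"
    using iso_obtain_inverse[OF \<phi>(1)] by metis
  have "(a \<odot> \<phi>) \<odot> \<psi> = a" if "a \<in> Arr C" "Dom C a = Dom C (fst \<nu>)" for a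
    using comp_assoc[of \<psi> \<phi> a] that \<phi>(2,4) \<psi> id_right'[of a] by simp
  then have "fst \<mu> \<odot> \<psi> = fst \<nu>" "snd \<mu> \<odot> \<psi> = snd \<nu>" using \<phi> unfolding is_span_def by metis+
  then show ?thesis by (intro span_isoI[of \<mu> \<psi>]) (use \<phi> \<psi> in auto)
qed

lemma span_iso_trans:
  assumes "(\<mu>, \<nu>) \<in> span_iso C" "(\<nu>, \<rho>) \<in> span_iso C"
  shows "(\<mu>, \<rho>) \<in> span_iso C"
proof -
  obtain \<phi> where \<phi>: "is_iso C \<phi>" "\<phi> \<in> Arr C" "Dom C \<phi> = Dom C (fst \<mu>)" "Cod C \<phi> = Dom C (fst \<nu>)"
    "fst \<nu> \<odot> \<phi> = fst \<mu>" "snd \<nu> \<odot> \<phi> = snd \<mu>" "is_span C \<mu>" "is_span C \<nu>"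
    using span_isoE[OF assms(1)] .
  obtain \<psi> where \<psi>: "is_iso C \<psi>" "\<psi> \<in> Arr C" "Dom C \<psi> = Dom C (fst \<nu>)" "Cod C \<psi> = Dom C (fst \<rho>)"
    "fst \<rho> \<odot> \<psi> = fst \<nu>" "snd \<rho> \<odot> \<psi> = snd \<nu>" "is_span C \<rho>"
    using span_isoE[OF assms(2)] by metis
  show ?thesis
  proof (rule span_isoI[of \<rho> "\<psi> \<odot> \<phi>"])
    show "fst \<rho> \<odot> (\<psi> \<odot> \<phi>) = fst \<mu>" using comp_assoc_eq[OF \<psi>(5), of \<phi>] \<phi> \<psi> by (simp add: is_span_def)
    show "snd \<rho> \<odot> (\<psi> \<odot> \<phi>) = snd \<mu>" using comp_assoc_eq[OF \<psi>(6), of \<phi>] \<phi> \<psi> by (simp add: is_span_def)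
  qed (use \<phi> \<psi> in \<open>simp_all add: iso_comp\<close>)
qed

lemma span_iso_swap: "(\<mu>, \<nu>) \<in> span_iso C \<Longrightarrow> (prod.swap \<mu>, prod.swap \<nu>) \<in> span_iso C"
  unfolding span_iso_def is_span_def by auto

lemma span_iso_class_eq:
  assumes "(\<mu>, \<nu>) \<in> span_iso C"
  shows "span_iso C `` {\<mu>} = span_iso C `` {\<nu>}"
  using assms span_iso_sym span_iso_trans by blast

lemma span_class_rep:
  assumes "is_span C \<mu>"
  shows "(\<mu>, SOME \<nu>. \<nu> \<in> span_iso C `` {\<mu>}) \<in> span_iso C"
proof -
  have "\<mu> \<in> span_iso C `` {\<mu>}" using span_iso_refl[OF assms] by simp
  from someI[of "\<lambda>\<nu>. \<nu> \<in> span_iso C `` {\<mu>}", OF this] show ?thesis by simp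
qed

lemma pushout_span_iso:
  assumes "(\<mu>, \<nu>) \<in> span_iso C" "is_pushout C (fst \<mu>) (snd \<mu>) h k"
  shows "is_pushout C (fst \<nu>) (snd \<nu>) h k"
proof -
  obtain \<phi> where \<phi>: "is_iso C \<phi>" "Cod C \<phi> = Dom C (fst \<mu>)" "fst \<mu> \<odot> \<phi> = fst \<nu>" "snd \<mu> \<odot> \<phi> = snd \<nu>"
    using span_isoE[OF span_iso_sym[OF assms(1)]] by metis
  from pushout_pre_iso[OF assms(2) \<phi>(1,2)] \<phi> show ?thesis by simp
qed

lemma pullback_span_iso:
  assumes "(\<mu>, \<nu>) \<in> span_iso C" "is_pullback C (fst \<mu>) (snd \<mu>) h k"
  shows "is_pullback C (fst \<nu>) (snd \<nu>) h k"
proof -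
  obtain \<phi> where \<phi>: "is_iso C \<phi>" "Cod C \<phi> = Dom C (fst \<mu>)" "fst \<mu> \<odot> \<phi> = fst \<nu>" "snd \<mu> \<odot> \<phi> = snd \<nu>"
    using span_isoE[OF span_iso_sym[OF assms(1)]] by metis
  from pullback_pre_iso[OF assms(2) \<phi>(1,2)] \<phi> show ?thesis by simp
qed

lemma pullback_spans_iso:
  assumes "is_pullback C (fst \<mu>) (snd \<mu>) h k" "is_pullback C (fst \<nu>) (snd \<nu>) h k"
  shows "(\<mu>, \<nu>) \<in> span_iso C"
proof -
  obtain \<phi> where \<phi>: "is_iso C \<phi>" "Dom C \<phi> = Dom C (fst \<mu>)" "Cod C \<phi> = Dom C (fst \<nu>)" "fst \<nu> \<odot> \<phi> = fst \<mu>" "snd \<nu> \<odot> \<phi> = snd \<mu>"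
    using pullback_iso_unique[OF assms] .
  moreover have "is_span C \<nu>" using pullback_comm[OF assms(2)] by (auto simp: is_span_def comm_square_def)
  ultimately show ?thesis by (intro span_isoI[of \<nu> \<phi>]) auto
qed

end

context M_adhesive_category
begin

lemma overlap_span_iso:
  assumes "(\<mu>, \<nu>) \<in> span_iso C" "overlap_span C M r2 r1 \<mu>"
  shows "overlap_span C M r2 r1 \<nu>"
proof -
  obtain \<phi> where \<phi>: "is_iso C \<phi>" "\<phi> \<in> Arr C" "Cod C \<phi> = Dom C (fst \<mu>)" "fst \<mu> \<odot> \<phi> = fst \<nu>" "snd \<mu> \<odot> \<phi> = snd \<nu>" "is_span C \<nu>"
    using span_isoE[OF span_iso_sym[OF assms(1)]] by metis
  have o: "fst \<mu> \<in> M" "snd \<mu> \<in> M" "Dom C (snd \<mu>) = Dom C (fst \<mu>)" "Cod C (fst \<mu>) = rule_input C r2" "Cod C (snd \<mu>) = rule_output C r1"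
    using assms(2) by (auto simp: overlap_span_def)
  have "fst \<mu> \<odot> \<phi> \<in> M" "snd \<mu> \<odot> \<phi> \<in> M" using M_comp[OF M_iso[OF \<phi>(1)]] o \<phi>(3) by simp_all
  moreover have "Cod C (fst \<mu> \<odot> \<phi>) = rule_input C r2" "Cod C (snd \<mu> \<odot> \<phi>) = rule_output C r1"
    using o \<phi>(2,3) M_arr[OF o(1)] M_arr[OF o(2)] by simp_all
  ultimately show ?thesis using \<phi> by (simp add: overlap_span_def is_span_def)
qed

lemma overlap_is_span: "overlap_span C M r2 r1 \<mu> \<Longrightarrow> is_span C \<mu>"
  by (auto simp: overlap_span_def is_span_def M_arr)

lemma chosen_diagram_composite:
  assumes l: "linear_rule C M r2" "linear_rule C M r1" and o: "overlap_span C M r2 r1 \<mu>"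
    and c: "chosen_diagram C r2 r1 \<mu> m2 m1 k1 n1 k2 n2 p2 q2 p1 q1 u2 u1"
    and pc: "has_pushout_complement C (fst r1) m1" "has_pushout_complement C (snd r2) m2"
  shows "composite_diagram C r2 r1 \<mu> m2 m1 k1 n1 k2 n2 p2 q2 p1 q1 u2 u1"
proof -
  have c: "some_pushout C (fst \<mu>) (snd \<mu>) = (m2, m1)"
    "some_pushout_complement C (fst r1) m1 = (k1, n1)" "some_pushout_complement C (snd r2) m2 = (k2, n2)"
    "some_pushout C (fst r2) k2 = (p2, q2)" "some_pushout C (snd r1) k1 = (p1, q1)" "some_pullback C n2 n1 = (u2, u1)"
    using c by (auto simp: chosen_diagram_def)
  have o: "fst \<mu> \<in> M" "snd \<mu> \<in> M" "Dom C (fst \<mu>) = Dom C (snd \<mu>)" using o by (auto simp: overlap_span_def)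
  note l = linear_ruleD[OF l(1)] linear_ruleD[OF l(2)]
  have 1: "is_pushout C (fst \<mu>) (snd \<mu>) m2 m1" using some_pushout[OF o(1) M_arr[OF o(2)] o(3) c(1)] .
  have 2: "is_pushout C (fst r1) k1 m1 n1" using some_pushout_complement[OF pc(1) c(2)] .
  have 3: "is_pushout C (snd r2) k2 m2 n2" using some_pushout_complement[OF pc(2) c(3)] .
  have k: "k1 \<in> Arr C" "Dom C (snd r1) = Dom C k1" "k2 \<in> Arr C" "Dom C (fst r2) = Dom C k2" "Cod C n1 = Cod C m1" "Cod C n2 = Cod C m2" "n1 \<in> Arr C"
    using pushout_comm[OF 2] pushout_comm[OF 3] l(5) l(10)[symmetric] by (simp_all add: comm_square_def)
  have 4: "is_pushout C (fst r2) k2 p2 q2" using some_pushout[OF l(1) k(3,4) c(4)] .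
  have 5: "is_pushout C (snd r1) k1 p1 q1" using some_pushout[OF l(7) k(1,2) c(5)] .
  have "Cod C m2 = Cod C m1" using pushout_comm[OF 1] by (simp add: comm_square_def)
  then have "\<exists>z. case z of (f, g) \<Rightarrow> is_pullback C f g n2 n1"
    using M_pullback_ex[OF M_pushout_stable[OF 3 l(2)] k(7)] k by auto
  from someI_ex[OF this] have 6: "is_pullback C u2 u1 n2 n1" using c(6) by (simp add: some_pullback_def)
  show ?thesis unfolding composite_diagram_def using 1 2 3 4 5 6 by blast
qed

end

context rewriting_category
begin

text \<open>The isomorphism \<open>\<alpha>\<close> between the given and the chosen pushout carries
  the complements along, so the chosen complements are genuine as soon as some composition diagram
  exists.\<close>

lemma composite_diagram_chosen:
  assumes l: "linear_rule C M r2" "linear_rule C M r1" and o: "overlap_span C M r2 r1 \<mu>"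
    and d: "composite_diagram C r2 r1 \<mu> m2 m1 k1 n1 k2 n2 p2 q2 p1 q1 u2 u1"
    and c: "chosen_diagram C r2 r1 \<mu> m2' m1' k1' n1' k2' n2' p2' q2' p1' q1' u2' u1'"
  shows "has_pushout_complement C (fst r1) m1'" "has_pushout_complement C (snd r2) m2'"
    "composite_diagram C r2 r1 \<mu> m2' m1' k1' n1' k2' n2' p2' q2' p1' q1' u2' u1'"
proof -
  have \<mu>: "fst \<mu> \<in> M" "snd \<mu> \<in> M" "Dom C (fst \<mu>) = Dom C (snd \<mu>)" using o by (auto simp: overlap_span_def)
  have p: "is_pushout C (fst \<mu>) (snd \<mu>) m2 m1" "is_pushout C (fst r1) k1 m1 n1" "is_pushout C (snd r2) k2 m2 n2"
    using d by (auto simp: composite_diagram_def)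
  have "is_pushout C (fst \<mu>) (snd \<mu>) m2' m1'"
    using some_pushout[OF \<mu>(1) M_arr[OF \<mu>(2)] \<mu>(3)] c by (simp add: chosen_diagram_def)
  then obtain \<alpha> where \<alpha>: "is_iso C \<alpha>" "Dom C \<alpha> = Cod C m2" "\<alpha> \<odot> m2 = m2'" "\<alpha> \<odot> m1 = m1'"
    using pushout_iso_unique[OF p(1)] by metis
  have "Cod C m1 = Cod C m2" using pushout_comm[OF p(1)] by (simp add: comm_square_def)
  then show pc: "has_pushout_complement C (fst r1) m1'" "has_pushout_complement C (snd r2) m2'"
    using has_pushout_complement_post_iso[OF _ \<alpha>(1)] \<alpha> p unfolding has_pushout_complement_def by metis+
  show "composite_diagram C r2 r1 \<mu> m2' m1' k1' n1' k2' n2' p2' q2' p1' q1' u2' u1'"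
    using chosen_diagram_composite[OF l o c pc] .
qed

lemma admissible_spanE:
  assumes R: "linear_crule C M R2" "linear_crule C M R1" and a: "admissible_span C M R2 R1 \<mu>"
  obtains m2 m1 k1 n1 k2 n2 p2 q2 p1 q1 u2 u1 where "overlap_span C M (fst R2) (fst R1) \<mu>"
    "chosen_diagram C (fst R2) (fst R1) \<mu> m2 m1 k1 n1 k2 n2 p2 q2 p1 q1 u2 u1"
    "composite_diagram C (fst R2) (fst R1) \<mu> m2 m1 k1 n1 k2 n2 p2 q2 p1 q1 u2 u1"
    "compose_along C M R2 \<mu> R1 = composite_crule C M (snd R2) (snd R1) m2 n1 q2 p1 q1 u2 u1"
    "linear_crule C M (compose_along C M R2 \<mu> R1)"
    "\<not> cond_equiv C M (rule_input C (fst (compose_along C M R2 \<mu> R1))) (snd (compose_along C M R2 \<mu> R1)) CFalse"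
proof -
  obtain m2 m1 k1 n1 k2 n2 p2 q2 p1 q1 u2 u1
    where c: "chosen_diagram C (fst R2) (fst R1) \<mu> m2 m1 k1 n1 k2 n2 p2 q2 p1 q1 u2 u1" by (rule chosen_diagram_ex)
  have a': "overlap_span C M (fst R2) (fst R1) \<mu>" "has_pushout_complement C (fst (fst R1)) m1" "has_pushout_complement C (snd (fst R2)) m2"
    "\<not> cond_equiv C M (rule_input C (fst (compose_along C M R2 \<mu> R1))) (snd (compose_along C M R2 \<mu> R1)) CFalse"
    using a c unfolding admissible_span_def chosen_diagram_def by (auto simp: case_prod_beta Let_def)
  have d: "composite_diagram C (fst R2) (fst R1) \<mu> m2 m1 k1 n1 k2 n2 p2 q2 p1 q1 u2 u1"
    using chosen_diagram_composite[OF linear_cruleD(1)[OF R(1)] linear_cruleD(1)[OF R(2)] a'(1) c a'(2,3)] .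
  show thesis
    using that[OF a'(1) c d compose_along_chosen[OF c]] composite_crule_linear[OF R a'(1) d] a'(4) compose_along_chosen[OF c, of M] by simp
qed

lemma compose_along_iso:
  assumes R: "linear_crule C M R2" "linear_crule C M R1" and o: "overlap_span C M (fst R2) (fst R1) \<mu>"
    and d: "composite_diagram C (fst R2) (fst R1) \<mu> m2 m1 k1 n1 k2 n2 p2 q2 p1 q1 u2 u1"
  shows "crule_iso C M (compose_along C M R2 \<mu> R1) (composite_crule C M (snd R2) (snd R1) m2 n1 q2 p1 q1 u2 u1)"
    "linear_crule C M (compose_along C M R2 \<mu> R1)"
proof -
  note l = linear_cruleD(1)[OF R(1)] linear_cruleD(1)[OF R(2)]
  obtain m2' m1' k1' n1' k2' n2' p2' q2' p1' q1' u2' u1'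
    where c: "chosen_diagram C (fst R2) (fst R1) \<mu> m2' m1' k1' n1' k2' n2' p2' q2' p1' q1' u2' u1'" by (rule chosen_diagram_ex)
  have d': "composite_diagram C (fst R2) (fst R1) \<mu> m2' m1' k1' n1' k2' n2' p2' q2' p1' q1' u2' u1'"
    using composite_diagram_chosen(3)[OF l o d c] .
  show "crule_iso C M (compose_along C M R2 \<mu> R1) (composite_crule C M (snd R2) (snd R1) m2 n1 q2 p1 q1 u2 u1)"
    "linear_crule C M (compose_along C M R2 \<mu> R1)"
    using composite_unique[OF R o d' d] composite_crule_linear[OF R o d'] compose_along_chosen[OF c, of M] by simp_all
qed

lemma admissible_spanI:
  assumes R: "linear_crule C M R2" "linear_crule C M R1" and o: "overlap_span C M (fst R2) (fst R1) \<mu>"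
    and d: "composite_diagram C (fst R2) (fst R1) \<mu> m2 m1 k1 n1 k2 n2 p2 q2 p1 q1 u2 u1"
    and nf: "\<not> cond_equiv C M (rule_input C (fst (compose_along C M R2 \<mu> R1))) (snd (compose_along C M R2 \<mu> R1)) CFalse"
  shows "admissible_span C M R2 R1 \<mu>"
proof -
  note l = linear_cruleD(1)[OF R(1)] linear_cruleD(1)[OF R(2)]
  obtain m2' m1' k1' n1' k2' n2' p2' q2' p1' q1' u2' u1'
    where c: "chosen_diagram C (fst R2) (fst R1) \<mu> m2' m1' k1' n1' k2' n2' p2' q2' p1' q1' u2' u1'" by (rule chosen_diagram_ex)
  show ?thesis
    using composite_diagram_chosen(1,2)[OF l o d c] nf o c
    unfolding admissible_span_def chosen_diagram_def by (auto simp: case_prod_beta Let_def)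
qed

lemma admissible_span_iso:
  assumes R: "linear_crule C M R2" "linear_crule C M R1" and a: "admissible_span C M R2 R1 \<mu>" and i: "(\<mu>, \<nu>) \<in> span_iso C"
  shows "admissible_span C M R2 R1 \<nu>"
proof -
  obtain m2 m1 k1 n1 k2 n2 p2 q2 p1 q1 u2 u1 where o: "overlap_span C M (fst R2) (fst R1) \<mu>"
    and d: "composite_diagram C (fst R2) (fst R1) \<mu> m2 m1 k1 n1 k2 n2 p2 q2 p1 q1 u2 u1"
    and e: "compose_along C M R2 \<mu> R1 = composite_crule C M (snd R2) (snd R1) m2 n1 q2 p1 q1 u2 u1"
    and nf: "\<not> cond_equiv C M (rule_input C (fst (compose_along C M R2 \<mu> R1))) (snd (compose_along C M R2 \<mu> R1)) CFalse"
    using admissible_spanE[OF R a] by metis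
  have o': "overlap_span C M (fst R2) (fst R1) \<nu>" using overlap_span_iso[OF i o] .
  have d': "composite_diagram C (fst R2) (fst R1) \<nu> m2 m1 k1 n1 k2 n2 p2 q2 p1 q1 u2 u1"
    using d pushout_span_iso[OF i] unfolding composite_diagram_def by simp
  show ?thesis
    using admissible_spanI[OF R o' d'] crule_iso_not_false[OF compose_along_iso(1)[OF R o' d']] nf e by auto
qed

text \<open>Admissibility is invariant under isomorphism of spans, hence it passes from whichever
  span generated the class to its \<open>SOME\<close> member.\<close>

lemma matches_rep:
  assumes R: "linear_crule C M R2" "linear_crule C M R1" and X: "X \<in> matches C M R2 R1"
  shows "admissible_span C M R2 R1 (SOME \<mu>. \<mu> \<in> X)" "X = span_iso C `` {SOME \<mu>. \<mu> \<in> X}"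
proof -
  obtain \<mu> where \<mu>: "admissible_span C M R2 R1 \<mu>" "X = span_iso C `` {\<mu>}"
    using X unfolding matches_def by (auto elim: quotientE)
  have "is_span C \<mu>" using \<mu>(1) overlap_is_span unfolding admissible_span_def by blast
  from span_class_rep[OF this]
  have "(\<mu>, SOME \<mu>. \<mu> \<in> X) \<in> span_iso C" using \<mu> by simp
  then show "admissible_span C M R2 R1 (SOME \<mu>. \<mu> \<in> X)" "X = span_iso C `` {SOME \<mu>. \<mu> \<in> X}"
    using admissible_span_iso[OF R \<mu>(1)] span_iso_class_eq \<mu>(2) by (blast, metis)
qed

lemma matches_class: "admissible_span C M R2 R1 \<mu> \<Longrightarrow> span_iso C `` {\<mu>} \<in> matches C M R2 R1"
  unfolding matches_def by (auto intro: quotientI)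

end

section \<open>Middle diagrams of three-fold composites\<close>

text \<open>
  A three-fold composite is determined by \<open>I2 \<rightarrow> A \<leftarrow> O1\<close> (morphisms \<open>h\<close> and \<open>g1\<close>), a direct derivation
  from \<open>A\<close> to \<open>B\<close> by the middle rule \<open>r\<close>, and \<open>O2 \<rightarrow> B \<leftarrow> I3\<close> (morphisms \<open>g\<close> and \<open>h3\<close>).
  Reversing all rules swaps the two sides and hence the two ways of bracketing.
\<close>

definition middle_diagram where
  "middle_diagram C M r g1 d h x g y h3 \<longleftrightarrow> g1 \<in> M \<and> h \<in> M \<and> h3 \<in> M \<and>
    Cod C g1 = Cod C h \<and> Cod C h3 = Cod C g \<and> is_pushout C (snd r) d h x \<and> is_pushout C (fst r) d g y"

text \<open>The derivation \<open>N21 \<Rightarrow> O21\<close> of a composition diagram, embedded into \<open>A \<Rightarrow> B\<close> by \<open>u\<close> and \<open>e\<close>.\<close>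

definition embedding where
  "embedding C M m2 m1 k n p q g1 d h x g y u f e \<longleftrightarrow> u \<in> M \<and>
    u \<odot>\<^bsub>C\<^esub> m2 = h \<and> u \<odot>\<^bsub>C\<^esub> m1 = g1 \<and> f \<odot>\<^bsub>C\<^esub> k = d \<and> e \<odot>\<^bsub>C\<^esub> p = g \<and>
    is_pushout C n f u x \<and> is_pushout C q f e y"

text \<open>Only the middle rule's half of the composition diagram occurs, so the same predicate
  serves both bracketings after reversal. Joint epicness is used in place of a pushout over
  \<open>\<nu>\<close> because it is the form that can be moved from \<open>B\<close> to
  \<open>A\<close>; for pullbacks of \<open>M\<close>-morphisms the two are equivalent.\<close>

definition induces where
  "induces C M r \<mu> m2 m1 k n p q \<nu> g1 d h x g y h3 \<longleftrightarrow>
    middle_diagram C M r g1 d h x g y h3 \<and> fst \<mu> \<in> M \<and> is_pushout C (fst \<mu>) (snd \<mu>) m2 m1 \<and>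
    is_pushout C (snd r) k m2 n \<and> is_pushout C (fst r) k p q \<and>
    (\<exists>u f e. embedding C M m2 m1 k n p q g1 d h x g y u f e \<and>
      is_pullback C (fst \<nu>) (snd \<nu>) h3 e \<and> jointly_epic C h3 e)"

definition middle_iso where
  "middle_iso C g1 d h x g y h3 g1' d' h' x' g' y' h3' \<longleftrightarrow>
    (\<exists>\<alpha> \<delta> \<beta>. is_iso C \<alpha> \<and> is_iso C \<delta> \<and> is_iso C \<beta> \<and>
      Dom C \<alpha> = Cod C h \<and> Cod C \<alpha> = Cod C h' \<and> Dom C \<delta> = Cod C d \<and> Cod C \<delta> = Cod C d' \<and>
      Dom C \<beta> = Cod C g \<and> Cod C \<beta> = Cod C g' \<and>
      \<alpha> \<odot>\<^bsub>C\<^esub> h = h' \<and> \<alpha> \<odot>\<^bsub>C\<^esub> g1 = g1' \<and> \<delta> \<odot>\<^bsub>C\<^esub> d = d' \<and> \<beta> \<odot>\<^bsub>C\<^esub> g = g' \<and> \<beta> \<odot>\<^bsub>C\<^esub> h3 = h3' \<and>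
      \<alpha> \<odot>\<^bsub>C\<^esub> x = x' \<odot>\<^bsub>C\<^esub> \<delta> \<and> \<beta> \<odot>\<^bsub>C\<^esub> y = y' \<odot>\<^bsub>C\<^esub> \<delta>)"

lemma middle_iso_reverse:
  "middle_iso C g1 d h x g y h3 g1' d' h' x' g' y' h3' \<Longrightarrow> middle_iso C h3 d g y h x g1 h3' d' g' y' h' x' g1'"
  unfolding middle_iso_def by blast

context rewriting_category
begin

lemma middle_diagram_reverse:
  assumes "linear_rule C M r" "middle_diagram C M r g1 d h x g y h3"
  shows "middle_diagram C M (prod.swap r) h3 d g y h x g1"
proof -
  have p: "is_pushout C (snd r) d h x" "is_pushout C (fst r) d g y" "h \<in> M" using assms by (auto simp: middle_diagram_def)
  have "g \<in> M" using M_pushout_stable'[OF p(2) M_pushout_complement_stable[OF p(1) _ p(3)]] linear_ruleD[OF assms(1)] by blast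
  then show ?thesis using assms by (auto simp: middle_diagram_def)
qed

lemma middle_diagram_typing:
  assumes l: "linear_rule C M r" and m: "middle_diagram C M r g1 d h x g y h3"
  shows "g1 \<in> M" "h \<in> M" "h3 \<in> M" "d \<in> M" "g \<in> M" "x \<in> M" "y \<in> M"
    "g1 \<in> Arr C" "h \<in> Arr C" "h3 \<in> Arr C" "d \<in> Arr C" "g \<in> Arr C" "x \<in> Arr C" "y \<in> Arr C"
    "Cod C g1 = Cod C h" "Cod C h3 = Cod C g" "Dom C d = Dom C (snd r)" "Dom C h = Cod C (snd r)" "Dom C g = Cod C (fst r)"
    "Dom C x = Cod C d" "Dom C y = Cod C d" "Cod C x = Cod C h" "Cod C y = Cod C g"
proof -
  have p: "is_pushout C (snd r) d h x" "is_pushout C (fst r) d g y" using m by (auto simp: middle_diagram_def)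
  note l = linear_ruleD[OF l]
  show g: "g1 \<in> M" "h \<in> M" "h3 \<in> M" "Cod C g1 = Cod C h" "Cod C h3 = Cod C g" using m by (auto simp: middle_diagram_def)
  show d: "d \<in> M" using M_pushout_complement_stable[OF p(1) l(2) g(2)] .
  show "g \<in> M" "x \<in> M" "y \<in> M" using M_pushout_stable'[OF p(2) d] M_pushout_stable[OF p(1) l(2)] M_pushout_stable[OF p(2) l(1)] by auto
  then show "g1 \<in> Arr C" "h \<in> Arr C" "h3 \<in> Arr C" "d \<in> Arr C" "g \<in> Arr C" "x \<in> Arr C" "y \<in> Arr C"
    using g d by (auto intro: M_arr)
  show "Dom C d = Dom C (snd r)" "Dom C h = Cod C (snd r)" "Dom C x = Cod C d" "Cod C x = Cod C h"
    using pushout_comm[OF p(1)] by (auto simp: comm_square_def)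
  show "Dom C g = Cod C (fst r)" "Dom C y = Cod C d" "Cod C y = Cod C g"
    using pushout_comm[OF p(2)] by (auto simp: comm_square_def)
qed

lemma embedding_typing:
  assumes l: "linear_rule C M r" and m: "middle_diagram C M r g1 d h x g y h3"
    and i: "is_pushout C (snd r) k m2 n" "is_pushout C (fst r) k p q"
    and e: "embedding C M m2 m1 k n p q g1 d h x g y u f e"
  shows "u \<in> M" "f \<in> M" "e \<in> M" "u \<in> Arr C" "f \<in> Arr C" "e \<in> Arr C" "n \<in> M" "q \<in> M" "n \<in> Arr C" "q \<in> Arr C"
    "m2 \<in> Arr C" "k \<in> Arr C" "p \<in> Arr C" "Cod C n = Cod C m2" "Dom C n = Cod C k" "Cod C q = Cod C p" "Dom C q = Cod C k"
    "Dom C u = Cod C m2" "Cod C u = Cod C h" "Dom C f = Cod C k" "Cod C f = Cod C d" "Dom C e = Cod C p" "Cod C e = Cod C g"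
    "u \<odot> n = x \<odot> f" "e \<odot> q = y \<odot> f"
proof -
  note t = middle_diagram_typing[OF l m] and l = linear_ruleD[OF l]
  have p: "is_pushout C n f u x" "is_pushout C q f e y" "u \<in> M" using e by (auto simp: embedding_def)
  show n: "n \<in> M" "q \<in> M" "u \<in> M" using M_pushout_stable[OF i(1) l(2)] M_pushout_stable[OF i(2) l(1)] p by auto
  show f: "f \<in> M" using M_pushout_complement_stable[OF p(1) n(1,3)] .
  show "e \<in> M" using M_pushout_stable'[OF p(2) f] .
  then show "u \<in> Arr C" "f \<in> Arr C" "e \<in> Arr C" "n \<in> Arr C" "q \<in> Arr C" using n f by (auto intro: M_arr)
  show 1: "m2 \<in> Arr C" "k \<in> Arr C" "Cod C n = Cod C m2" "Dom C n = Cod C k" using pushout_comm[OF i(1)] by (auto simp: comm_square_def)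
  show 2: "p \<in> Arr C" "Cod C q = Cod C p" "Dom C q = Cod C k" using pushout_comm[OF i(2)] by (auto simp: comm_square_def)
  have c: "comm_square C n f u x" "comm_square C q f e y" using p by (auto intro: pushout_comm)
  have "Dom C u = Cod C n" "Cod C u = Cod C x" "Dom C f = Dom C n" "Cod C f = Dom C x" "u \<odot> n = x \<odot> f"
    using c(1) by (auto simp: comm_square_def)
  then show "Dom C u = Cod C m2" "Cod C u = Cod C h" "Dom C f = Cod C k" "Cod C f = Cod C d" "u \<odot> n = x \<odot> f"
    using 1 t by auto
  have "Dom C e = Cod C q" "Cod C e = Cod C y" "e \<odot> q = y \<odot> f"
    using c(2) by (auto simp: comm_square_def)
  then show "Dom C e = Cod C p" "Cod C e = Cod C g" "e \<odot> q = y \<odot> f" using 2 t by auto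
qed

text \<open>A pushout along an \<open>M\<close>-morphism is a pullback, and it remains one after
  embedding its codomain by the monomorphism \<open>u\<close>. So the first match can be read off
  from \<open>A\<close> as the intersection of \<open>h\<close> and \<open>g1\<close>.\<close>

lemma induces_span_pullback:
  assumes l: "linear_rule C M r" and i: "induces C M r \<mu> m2 m1 k n p q \<nu> g1 d h x g y h3"
  shows "is_pullback C (fst \<mu>) (snd \<mu>) h g1"
proof -
  obtain u f e where u: "embedding C M m2 m1 k n p q g1 d h x g y u f e"
    and m: "middle_diagram C M r g1 d h x g y h3" "fst \<mu> \<in> M" "is_pushout C (fst \<mu>) (snd \<mu>) m2 m1"
    "is_pushout C (snd r) k m2 n" "is_pushout C (fst r) k p q"
    using i unfolding induces_def by blast
  note t = embedding_typing[OF l m(1,4,5) u]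
  have "is_pullback C (fst \<mu>) (snd \<mu>) (u \<odot> m2) (u \<odot> m1)"
    using pullback_post_mono[OF pushout_along_M_is_pullback[OF m(3,2)] M_mono[OF t(1)]] t by simp
  then show ?thesis using u by (simp add: embedding_def)
qed

text \<open>The reconstruction runs backwards: \<open>B\<close> is the pushout of
  \<open>\<nu>\<close>, the context is the unique pushout complement inside it, and \<open>A\<close>
  is the pushout of that context along the input leg. The leg from \<open>O1\<close> is recovered
  through \<open>u\<close>.\<close>

lemma induces_middle_iso:
  assumes l: "linear_rule C M r" and i: "induces C M r \<mu> m2 m1 k n p q \<nu> g1 d h x g y h3"
    and i': "induces C M r \<mu> m2 m1 k n p q \<nu> g1' d' h' x' g' y' h3'"
  shows "middle_iso C g1 d h x g y h3 g1' d' h' x' g' y' h3'"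
proof -
  obtain u f e where u: "embedding C M m2 m1 k n p q g1 d h x g y u f e"
    and m: "middle_diagram C M r g1 d h x g y h3" "fst \<mu> \<in> M" "is_pushout C (fst \<mu>) (snd \<mu>) m2 m1"
    "is_pushout C (snd r) k m2 n" "is_pushout C (fst r) k p q"
    and n: "is_pullback C (fst \<nu>) (snd \<nu>) h3 e" "jointly_epic C h3 e"
    using i unfolding induces_def by blast
  obtain u' f' e' where u': "embedding C M m2 m1 k n p q g1' d' h' x' g' y' u' f' e'"
    and m': "middle_diagram C M r g1' d' h' x' g' y' h3'"
    and n': "is_pullback C (fst \<nu>) (snd \<nu>) h3' e'" "jointly_epic C h3' e'"
    using i' unfolding induces_def by blast
  note t = middle_diagram_typing[OF l m(1)] embedding_typing[OF l m(1,4,5) u]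
  note t' = middle_diagram_typing[OF l m'] embedding_typing[OF l m' m(4,5) u']
  have E: "u \<odot> m2 = h" "u \<odot> m1 = g1" "f \<odot> k = d" "e \<odot> p = g" using u by (auto simp: embedding_def)
  have E': "u' \<odot> m2 = h'" "u' \<odot> m1 = g1'" "f' \<odot> k = d'" "e' \<odot> p = g'" using u' by (auto simp: embedding_def)
  have po: "is_pushout C (snd r) d h x" "is_pushout C (fst r) d g y" "is_pushout C (snd r) d' h' x'" "is_pushout C (fst r) d' g' y'"
    using m(1) m' by (auto simp: middle_diagram_def)
  have pn: "is_pushout C (fst \<nu>) (snd \<nu>) h3 e" "is_pushout C (fst \<nu>) (snd \<nu>) h3' e'"
    using jointly_epic_pushout[OF _ _ n] jointly_epic_pushout[OF _ _ n'] t t' by auto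
  obtain \<beta> where \<beta>: "is_iso C \<beta>" "\<beta> \<in> Arr C" "Dom C \<beta> = Cod C h3" "Cod C \<beta> = Cod C h3'" "\<beta> \<odot> h3 = h3'" "\<beta> \<odot> e = e'"
    using pushout_iso_unique[OF pn] .
  have bg: "\<beta> \<odot> g = g'" using comp_assoc_eq[OF \<beta>(6), of p] \<beta> E E' t by simp
  have "is_pushout C (fst r) d g' (\<beta> \<odot> y)" using pushout_post_iso[OF po(2) \<beta>(1)] \<beta> t bg by simp
  from pushout_complement_unique[OF this po(4) linear_ruleD(1)[OF l]]
  obtain \<delta> where \<delta>: "is_iso C \<delta>" "\<delta> \<in> Arr C" "Dom C \<delta> = Cod C d" "Cod C \<delta> = Cod C d'" "\<delta> \<odot> d = d'" "y' \<odot> \<delta> = \<beta> \<odot> y" .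
  have "is_pushout C (snd r) (\<delta> \<odot> d) h' x'" using po(3) \<delta> by simp
  from pushout_iso_along[OF po(1) this \<delta>(1,3)]
  obtain \<alpha> where \<alpha>: "is_iso C \<alpha>" "\<alpha> \<in> Arr C" "Dom C \<alpha> = Cod C h" "Cod C \<alpha> = Cod C h'" "\<alpha> \<odot> h = h'" "\<alpha> \<odot> x = x' \<odot> \<delta>" .
  have df: "\<delta> \<odot> f = f'"
  proof (rule M_cancel[OF t'(7)])
    have "y' \<odot> (\<delta> \<odot> f) = \<beta> \<odot> (y \<odot> f)" using comp_assoc_eq[OF \<delta>(6), of f] comp_assoc[of f y \<beta>] \<beta> \<delta> t t' by simp
    also have "\<dots> = e' \<odot> q" using comp_assoc_eq[OF \<beta>(6), of q] \<beta> t by simp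
    finally show "y' \<odot> (\<delta> \<odot> f) = y' \<odot> f'" using t' by simp
  qed (use \<delta> t t' in simp_all)
  have "\<alpha> \<odot> u = u'"
  proof (rule pushout_unique[OF m(4)])
    show "(\<alpha> \<odot> u) \<odot> m2 = u' \<odot> m2" using comp_assoc[of m2 u \<alpha>] E E' \<alpha> t by simp
    have "(\<alpha> \<odot> u) \<odot> n = (\<alpha> \<odot> x) \<odot> f" using comp_assoc[of n u \<alpha>] comp_assoc[of f x \<alpha>] \<alpha> t by simp
    also have "\<dots> = x' \<odot> f'" using comp_assoc[of f \<delta> x'] \<alpha>(6) \<delta> t t' df by simp
    finally show "(\<alpha> \<odot> u) \<odot> n = u' \<odot> n" using t' by simp
  qed (use \<alpha> t t' in simp_all)
  moreover have "m1 \<in> Arr C" "Cod C m1 = Cod C m2" using pushout_comm[OF m(3)] by (auto simp: comm_square_def)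
  ultimately have "\<alpha> \<odot> g1 = g1'" using comp_assoc[of m1 u \<alpha>] E E' \<alpha> t by simp
  with \<alpha> \<beta> \<delta> bg show ?thesis unfolding middle_iso_def
    by - (rule exI[of _ \<alpha>], rule exI[of _ \<delta>], rule exI[of _ \<beta>], use t t' in simp)
qed

lemma induces_first_unique:
  assumes l: "linear_rule C M r" and i: "induces C M r \<mu> m2 m1 k n p q \<nu> g1 d h x g y h3"
    and i': "induces C M r \<mu>' m2' m1' k' n' p' q' \<nu>' g1' d' h' x' g' y' h3'"
    and iso: "middle_iso C g1 d h x g y h3 g1' d' h' x' g' y' h3'"
  shows "(\<mu>, \<mu>') \<in> span_iso C"
proof -
  obtain \<alpha> where \<alpha>: "is_iso C \<alpha>" "Dom C \<alpha> = Cod C h" "\<alpha> \<odot> h = h'" "\<alpha> \<odot> g1 = g1'"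
    using iso unfolding middle_iso_def by blast
  have "is_pullback C (fst \<mu>) (snd \<mu>) h' g1'"
    using pullback_post_mono[OF induces_span_pullback[OF l i] iso_mono[OF \<alpha>(1)] \<alpha>(2)] \<alpha> by simp
  from pullback_spans_iso[OF this induces_span_pullback[OF l i']] show ?thesis .
qed

text \<open>Over the same first-step data the isomorphisms \<open>\<alpha>\<close>,
  \<open>\<delta>\<close>, \<open>\<beta>\<close> must carry \<open>u\<close>, \<open>f\<close>,
  \<open>e\<close> to their counterparts; then \<open>\<nu>\<close> and \<open>\<nu>'\<close> are
  pullbacks of one cospan.\<close>

lemma induces_second_unique:
  assumes l: "linear_rule C M r" and i: "induces C M r \<mu> m2 m1 k n p q \<nu> g1 d h x g y h3"
    and i': "induces C M r \<mu> m2 m1 k n p q \<nu>' g1' d' h' x' g' y' h3'"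
    and iso: "middle_iso C g1 d h x g y h3 g1' d' h' x' g' y' h3'"
  shows "(\<nu>, \<nu>') \<in> span_iso C"
proof -
  obtain u f e where u: "embedding C M m2 m1 k n p q g1 d h x g y u f e"
    and m: "middle_diagram C M r g1 d h x g y h3" "fst \<mu> \<in> M" "is_pushout C (fst \<mu>) (snd \<mu>) m2 m1"
    "is_pushout C (snd r) k m2 n" "is_pushout C (fst r) k p q"
    and n: "is_pullback C (fst \<nu>) (snd \<nu>) h3 e"
    using i unfolding induces_def by blast
  obtain u' f' e' where u': "embedding C M m2 m1 k n p q g1' d' h' x' g' y' u' f' e'"
    and m': "middle_diagram C M r g1' d' h' x' g' y' h3'"
    and n': "is_pullback C (fst \<nu>') (snd \<nu>') h3' e'"
    using i' unfolding induces_def by blast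
  note t = middle_diagram_typing[OF l m(1)] embedding_typing[OF l m(1,4,5) u]
  note t' = middle_diagram_typing[OF l m'] embedding_typing[OF l m' m(4,5) u']
  have E: "u \<odot> m2 = h" "u \<odot> m1 = g1" "f \<odot> k = d" "e \<odot> p = g" using u by (auto simp: embedding_def)
  have E': "u' \<odot> m2 = h'" "u' \<odot> m1 = g1'" "f' \<odot> k = d'" "e' \<odot> p = g'" using u' by (auto simp: embedding_def)
  obtain \<alpha> \<delta> \<beta> where i: "is_iso C \<alpha>" "is_iso C \<delta>" "is_iso C \<beta>"
      "Dom C \<alpha> = Cod C h" "Cod C \<alpha> = Cod C h'" "Dom C \<delta> = Cod C d" "Cod C \<delta> = Cod C d'"
      "Dom C \<beta> = Cod C g" "Cod C \<beta> = Cod C g'"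
      "\<alpha> \<odot> h = h'" "\<alpha> \<odot> g1 = g1'" "\<delta> \<odot> d = d'" "\<beta> \<odot> g = g'" "\<beta> \<odot> h3 = h3'"
      "\<alpha> \<odot> x = x' \<odot> \<delta>" "\<beta> \<odot> y = y' \<odot> \<delta>"
    using iso unfolding middle_iso_def by blast
  have iA: "\<alpha> \<in> Arr C" "\<delta> \<in> Arr C" "\<beta> \<in> Arr C" using i by (auto intro: iso_arr)
  have m1: "m1 \<in> Arr C" "Cod C m1 = Cod C m2" using pushout_comm[OF m(3)] by (auto simp: comm_square_def)
  have au: "\<alpha> \<odot> u = u'"
  proof (rule pushout_unique[OF m(3)])
    show "(\<alpha> \<odot> u) \<odot> m2 = u' \<odot> m2" using comp_assoc[of m2 u \<alpha>] E E' i iA t by simp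
    show "(\<alpha> \<odot> u) \<odot> m1 = u' \<odot> m1" using comp_assoc[of m1 u \<alpha>] E E' i iA t m1 by simp
  qed (use i iA t t' in simp_all)
  have df: "\<delta> \<odot> f = f'"
  proof (rule M_cancel[OF t'(6)])
    have "x' \<odot> (\<delta> \<odot> f) = (\<alpha> \<odot> x) \<odot> f" using comp_assoc[of f \<delta> x'] i iA t t' by simp
    also have "\<dots> = u' \<odot> n" using comp_assoc[of f x \<alpha>] comp_assoc[of n u \<alpha>] au i iA t by simp
    finally show "x' \<odot> (\<delta> \<odot> f) = x' \<odot> f'" using t' by simp
  qed (use i iA t t' in simp_all)
  have "\<beta> \<odot> e = e'"
  proof (rule pushout_unique[OF m(5)])
    show "(\<beta> \<odot> e) \<odot> p = e' \<odot> p" using comp_assoc[of p e \<beta>] E E' i iA t by simp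
    have "(\<beta> \<odot> e) \<odot> q = (\<beta> \<odot> y) \<odot> f" using comp_assoc[of q e \<beta>] comp_assoc[of f y \<beta>] i(8) iA t by simp
    also have "\<dots> = y' \<odot> f'" using comp_assoc[of f \<delta> y'] i iA t t' df by simp
    finally show "(\<beta> \<odot> e) \<odot> q = e' \<odot> q" using t' by simp
  qed (use i iA t t' in simp_all)
  moreover have "is_pullback C (fst \<nu>) (snd \<nu>) (\<beta> \<odot> h3) (\<beta> \<odot> e)"
    using pullback_post_mono[OF n iso_mono[OF i(3)]] i t by simp
  ultimately show ?thesis using pullback_spans_iso[OF _ n'] i by simp
qed

text \<open>\<open>u\<close> is the effective union of \<open>h\<close> and \<open>g1\<close>. The
  derivation on \<open>A\<close> restricts to this union because its match factors through it:
  \<open>f\<close> embeds the restricted context and \<open>e\<close> is induced on the output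
  side.\<close>

lemma embedding_ex:
  assumes l: "linear_rule C M r" and m: "middle_diagram C M r g1 d h x g y h3"
    and i: "is_pushout C (fst \<mu>) (snd \<mu>) m2 m1" "is_pushout C (snd r) k m2 n" "is_pushout C (fst r) k p q"
    and pb: "is_pullback C (fst \<mu>) (snd \<mu>) h g1"
  obtains u f e where "embedding C M m2 m1 k n p q g1 d h x g y u f e"
proof -
  note t = middle_diagram_typing[OF l m] and l = linear_ruleD[OF l]
  obtain u where u: "u \<in> M" "Dom C u = Cod C m2" "u \<odot> m2 = h" "u \<odot> m1 = g1"
    using effective_union[OF t(2,1) pb i(1)] by metis
  have po: "is_pushout C (snd r) d (u \<odot> m2) x" "is_pushout C (fst r) d g y" using m u by (auto simp: middle_diagram_def)
  have m2: "m2 \<in> Arr C" "Dom C m2 = Cod C (snd r)" "Dom C n = Cod C k" using pushout_comm[OF i(2)] by (auto simp: comm_square_def)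
  obtain f where f: "f \<in> Arr C" "Dom C f = Dom C n" "f \<odot> k = d" "is_pushout C n f u x"
    using pushout_complement_decompose(2)[OF po(1) l(2) u(1) m2(1) u(2)[symmetric] m2(2) i(2)] by blast
  obtain e where "is_pushout C q f e y" "e \<odot> p = g"
    using pushout_factor[OF po(2) l(1) i(3) f(1) _ f(3)] f m2 by auto
  then show thesis using that u f by (auto simp: embedding_def)
qed

text \<open>
  Both conditions say that \<open>A \<Rightarrow> B\<close> is generated by \<open>O1\<close>, \<open>I2\<close>, \<open>O2\<close> and \<open>I3\<close>: subobjects of \<open>A\<close>
  containing \<open>I2\<close> correspond via the common context to subobjects of \<open>B\<close> containing \<open>O2\<close>.
\<close>

lemma jointly_epic_transfer:
  assumes l: "linear_rule C M r" and m: "middle_diagram C M r g1 d h x g y h3"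
    and i: "is_pushout C (snd r) k m2 n" "is_pushout C (fst r) k p q" "jointly_epic C m2 m1"
    and e: "embedding C M m2 m1 k n p q g1 d h x g y u f e"
    and i': "is_pushout C (fst r) k' m2' n'" "is_pushout C (snd r) k' p' q'" "m1' \<in> Arr C" "Cod C m1' = Cod C m2'"
    and e': "embedding C M m2' m1' k' n' p' q' h3 d g y h x v f' e'"
    and je: "jointly_epic C h3 e"
  shows "jointly_epic C g1 e'"
proof -
  have l': "linear_rule C M (prod.swap r)" using l by (simp add: linear_rule_swap)
  note m' = middle_diagram_reverse[OF l m]
  note t = middle_diagram_typing[OF l m] embedding_typing[OF l m i(1,2) e]
  have t': "v \<in> M" "f' \<in> M" "e' \<in> M" "v \<in> Arr C" "f' \<in> Arr C" "e' \<in> Arr C" "n' \<in> M" "q' \<in> M" "n' \<in> Arr C" "q' \<in> Arr C"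
    "m2' \<in> Arr C" "k' \<in> Arr C" "p' \<in> Arr C" "Cod C n' = Cod C m2'" "Dom C n' = Cod C k'" "Cod C q' = Cod C p'" "Dom C q' = Cod C k'"
    "Dom C v = Cod C m2'" "Cod C v = Cod C g" "Dom C f' = Cod C k'" "Cod C f' = Cod C d" "Dom C e' = Cod C p'" "Cod C e' = Cod C h"
    "v \<odot> n' = y \<odot> f'" "e' \<odot> q' = x \<odot> f'"
    using embedding_typing[OF l' m' _ _ e'] i' by simp_all
  have E: "u \<odot> m2 = h" "u \<odot> m1 = g1" "f \<odot> k = d" "e \<odot> p = g" "is_pushout C q f e y" using e by (auto simp: embedding_def)
  have E': "v \<odot> m2' = g" "v \<odot> m1' = h3" "f' \<odot> k' = d" "e' \<odot> p' = h" "is_pushout C n' f' v y" using e' by (auto simp: embedding_def)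
  have M1: "m1 \<in> Arr C" "Cod C m1 = Cod C m2" using i(3) by (auto simp: jointly_epic_def)
  \<comment> \<open>\<open>h3\<close> factors through \<open>v\<close>, so replacing it by
    \<open>v\<close> keeps joint epicness; both members of the pair now lie above
    \<open>O2\<close>.\<close>
  have jv: "jointly_epic C v e"
    unfolding jointly_epic_def
  proof (intro conjI ballI impI)
    fix a b assume ab: "a \<in> Arr C" "b \<in> Arr C"
      "Cod C a = Cod C b \<and> Dom C a = Cod C v \<and> Dom C b = Cod C v \<and> a \<odot> v = b \<odot> v \<and> a \<odot> e = b \<odot> e"
    then have "(a \<odot> v) \<odot> m1' = (b \<odot> v) \<odot> m1'" by simp
    then have eq: "a \<odot> h3 = b \<odot> h3" using comp_assoc[of m1' v a] comp_assoc[of m1' v b] ab t' i' E' by simp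
    show "a = b" by (rule jointly_epicD[OF je eq]) (use ab t t' in simp_all)
  qed (use t t' in simp_all)
  obtain a1 a2 where pb: "is_pullback C a1 a2 v e" using M_pullback_ex[OF t'(1) t(29)] t t' by auto
  have po: "is_pushout C a1 a2 v e" using jointly_epic_pushout[OF t'(1) t(26) pb jv] .
  have aM: "a1 \<in> M" using M_pullback_stable'[OF pb t(26)] .
  have at: "a1 \<in> Arr C" "a2 \<in> Arr C" "Cod C a1 = Dom C v" "Cod C a2 = Dom C e" "Dom C a2 = Dom C a1" "v \<odot> a1 = e \<odot> a2"
    using pullback_comm[OF pb] by (auto simp: comm_square_def)
  have face1: "is_pullback C f' n' y v"
    using pushout_along_M_is_pullback[OF pushout_sym[OF E'(5)] t'(2)] .
  have face2: "is_pullback C f q y e"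
    using pushout_along_M_is_pullback[OF pushout_sym[OF E(5)] t(25)] .
  \<comment> \<open>The pushout of \<open>v\<close> and \<open>e\<close> over their intersection is
    pulled back along the context inclusion \<open>y\<close>; the van Kampen cube turns it into a
    pushout of \<open>f'\<close> and \<open>f\<close>.\<close>
  obtain b c where pbb: "is_pullback C b c a1 n'" using M_pullback_ex[OF aM t'(9)] at t' by auto
  have bt: "b \<in> Arr C" "c \<in> Arr C" "Cod C b = Dom C a1" "Cod C c = Dom C n'" "Dom C c = Dom C b" "a1 \<odot> b = n' \<odot> c"
    using pullback_comm[OF pbb] by (auto simp: comm_square_def)
  have bM: "b \<in> M" using M_pullback_stable'[OF pbb t'(7)] .
  have "y \<odot> (f' \<odot> c) = v \<odot> (n' \<odot> c)" using comp_assoc[of c n' v] comp_assoc[of c f' y] bt t t' by simp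
  also have "\<dots> = e \<odot> (a2 \<odot> b)" using comp_assoc[of b a1 v] comp_assoc[of b a2 e] bt at t t' by simp
  finally have "comm_square C (f' \<odot> c) (a2 \<odot> b) y e" using bt at t t' by (simp add: comm_square_def)
  from pullback_obtain[OF face2 this]
  obtain s where s: "s \<in> Arr C" "Dom C s = Dom C (f' \<odot> c)" "Cod C s = Dom C f" "f \<odot> s = f' \<odot> c" "q \<odot> s = a2 \<odot> b" .
  have outer: "is_pullback C b (f' \<odot> c) (v \<odot> a1) y"
    using pullback_compose[OF pbb pullback_sym[OF face1]] .
  have "is_pullback C b s a2 q"
    by (rule pullback_decompose[OF pullback_sym[OF face2], of b s a2])
      (use outer s bt at t t' in \<open>simp_all add: comm_square_def\<close>)
  then have "is_pushout C c s f' f"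
    using M_VK[OF po aM, unfolded M_van_Kampen_def, rule_format, OF bM t'(7) t(31) t(7), of c s f' f]
      pullback_sym[OF pbb] pullback_sym[OF \<open>is_pullback C b s a2 q\<close>] face1 face2 s bt t t'
    by (auto simp: comm_square_def)
  then have jf: "jointly_epic C f' f" by (rule pushout_jointly_epic)
  show ?thesis unfolding jointly_epic_def
  proof (intro conjI ballI impI)
    fix a b assume ab0: "a \<in> Arr C" "b \<in> Arr C"
      "Cod C a = Cod C b \<and> Dom C a = Cod C g1 \<and> Dom C b = Cod C g1 \<and> a \<odot> g1 = b \<odot> g1 \<and> a \<odot> e' = b \<odot> e'"
    then have ab: "a \<in> Arr C" "b \<in> Arr C" "Cod C a = Cod C b" "Dom C a = Cod C h" "Dom C b = Cod C h"
      "a \<odot> g1 = b \<odot> g1" "a \<odot> e' = b \<odot> e'" using t by auto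
    have ah: "a \<odot> h = b \<odot> h" using comp_assoc[of p' e' a] comp_assoc[of p' e' b] ab t' E' by simp
    have au: "a \<odot> u = b \<odot> u"
    proof (rule jointly_epicD[OF i(3)])
      show "(a \<odot> u) \<odot> m2 = (b \<odot> u) \<odot> m2" using comp_assoc[of m2 u a] comp_assoc[of m2 u b] ab ah E t by simp
      show "(a \<odot> u) \<odot> m1 = (b \<odot> u) \<odot> m1" using comp_assoc[of m1 u a] comp_assoc[of m1 u b] ab E t M1 by simp
    qed (use ab t in simp_all)
    \<comment> \<open>Agreement on the context is checked on its two generating parts:
      \<open>x \<odot> f'\<close> factors through \<open>e'\<close> and \<open>x \<odot> f\<close>
      through \<open>u\<close>. With agreement on \<open>h\<close> this settles \<open>A\<close>,
      the pushout with legs \<open>h\<close> and \<open>x\<close>.\<close>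
    have "a \<odot> x = b \<odot> x"
    proof (rule jointly_epicD[OF jf])
      have "(a \<odot> x) \<odot> f' = (b \<odot> x) \<odot> f'" if "a \<odot> (x \<odot> f') = b \<odot> (x \<odot> f')"
        using that comp_assoc[of f' x a] comp_assoc[of f' x b] ab t t' by simp
      moreover have "a \<odot> (e' \<odot> q') = b \<odot> (e' \<odot> q')" using comp_assoc[of q' e' a] comp_assoc[of q' e' b] ab t' by simp
      ultimately show "(a \<odot> x) \<odot> f' = (b \<odot> x) \<odot> f'" using t' by simp
      have "(a \<odot> x) \<odot> f = (b \<odot> x) \<odot> f" if "a \<odot> (x \<odot> f) = b \<odot> (x \<odot> f)"
        using that comp_assoc[of f x a] comp_assoc[of f x b] ab t by simp
      moreover have "a \<odot> (u \<odot> n) = b \<odot> (u \<odot> n)" using comp_assoc[of n u a] comp_assoc[of n u b] ab au t by simp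
      ultimately show "(a \<odot> x) \<odot> f = (b \<odot> x) \<odot> f" using t by simp
    qed (use ab t t' in simp_all)
    moreover have "is_pushout C (snd r) d h x" using m by (simp add: middle_diagram_def)
    ultimately show "a = b" using pushout_unique[OF _ ab(1-3)] ab ah by blast
  qed (use t t' in simp_all)
qed

text \<open>The complement for the composite output leg gives an arrow \<open>c\<close> into a
  context shared by both rules. Pushing out along \<open>u2\<close> yields the context of the middle
  step, from which \<open>A\<close> is rebuilt; pushing out along \<open>u1\<close> shows by
  \<open>pushout_analysis\<close> that the first rule's output has a complement in
  \<open>A\<close>.\<close>

lemma embedding_of_pushout:
  assumes l: "linear_rule C M r" "linear_rule C M r1" and o: "overlap_span C M r r1 \<mu>"
    and cd: "composite_diagram C r r1 \<mu> m2 m1 k1 n1 k n p q p1 q1 u2 u1"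
    and e: "e \<in> M" "h3 \<in> M" "Cod C h3 = Cod C e" "has_pushout_complement C (q \<odot> u2) e"
  obtains g1 d h x g y u f where "middle_diagram C M r g1 d h x g y h3" "has_pushout_complement C (fst r1) g1"
    "embedding C M m2 m1 k n p q g1 d h x g y u f e"
proof -
  note t = composite_diagram_typing[OF l o cd]
  have p: "is_pushout C (fst \<mu>) (snd \<mu>) m2 m1" "is_pushout C (fst r1) k1 m1 n1" "is_pushout C (snd r) k m2 n"
    "is_pushout C (fst r) k p q" "is_pullback C u2 u1 n n1"
    using cd by (auto simp: composite_diagram_def)
  obtain c w where po: "is_pushout C (q \<odot> u2) c e w" using e(4) unfolding has_pushout_complement_def by blast
  have ct: "c \<in> Arr C" "Dom C c = Dom C u2" "Dom C e = Cod C q" using pushout_comm[OF po] t by (auto simp: comm_square_def)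
  obtain f z2 where pf: "is_pushout C u2 c f z2" using M_pushout_ex[OF t(11) ct(1)] ct by auto
  obtain f1 z1 where pf1: "is_pushout C u1 c f1 z1" using M_pushout_ex[OF t(12) ct(1)] ct t by auto
  obtain y where y: "is_pushout C q f e y" using pushout_split[OF po pf t(20)] t by metis
  have "q \<odot> u2 \<in> M" using M_comp t by auto
  then have cM: "c \<in> M" using M_pushout_complement_stable[OF po] e by blast
  have fM: "f \<in> M" using M_pushout_stable'[OF pf cM] .
  have ft: "f \<in> Arr C" "Dom C f = Cod C k" using pushout_comm[OF pf] t by (auto simp: comm_square_def)
  obtain u x where u: "is_pushout C n f u x" using M_pushout_ex[OF t(6) ft(1)] ft t by auto
  have uM: "u \<in> M" using M_pushout_stable'[OF u fM] .
  have nu: "n \<odot> u2 = n1 \<odot> u1" using pullback_comm[OF p(5)] by (simp add: comm_square_def)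
  obtain y1 where "is_pushout C n1 f1 u y1" using pushout_analysis[OF pf u pf1 nu] t by auto
  from pushout_compose[OF p(2) this] have pc: "has_pushout_complement C (fst r1) (u \<odot> m1)"
    unfolding has_pushout_complement_def by blast
  have ut: "Dom C u = Cod C m2" "u \<in> Arr C" using pushout_comm[OF u] t by (auto simp: comm_square_def)
  have m: "middle_diagram C M r (u \<odot> m1) (f \<odot> k) (u \<odot> m2) x (e \<odot> p) y h3"
    unfolding middle_diagram_def
    using pushout_compose[OF p(3) u] pushout_compose[OF p(4) y] M_comp uM ut ct t e M_arr by auto
  have "embedding C M m2 m1 k n p q (u \<odot> m1) (f \<odot> k) (u \<odot> m2) x (e \<odot> p) y u f e"
    unfolding embedding_def using uM u y by simp
  with that m pc show thesis by blast
qed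

end

section \<open>Associativity\<close>

context rewriting_category
begin

lemma dpo_squares_typing:
  assumes li: "l \<in> M" "i \<in> M" "Dom C l = Dom C i" and p: "p \<in> M"
    and po: "is_pushout C i f p i'" "is_pushout C l f n l'"
  shows "i' \<in> M" "l' \<in> M" "n \<in> M" "Dom C l' = Dom C i'" "Cod C i' = Cod C p" "Cod C l' = Cod C n" "Dom C n = Cod C l" "Dom C p = Cod C i"
proof -
  have f: "f \<in> M" using M_pushout_complement_stable[OF po(1) li(2) p] .
  show "i' \<in> M" "l' \<in> M" "n \<in> M"
    using M_pushout_stable[OF po(1)] M_pushout_stable[OF po(2)] M_pushout_stable'[OF po(2) f] li by auto
  have c: "comm_square C i f p i'" "comm_square C l f n l'" using po by (auto intro: pushout_comm)
  show "Dom C l' = Dom C i'" "Cod C i' = Cod C p" "Cod C l' = Cod C n" "Dom C n = Cod C l" "Dom C p = Cod C i"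
    using c by (auto simp: comm_square_def)
qed

text \<open>The three conditions are compared separately. For \<open>c1\<close> two shifts compose;
  for \<open>c2\<close> \<open>transport_shift\<close> exchanges shift and transport, using that
  both routes from \<open>I2\<close> to \<open>A\<close> agree; for \<open>c3\<close>
  \<open>transport_comp\<close> splits the transport along the intersection of contexts.\<close>

lemma associative_cond:
  assumes c: "cond_over C M c1 (Dom C p1)" "cond_over C M c2 (Dom C m2)" "cond_over C M c3 (Dom C m2')"
    and M1: "p1 \<in> M" "m2 \<in> M" "q1 \<in> M" "n1 \<in> M" "pp \<in> M" "Cod C p1 = Cod C q1" "Dom C n1 = Dom C q1" "Cod C m2 = Cod C n1"
    and M2: "p1' \<in> M" "m2' \<in> M" "q1' \<in> M" "n1' \<in> M" "e' \<in> M" "Cod C p1' = Cod C q1'" "Dom C n1' = Dom C q1'" "Cod C m2' = Cod C n1'"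
    and po: "is_pushout C q1 f1 pp x1" "is_pushout C n1 f1 u y1" "is_pushout C q1' f' e' x" "is_pushout C n1' f' v y"
    and eq: "e' \<odot> p1' = u \<odot> m2" "Dom C p1' = Dom C m2" and pb: "is_pullback C z2 z1 x y1"
    and h: "h \<in> M" "Dom C h = Cod C x1"
  shows "sat C M (CAnd (shift C M (CAnd (shift C M c1 p1) (transport C (shift C M c2 m2) (n1, q1))) pp)
      (transport C (shift C M c3 (v \<odot> m2')) (y \<odot> z2, x1 \<odot> z1))) h \<longleftrightarrow>
    sat C M (CAnd (shift C M c1 (pp \<odot> p1))
      (transport C (shift C M (CAnd (shift C M c2 p1') (transport C (shift C M c3 m2') (n1', q1'))) e') (y1, x1))) h"
proof -
  note t = dpo_squares_typing[OF M1(4,3,7,5) po(1,2)] and t' = dpo_squares_typing[OF M2(4,3,7,5) po(3,4)]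
  have xy: "Cod C x = Cod C y1" using pullback_comm[OF pb] by (simp add: comm_square_def)
  have A: "p1 \<in> Arr C" "m2 \<in> Arr C" "q1 \<in> Arr C" "n1 \<in> Arr C" "pp \<in> Arr C" "p1' \<in> Arr C" "m2' \<in> Arr C" "q1' \<in> Arr C" "n1' \<in> Arr C" "e' \<in> Arr C"
    "u \<in> Arr C" "v \<in> Arr C" "h \<in> Arr C" "x1 \<in> Arr C" "y1 \<in> Arr C" "x \<in> Arr C" "y \<in> Arr C"
    using M1 M2 t t' h by (auto intro: M_arr)
  have r: "linear_rule C M (y1, x1)" "linear_rule C M (y, x)" "linear_rule C M (n1, q1)" "linear_rule C M (n1', q1')"
    using t t' M1 M2 by (auto simp: linear_rule_def)
  have um: "u \<odot> m2 \<in> M" "v \<odot> m2' \<in> M" "pp \<odot> p1 \<in> M" using M_comp M1 M2 t t' by auto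
  have s: "cond_over C M (shift C M c1 p1) (Cod C q1)" "cond_over C M (shift C M c2 m2) (Cod C n1)" "cond_over C M (shift C M c2 p1') (Cod C q1')"
    "cond_over C M (shift C M c3 m2') (Cod C n1')" "cond_over C M (shift C M c3 (v \<odot> m2')) (Cod C y)"
    using cond_over_shift[of c1 p1] cond_over_shift[of c2 m2] cond_over_shift[of c2 p1'] cond_over_shift[of c3 m2'] cond_over_shift[of c3 "v \<odot> m2'"]
      c M1 M2 um t' A eq by simp_all
  have s2: "cond_over C M (transport C (shift C M c2 m2) (n1, q1)) (Cod C q1)" "cond_over C M (transport C (shift C M c3 m2') (n1', q1')) (Cod C q1')"
    "cond_over C M (transport C (shift C M c3 (v \<odot> m2')) (y, x)) (Cod C x)"
    using cond_over_transport[OF r(3)] cond_over_transport[OF r(4)] cond_over_transport[OF r(2)] s by simp_all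
  have s3: "cond_over C M (shift C M (shift C M c2 m2) u) (Cod C y1)" "cond_over C M (shift C M (shift C M c3 m2') v) (Cod C y)"
    using cond_over_shift[of "shift C M c2 m2" u] cond_over_shift[of "shift C M c3 m2'" v] s t t' by simp_all
  define c32 where "c32 = CAnd (shift C M c2 p1') (transport C (shift C M c3 m2') (n1', q1'))"
  \<comment> \<open>The right-bracketed condition on \<open>A\<close> with its shift along
    \<open>e'\<close> distributed over both conjuncts, and the route from \<open>I2\<close>
    rewritten to pass through \<open>u\<close>.\<close>
  define cA where "cA = CAnd (shift C M (shift C M c2 m2) u) (transport C (shift C M c3 (v \<odot> m2')) (y, x))"
  have s4: "cond_over C M (shift C M c32 e') (Cod C y1)" "cond_over C M cA (Cod C y1)"
    using cond_over_shift[of c32 e'] s s2 s3 M2 t' xy unfolding c32_def cA_def by simp_all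
  have "cond_equiv C M (Cod C y) (shift C M (shift C M c3 m2') v) (shift C M c3 (v \<odot> m2'))"
    unfolding cond_equiv_def
  proof (intro ballI impI)
    fix b assume b: "b \<in> M" "Dom C b = Cod C y"
    then have "b \<odot> v \<in> M" "b \<in> Arr C" using M_comp t' by (auto intro: M_arr)
    then show "sat C M (shift C M (shift C M c3 m2') v) b \<longleftrightarrow> sat C M (shift C M c3 (v \<odot> m2')) b"
      using sat_shift[of "shift C M c3 m2'" v b] sat_shift[of c3 m2' "b \<odot> v"] sat_shift[of c3 "v \<odot> m2'" b]
        comp_assoc[of m2' v b] b c s um M2 t' A by simp
  qed
  then have tv: "cond_equiv C M (Cod C x) (transport C (shift C M (shift C M c3 m2') v) (y, x)) (transport C (shift C M c3 (v \<odot> m2')) (y, x))"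
    using transport_cong[OF r(2), of "shift C M (shift C M c3 m2') v" "shift C M c3 (v \<odot> m2')"] s3 s by simp
  have eqA: "cond_equiv C M (Cod C y1) (shift C M c32 e') cA"
    unfolding cond_equiv_def
  proof (intro ballI impI)
    fix a assume a: "a \<in> M" "Dom C a = Cod C y1"
    have aA: "a \<in> Arr C" "a \<odot> e' \<in> M" "a \<odot> u \<in> M" using M_comp[of e' a] M_comp[of u a] a M2 t t' xy by (auto intro: M_arr)
    have 1: "sat C M (shift C M c32 e') a \<longleftrightarrow> sat C M c32 (a \<odot> e')"
      using sat_shift[of c32 e' a] s s2 M2 t' a xy unfolding c32_def by simp
    have 2: "sat C M (shift C M c2 p1') (a \<odot> e') \<longleftrightarrow> sat C M (shift C M (shift C M c2 m2) u) a"
      using sat_shift[of c2 p1' "a \<odot> e'"] sat_shift[of "shift C M c2 m2" u a] sat_shift[of c2 m2 "a \<odot> u"]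
        comp_assoc[of p1' e' a] comp_assoc[of m2 u a] a aA c s M1 M2 t t' xy A eq by simp
    have "sat C M (transport C (shift C M (shift C M c3 m2') v) (y, x)) a \<longleftrightarrow> sat C M (transport C (shift C M c3 m2') (n1', q1')) (a \<odot> e')"
      by (rule transport_shift[OF M2(4,3,7,5) po(3,4)]) (use s a xy t' in simp_all)
    then have 3: "sat C M (transport C (shift C M c3 m2') (n1', q1')) (a \<odot> e') \<longleftrightarrow> sat C M (transport C (shift C M c3 (v \<odot> m2')) (y, x)) a"
      using tv a xy unfolding cond_equiv_def by simp
    show "sat C M (shift C M c32 e') a \<longleftrightarrow> sat C M cA a" using 1 2 3 unfolding c32_def cA_def by simp
  qed
  have eqB: "sat C M (transport C (shift C M c32 e') (y1, x1)) h \<longleftrightarrow> sat C M (transport C cA (y1, x1)) h"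
    using transport_cong[OF r(1), of "shift C M c32 e'" cA] s4 eqA h unfolding cond_equiv_def by simp
  have hp: "h \<odot> pp \<in> M" using M_comp[OF M1(5) h(1)] h t by simp
  have 1: "sat C M (shift C M c1 p1) (h \<odot> pp) \<longleftrightarrow> sat C M (shift C M c1 (pp \<odot> p1)) h"
    using sat_shift[of c1 p1 "h \<odot> pp"] sat_shift[of c1 "pp \<odot> p1" h] comp_assoc[of p1 pp h] hp c M1 A t um h by simp
  have 2: "sat C M (transport C (shift C M (shift C M c2 m2) u) (y1, x1)) h \<longleftrightarrow> sat C M (transport C (shift C M c2 m2) (n1, q1)) (h \<odot> pp)"
    by (rule transport_shift[OF M1(4,3,7,5) po(1,2)]) (use s h t in simp_all)
  have 3: "sat C M (transport C (shift C M c3 (v \<odot> m2')) (y \<odot> z2, x1 \<odot> z1)) h \<longleftrightarrow>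
    sat C M (transport C (transport C (shift C M c3 (v \<odot> m2')) (y, x)) (y1, x1)) h"
    by (rule transport_comp[OF r(1,2) _ pb]) (use s h xy in simp_all)
  have 4: "sat C M (shift C M (CAnd (shift C M c1 p1) (transport C (shift C M c2 m2) (n1, q1))) pp) h \<longleftrightarrow>
      sat C M (shift C M c1 p1) (h \<odot> pp) \<and> sat C M (transport C (shift C M c2 m2) (n1, q1)) (h \<odot> pp)"
    using sat_shift[of "CAnd (shift C M c1 p1) (transport C (shift C M c2 m2) (n1, q1))" pp h] s s2 M1 t h by simp
  show ?thesis using 1 2 3 4 eqB unfolding c32_def[symmetric] cA_def by simp argo
qed

text \<open>A morphism satisfying the composite condition satisfies the first rule's condition after
  precomposition with \<open>p1\<close>. An unsatisfiable condition of the second rule stays so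
  under shift and, by \<open>transport_cong\<close>, under transport at every
  \<open>M\<close>-morphism. Given the diagrams, admissibility of a pair thus reduces to
  satisfiability of the final condition.\<close>

lemma composite_condition_not_false:
  assumes R: "linear_crule C M R2" "linear_crule C M R1" and o: "overlap_span C M (fst R2) (fst R1) \<mu>"
    and d: "composite_diagram C (fst R2) (fst R1) \<mu> m2 m1 k1 n1 k2 n2 p2 q2 p1 q1 u2 u1"
    and nf: "\<not> cond_equiv C M (rule_input C (fst (compose_along C M R2 \<mu> R1))) (snd (compose_along C M R2 \<mu> R1)) CFalse"
  shows "\<not> cond_equiv C M (rule_input C (fst R2)) (snd R2) CFalse" "\<not> cond_equiv C M (rule_input C (fst R1)) (snd R1) CFalse"
proof -
  note t = composite_diagram_typing[OF linear_cruleD(1)[OF R(1)] linear_cruleD(1)[OF R(2)] o d]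
  note c = linear_cruleD(2)[OF R(1)] linear_cruleD(2)[OF R(2)]
  let ?R = "composite_crule C M (snd R2) (snd R1) m2 n1 q2 p1 q1 u2 u1"
  have nf': "\<not> cond_equiv C M (rule_input C (fst ?R)) (snd ?R) CFalse"
    using crule_iso_not_false[OF crule_iso_sym[OF compose_along_iso(1)[OF R o d]]]
      linear_cruleD(1)[OF compose_along_iso(2)[OF R o d]] linear_cruleD(1)[OF composite_crule_linear[OF R o d]] nf by blast
  then obtain h where h: "h \<in> M" "Dom C h = Cod C q1" "sat C M (shift C M (snd R1) p1) h" "sat C M (transport C (shift C M (snd R2) m2) (n1, q1)) h"
    using t unfolding cond_equiv_def composite_crule_def by auto
  have "sat C M (snd R1) (h \<odot> p1)" using sat_shift[of "snd R1" p1 h] c t h by simp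
  moreover have "h \<odot> p1 \<in> M" "Dom C (h \<odot> p1) = Cod C (snd (fst R1))" using M_comp[of p1 h] h t by (simp_all add: M_arr)
  ultimately show "\<not> cond_equiv C M (rule_input C (fst R1)) (snd R1) CFalse" unfolding cond_equiv_def by auto
  show "\<not> cond_equiv C M (rule_input C (fst R2)) (snd R2) CFalse"
  proof
    assume f: "cond_equiv C M (rule_input C (fst R2)) (snd R2) CFalse"
    have r: "linear_rule C M (n1, q1)" using t by (simp add: linear_rule_def)
    have s: "cond_over C M (shift C M (snd R2) m2) (Cod C n1)" using cond_over_shift[of "snd R2" m2] c t by simp
    have "cond_equiv C M (Cod C n1) (shift C M (snd R2) m2) CFalse"
      unfolding cond_equiv_def
    proof (intro ballI impI)
      fix b assume b: "b \<in> M" "Dom C b = Cod C n1"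
      then have "b \<odot> m2 \<in> M" "Dom C (b \<odot> m2) = Cod C (snd (fst R2))" using M_comp[of m2 b] t by (simp_all add: M_arr)
      then show "sat C M (shift C M (snd R2) m2) b \<longleftrightarrow> sat C M CFalse b"
        using sat_shift[of "snd R2" m2 b] f c t b unfolding cond_equiv_def by simp
    qed
    with transport_cong[OF r, of "shift C M (snd R2) m2" CFalse] s t
    have "cond_equiv C M (Cod C q1) (transport C (shift C M (snd R2) m2) (n1, q1)) CFalse" by (simp add: cod_obj)
    then show False using h unfolding cond_equiv_def by auto
  qed
qed

text \<open>The first rule's step on \<open>A\<close> is restricted to the part \<open>u\<close>;
  \<open>f1\<close> embeds the restricted context and \<open>pp\<close> the restricted result.
  \<open>pushout_synthesis\<close> then intersects the contexts of the two steps.\<close>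

lemma composite_embedding:
  assumes l: "linear_rule C M r" "linear_rule C M r1" and o: "overlap_span C M r r1 \<mu>"
    and cd: "composite_diagram C r r1 \<mu> m2 m1 k1 n1 k n p q p1 q1 u2 u1"
    and e: "embedding C M m2 m1 k n p q g1 d h x g y u f e"
    and s1: "is_pushout C (fst r1) d1 g1 y1" "is_pushout C (snd r1) d1 h1 x1"
    and pb: "is_pullback C z2 z1 x y1"
  obtains f1 pp kk where "is_pushout C n1 f1 u y1" "is_pushout C q1 f1 pp x1" "pp \<odot> p1 = h1"
    "is_pushout C (q \<odot> u2) kk e (y \<odot> z2)" "is_pushout C (q1 \<odot> u1) kk pp (x1 \<odot> z1)"
proof -
  note t = composite_diagram_typing[OF l o cd]
  have p: "is_pushout C (fst r1) k1 m1 n1" "is_pushout C (snd r) k m2 n"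
    "is_pushout C (fst r) k p q" "is_pullback C u2 u1 n n1" "is_pushout C (snd r1) k1 p1 q1"
    using cd by (auto simp: composite_diagram_def)
  have E: "u \<in> M" "u \<odot> m1 = g1" "is_pushout C n f u x" "is_pushout C q f e y" using e by (auto simp: embedding_def)
  have ut: "Cod C m1 = Dom C u" using pushout_comm[OF E(3)] t by (simp add: comm_square_def)
  have "is_pushout C (fst r1) d1 (u \<odot> m1) y1" using s1 E by simp
  from pushout_complement_decompose(2)[OF this linear_ruleD(1)[OF l(2)] E(1) t(14) ut t(26) p(1)]
  obtain f1 where f1: "f1 \<in> Arr C" "Dom C f1 = Dom C n1" "f1 \<odot> k1 = d1" "is_pushout C n1 f1 u y1" by blast
  obtain pp where pp: "is_pushout C q1 f1 pp x1" "pp \<odot> p1 = h1"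
    using pushout_factor[OF s1(2) linear_ruleD(2)[OF l(2)] p(5) f1(1) _ f1(3)] f1 t by auto
  obtain kk where "is_pushout C u2 kk f z2" "is_pushout C u1 kk f1 z1"
    using pushout_synthesis[OF p(4) E(3) f1(4) t(6,4) pb] .
  from pushout_compose_sym[OF this(1) E(4)] pushout_compose_sym[OF this(2) pp(1)]
  show thesis using that f1 pp by blast
qed

text \<open>Both bracketings receive composition diagrams built over the same three derivation
  steps, arranged so that the two plain rules coincide literally. Isomorphisms are needed only to
  pass between these composites and the \<open>SOME\<close>-chosen ones.\<close>

theorem composite_associative:
  assumes R: "linear_crule C M R1" "linear_crule C M R2" "linear_crule C M R3"
    and o: "overlap_span C M (fst R2) (fst R1) \<mu>"
    and d: "composite_diagram C (fst R2) (fst R1) \<mu> m2 m1 k1 n1 k2 n2 p2 q2 p1 q1 u2 u1"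
    and R21: "R21 = composite_crule C M (snd R2) (snd R1) m2 n1 q2 p1 q1 u2 u1"
    and o': "overlap_span C M (fst R3) (fst R2) \<mu>'"
    and d': "composite_diagram C (fst R3) (fst R2) \<mu>' m2' m1' k1' n1' k2' n2' p2' q2' p1' q1' u2' u1'"
    and R32: "R32 = composite_crule C M (snd R3) (snd R2) m2' n1' q2' p1' q1' u2' u1'"
    and m: "middle_diagram C M (fst R2) g1 dd h x g y h3"
    and e: "embedding C M m2 m1 k2 n2 p2 q2 g1 dd h x g y u f e"
    and e': "embedding C M m1' m2' k1' n1' p1' q1' h3 dd g y h x v f' e'"
    and \<nu>: "is_pullback C (fst \<nu>) (snd \<nu>) h3 e" "jointly_epic C h3 e"
    and \<kappa>: "is_pullback C (fst \<kappa>) (snd \<kappa>) e' g1" "jointly_epic C g1 e'"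
    and pc: "has_pushout_complement C (fst (fst R1)) g1" "has_pushout_complement C (snd (fst R3)) h3"
  shows "overlap_span C M (fst R3) (fst R21) \<nu>" "overlap_span C M (fst R32) (fst R1) \<kappa>"
    "\<exists>k1 n1 k2 n2 p2 q2 p1 q1 u2 u1. composite_diagram C (fst R3) (fst R21) \<nu> h3 e k1 n1 k2 n2 p2 q2 p1 q1 u2 u1"
    "\<exists>k1 n1 k2 n2 p2 q2 p1 q1 u2 u1. composite_diagram C (fst R32) (fst R1) \<kappa> e' g1 k1 n1 k2 n2 p2 q2 p1 q1 u2 u1"
    "crule_iso C M (compose_along C M R3 \<nu> R21) (compose_along C M R32 \<kappa> R1)"
    "linear_crule C M (compose_along C M R3 \<nu> R21)"
proof -
  note l1 = linear_cruleD(1)[OF R(1)] and l2 = linear_cruleD(1)[OF R(2)] and l3 = linear_cruleD(1)[OF R(3)]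
  have l2': "linear_rule C M (prod.swap (fst R2))" and l3': "linear_rule C M (prod.swap (fst R3))"
    using l2 l3 by (simp_all add: linear_rule_swap)
  have ds: "composite_diagram C (prod.swap (fst R2)) (prod.swap (fst R3)) (prod.swap \<mu>') m1' m2' k2' n2' k1' n1' p1' q1' p2' q2' u1' u2'"
    using composite_diagram_reverse[OF category_axioms d'] .
  have os: "overlap_span C M (prod.swap (fst R2)) (prod.swap (fst R3)) (prod.swap \<mu>')" using o' by (simp add: overlap_span_swap)
  note t = composite_diagram_typing[OF l2 l1 o d] and t' = composite_diagram_typing[OF l3 l2 o' d']
  have p: "is_pushout C (snd (fst R2)) k2 m2 n2" "is_pushout C (fst (fst R2)) k2 p2 q2"
    "is_pushout C (fst (fst R2)) k1' m1' n1'" "is_pushout C (snd (fst R2)) k1' p1' q1'"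
    using d d' by (auto simp: composite_diagram_def)
  note tm = middle_diagram_typing[OF l2 m]
  note te = embedding_typing[OF l2 m p(1,2) e]
  have te': "v \<in> M" "f' \<in> M" "e' \<in> M" "v \<in> Arr C" "e' \<in> Arr C" "Dom C v = Cod C m1'" "Cod C v = Cod C g" "Dom C e' = Cod C p1'" "Cod C e' = Cod C h"
    using embedding_typing[OF l2' middle_diagram_reverse[OF l2 m] _ _ e'] p by simp_all
  have E: "u \<odot> m2 = h" "u \<odot> m1 = g1" using e by (auto simp: embedding_def)
  have E': "v \<odot> m2' = h3" "e' \<odot> p1' = h" "is_pushout C n1' f' v y" "is_pushout C q1' f' e' x" using e' by (auto simp: embedding_def)
  have L21: "linear_crule C M R21" unfolding R21 using composite_crule_linear[OF R(2,1) o d] .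
  have L32: "linear_crule C M R32" unfolding R32 using composite_crule_linear[OF R(3,2) o' d'] .
  have f21: "fst R21 = (q2 \<odot> u2, q1 \<odot> u1)" unfolding R21 composite_crule_def by simp
  have f32: "fst R32 = (q2' \<odot> u2', q1' \<odot> u1')" unfolding R32 composite_crule_def by simp
  obtain d1 y1 where s1: "is_pushout C (fst (fst R1)) d1 g1 y1" using pc unfolding has_pushout_complement_def by blast
  note D1 = linear_ruleD[OF l1] and D3 = linear_ruleD[OF l3]
  have d1M: "d1 \<in> M" "y1 \<in> M" "d1 \<in> Arr C" "y1 \<in> Arr C" "Cod C y1 = Cod C g1" "Dom C y1 = Cod C d1" "Dom C d1 = Dom C (snd (fst R1))"
    using M_pushout_complement_stable[OF s1 D1(1) tm(1)] M_pushout_stable[OF s1 D1(1)] pushout_comm[OF s1] D1(5)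
    by (auto simp: comm_square_def)
  obtain h1 x1 where s1': "is_pushout C (snd (fst R1)) d1 h1 x1" using M_pushout_ex[OF D1(2) d1M(3)] d1M by auto
  obtain d3 x3 where s3: "is_pushout C (snd (fst R3)) d3 h3 x3" using pc unfolding has_pushout_complement_def by blast
  have d3M: "d3 \<in> M" "x3 \<in> M" "d3 \<in> Arr C" "x3 \<in> Arr C" "Cod C x3 = Cod C h3" "Dom C x3 = Cod C d3" "Dom C d3 = Dom C (snd (fst R3))"
    using M_pushout_complement_stable[OF s3 D3(2) tm(3)] M_pushout_stable[OF s3 D3(2)] pushout_comm[OF s3]
    by (auto simp: comm_square_def)
  obtain g3 y3 where s3': "is_pushout C (fst (fst R3)) d3 g3 y3" using M_pushout_ex[OF D3(1) d3M(3)] d3M D3 by auto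
  obtain z2 z1 where pz: "is_pullback C z2 z1 x y1" using M_pullback_ex[OF tm(6) d1M(4)] d1M tm by auto
  obtain z2' z1' where pz': "is_pullback C z2' z1' y x3" using M_pullback_ex[OF tm(7) d3M(4)] d3M tm by auto
  have zt: "z2 \<in> Arr C" "z1 \<in> Arr C" "Cod C z2 = Dom C x" "Cod C z1 = Dom C y1" "Dom C z1 = Dom C z2"
    using pullback_comm[OF pz] by (auto simp: comm_square_def)
  have zt': "z2' \<in> Arr C" "z1' \<in> Arr C" "Cod C z2' = Dom C y" "Cod C z1' = Dom C x3" "Dom C z1' = Dom C z2'"
    using pullback_comm[OF pz'] by (auto simp: comm_square_def)
  obtain f1 pp kk where A: "is_pushout C n1 f1 u y1" "is_pushout C q1 f1 pp x1" "pp \<odot> p1 = h1"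
    "is_pushout C (q2 \<odot> u2) kk e (y \<odot> z2)" "is_pushout C (q1 \<odot> u1) kk pp (x1 \<odot> z1)"
    using composite_embedding[OF l2 l1 o d e s1 s1' pz] .
  obtain qq kk' where B: "is_pushout C (q1' \<odot> u1') kk' e' (x \<odot> z2')" "is_pushout C (q2' \<odot> u2') kk' qq (y3 \<odot> z1')"
    using composite_embedding[OF l2' l3' os ds e' _ _ pz', of d3 g3 y3] s3 s3' by (metis fst_swap snd_swap)
  have yz: "y \<odot> z2 \<in> Arr C" "Cod C (y \<odot> z2) = Cod C g" "Dom C (y \<odot> z2) = Dom C z2" using tm zt by simp_all
  \<comment> \<open>The triple intersection of contexts, formed with the left-bracketed context
    \<open>y \<odot> z2\<close>. The arrow \<open>W2\<close> exhibits the same apex as the pullback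
    for the other bracketing.\<close>
  obtain w3 w12 where pw: "is_pullback C w3 w12 x3 (y \<odot> z2)" using M_pullback_ex[OF d3M(2) yz(1)] yz d3M tm by auto
  have wt: "w3 \<in> Arr C" "w12 \<in> Arr C" "Cod C w3 = Dom C x3" "Cod C w12 = Dom C z2" "Dom C w3 = Dom C w12" "x3 \<odot> w3 = (y \<odot> z2) \<odot> w12"
    using pullback_comm[OF pw] yz by (auto simp: comm_square_def)
  have "comm_square C (z2 \<odot> w12) w3 y x3" using wt zt tm d3M comp_assoc[of w12 z2 y] by (simp add: comm_square_def)
  from pullback_obtain[OF pz' this]
  obtain W2 where W2: "W2 \<in> Arr C" "Dom C W2 = Dom C w12" "Cod C W2 = Dom C z2'" "z2' \<odot> W2 = z2 \<odot> w12" "z1' \<odot> W2 = w3"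
    using wt zt by auto
  have "is_pullback C w12 W2 z2 z2'"
    by (rule pullback_decompose[OF pz']) (use pullback_sym[OF pw] W2 wt zt zt' tm in \<open>simp_all add: comm_square_def\<close>)
  from pullback_compose[OF pullback_sym[OF this] pz]
  have pW: "is_pullback C W2 (z1 \<odot> w12) (x \<odot> z2') y1" .
  have pn: "is_pushout C (fst \<nu>) (snd \<nu>) h3 e" using jointly_epic_pushout[OF tm(3) te(3) \<nu>] .
  have "jointly_epic C e' g1" using \<kappa>(2) unfolding jointly_epic_def by auto
  then have pk: "is_pushout C (fst \<kappa>) (snd \<kappa>) e' g1" using jointly_epic_pushout[OF te'(3) tm(1) \<kappa>(1)] by blast
  have cA: "composite_diagram C (fst R3) (fst R21) \<nu> h3 e kk (y \<odot> z2) d3 x3 g3 y3 pp (x1 \<odot> z1) w3 w12"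
    unfolding composite_diagram_def f21 using pn A s3 s3' pw by simp
  have cB: "composite_diagram C (fst R32) (fst R1) \<kappa> e' g1 d1 y1 kk' (x \<odot> z2') qq (y3 \<odot> z1') h1 x1 W2 (z1 \<odot> w12)"
    unfolding composite_diagram_def f32 using pk B s1 s1' pW by simp
  have \<nu>t: "Dom C (fst \<nu>) = Dom C (snd \<nu>)" "Cod C (fst \<nu>) = Dom C h3" "Cod C (snd \<nu>) = Dom C e"
    using pullback_comm[OF \<nu>(1)] by (auto simp: comm_square_def)
  have \<kappa>t: "Dom C (fst \<kappa>) = Dom C (snd \<kappa>)" "Cod C (fst \<kappa>) = Dom C e'" "Cod C (snd \<kappa>) = Dom C g1"
    using pullback_comm[OF \<kappa>(1)] by (auto simp: comm_square_def)
  have h3t: "Dom C h3 = Cod C (snd (fst R3))" "Dom C g1 = Cod C (fst (fst R1))"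
    using pushout_comm[OF s3] pushout_comm[OF s1] by (auto simp: comm_square_def)
  have "fst \<nu> \<in> M" "snd \<nu> \<in> M" using M_pullback_stable'[OF \<nu>(1)] M_pullback_stable[OF \<nu>(1)] tm te by auto
  then show oA: "overlap_span C M (fst R3) (fst R21) \<nu>"
    using \<nu>t h3t t te(22) unfolding overlap_span_def f21 by simp
  have "fst \<kappa> \<in> M" "snd \<kappa> \<in> M" using M_pullback_stable'[OF \<kappa>(1)] M_pullback_stable[OF \<kappa>(1)] tm te' by auto
  then show oB: "overlap_span C M (fst R32) (fst R1) \<kappa>"
    using \<kappa>t h3t t' te' unfolding overlap_span_def f32 by simp
  show "\<exists>k1 n1 k2 n2 p2 q2 p1 q1 u2 u1. composite_diagram C (fst R3) (fst R21) \<nu> h3 e k1 n1 k2 n2 p2 q2 p1 q1 u2 u1"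
    using cA by blast
  show "\<exists>k1 n1 k2 n2 p2 q2 p1 q1 u2 u1. composite_diagram C (fst R32) (fst R1) \<kappa> e' g1 k1 n1 k2 n2 p2 q2 p1 q1 u2 u1"
    using cB by blast
  note tA = composite_diagram_typing[OF l3 linear_cruleD(1)[OF L21] oA cA] and tB = composite_diagram_typing[OF linear_cruleD(1)[OF L32] l1 oB cB]
  let ?A = "composite_crule C M (snd R3) (snd R21) h3 (y \<odot> z2) y3 pp (x1 \<odot> z1) w3 w12"
  let ?B = "composite_crule C M (snd R32) (snd R1) e' y1 (y3 \<odot> z1') h1 x1 W2 (z1 \<odot> w12)"
  have x1t: "x1 \<in> Arr C" "x1 \<in> M" "Dom C x1 = Cod C d1" "y3 \<in> Arr C" "Dom C y3 = Cod C d3" using tA tB by auto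
  have r1: "(y3 \<odot> z1') \<odot> W2 = y3 \<odot> w3" using comp_assoc[of W2 z1' y3] W2 zt' x1t d3M by simp
  have r2: "x1 \<odot> (z1 \<odot> w12) = (x1 \<odot> z1) \<odot> w12" using comp_assoc[of w12 z1 x1] wt zt x1t d1M by simp
  \<comment> \<open>After reassociation the legs are identical, so identities will serve as the
    isomorphisms of rules.\<close>
  have fAB: "fst ?A = fst ?B" unfolding composite_crule_def using r1 r2 by simp
  have sAB: "sat C M (snd ?A) a \<longleftrightarrow> sat C M (snd ?B) a" if "a \<in> M" "Dom C a = Cod C x1" for a
  proof -
    have "cond_over C M (snd R1) (Dom C p1)" "cond_over C M (snd R2) (Dom C m2)" "cond_over C M (snd R3) (Dom C m2')"
      using R[THEN linear_cruleD(2)] t(29,25) t'(25) t by auto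
    moreover have "Cod C p1 = Cod C q1" "Dom C n1 = Dom C q1" "Cod C m2 = Cod C n1" using t by auto
    moreover have "Cod C p1' = Cod C q1'" "Dom C n1' = Dom C q1'" "Cod C m2' = Cod C n1'" using t' by auto
    moreover have "e' \<odot> p1' = u \<odot> m2" "Dom C p1' = Dom C m2" using E E' t t' by auto
    ultimately have "sat C M (CAnd (shift C M (CAnd (shift C M (snd R1) p1) (transport C (shift C M (snd R2) m2) (n1, q1))) pp)
        (transport C (shift C M (snd R3) (v \<odot> m2')) (y \<odot> z2, x1 \<odot> z1))) a \<longleftrightarrow>
      sat C M (CAnd (shift C M (snd R1) (pp \<odot> p1))
        (transport C (shift C M (CAnd (shift C M (snd R2) p1') (transport C (shift C M (snd R3) m2') (n1', q1'))) e') (y1, x1))) a"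
      using associative_cond[OF _ _ _ t(9,1,10,4) tA(9) _ _ _ t'(9,1,10,4) te'(3) _ _ _ A(2,1) E'(4,3) _ _ pz that] by blast
    then show ?thesis unfolding composite_crule_def R21 R32 using A(3) E'(1) by simp
  qed
  have LA: "linear_crule C M ?A" using composite_crule_linear[OF R(3) L21 oA cA] .
  have LB: "linear_crule C M ?B" using composite_crule_linear[OF L32 R(1) oB cB] .
  note la = linear_ruleD[OF linear_cruleD(1)[OF LA]]
  have iAB: "crule_iso C M ?A ?B"
  proof (rule crule_isoI[of "Id C (rule_output C (fst ?A))" _ _ "Id C (Dom C (fst (fst ?A)))" "Id C (rule_input C (fst ?A))"])
    fix a assume a: "a \<in> M" "Dom C a = rule_input C (fst ?B)"
    then have "Dom C a = Cod C x1" using tB by (simp add: composite_crule_def)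
    then show "sat C M (snd ?A) (a \<odot> Id C (rule_input C (fst ?A))) \<longleftrightarrow> sat C M (snd ?B) a"
      using sAB[OF a(1)] a id_right'[of a] fAB by (simp add: M_arr)
  qed (use fAB la in \<open>simp_all add: id_iso id_dom id_cod cod_obj dom_obj id_left' id_right'\<close>)
  note ca = compose_along_iso[OF R(3) L21 oA cA] and cb = compose_along_iso[OF L32 R(1) oB cB]
  show "linear_crule C M (compose_along C M R3 \<nu> R21)" by (fact ca(2))
  show "crule_iso C M (compose_along C M R3 \<nu> R21) (compose_along C M R32 \<kappa> R1)"
    using crule_iso_trans[OF ca(1) crule_iso_trans[OF iAB crule_iso_sym[OF cb(1)]]]
      linear_cruleD(1)[OF LA] linear_cruleD(1)[OF LB] linear_cruleD(1)[OF ca(2)] linear_cruleD(1)[OF cb(2)] by blast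
qed

end

section \<open>Correspondence between left-bracketed and right-bracketed pairs of spans\<close>

lemma chosen_diagram_unique:
  assumes "chosen_diagram C r2 r1 \<mu> m2 m1 k1 n1 k2 n2 p2 q2 p1 q1 u2 u1"
    and "chosen_diagram C r2 r1 \<mu> m2' m1' k1' n1' k2' n2' p2' q2' p1' q1' u2' u1'"
  shows "m2' = m2 \<and> m1' = m1 \<and> k1' = k1 \<and> n1' = n1 \<and> k2' = k2 \<and> n2' = n2 \<and>
    p2' = p2 \<and> q2' = q2 \<and> p1' = p1 \<and> q1' = q1 \<and> u2' = u2 \<and> u1' = u1"
  using assms unfolding chosen_diagram_def by auto

definition left_induces where
  "left_induces C M r2 r1 \<mu> \<nu> g1 d h x g y h3 \<longleftrightarrow>
    (\<exists>m2 m1 k1 n1 k2 n2 p2 q2 p1 q1 u2 u1. chosen_diagram C r2 r1 \<mu> m2 m1 k1 n1 k2 n2 p2 q2 p1 q1 u2 u1 \<and>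
      induces C M r2 \<mu> m2 m1 k2 n2 p2 q2 \<nu> g1 d h x g y h3)"

text \<open>After reversal the rule \<open>r3\<close> acts before the middle rule, so the sides are
  exchanged: the half \<open>k1\<close>, \<open>n1\<close>, \<open>p1\<close>, \<open>q1\<close> of
  the composition diagram belongs to \<open>r2\<close>, and \<open>g1\<close> and \<open>h3\<close>
  change places.\<close>

definition right_induces where
  "right_induces C M r3 r2 \<mu> \<kappa> g1 d h x g y h3 \<longleftrightarrow>
    (\<exists>m2 m1 k1 n1 k2 n2 p2 q2 p1 q1 u2 u1. chosen_diagram C r3 r2 \<mu> m2 m1 k1 n1 k2 n2 p2 q2 p1 q1 u2 u1 \<and>
      induces C M (prod.swap r2) (prod.swap \<mu>) m1 m2 k1 n1 p1 q1 (prod.swap \<kappa>) h3 d g y h x g1)"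

text \<open>A single middle diagram witnesses both sides. The two complements say that the outer
  rules can act on it, which neither \<open>left_induces\<close> nor \<open>right_induces\<close>
  provides.\<close>

definition corresponding_spans where
  "corresponding_spans C M r3 r2 r1 \<mu> \<nu> \<mu>' \<kappa> \<longleftrightarrow>
    (\<exists>g1 d h x g y h3. has_pushout_complement C (fst r1) g1 \<and> has_pushout_complement C (snd r3) h3 \<and>
      left_induces C M r2 r1 \<mu> \<nu> g1 d h x g y h3 \<and> right_induces C M r3 r2 \<mu>' \<kappa> g1 d h x g y h3)"

context rewriting_category
begin

text \<open>The steps on \<open>A\<close> restrict along the union \<open>u\<close> of
  \<open>h\<close> and \<open>g1\<close>, so complements for \<open>g1\<close> and \<open>h\<close>
  yield the complements for \<open>m1\<close> and \<open>m2\<close> that a composition diagram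
  requires.\<close>

lemma middle_composite:
  assumes l: "linear_rule C M r" "linear_rule C M r1" and m: "middle_diagram C M r g1 d h x g y h3"
    and pc: "has_pushout_complement C (fst r1) g1" and pb: "is_pullback C (fst \<mu>) (snd \<mu>) h g1"
  shows "overlap_span C M r r1 \<mu>"
    and "\<exists>m2 m1 k1 n1 k2 n2 p2 q2 p1 q1 u2 u1. composite_diagram C r r1 \<mu> m2 m1 k1 n1 k2 n2 p2 q2 p1 q1 u2 u1"
proof -
  note t = middle_diagram_typing[OF l(1) m]
  have \<mu>: "fst \<mu> \<in> M" "snd \<mu> \<in> M" using M_pullback_stable'[OF pb t(1)] M_pullback_stable[OF pb t(2)] by auto
  have \<mu>t: "Dom C (fst \<mu>) = Dom C (snd \<mu>)" "Cod C (fst \<mu>) = Dom C h" "Cod C (snd \<mu>) = Dom C g1" "snd \<mu> \<in> Arr C"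
    using pullback_comm[OF pb] by (auto simp: comm_square_def)
  have g1: "Dom C g1 = Cod C (fst r1)" using has_pushout_complement_comm[OF pc] by simp
  show o: "overlap_span C M r r1 \<mu>" using \<mu> \<mu>t g1 t unfolding overlap_span_def by simp
  obtain m2 m1 k1 n1 k2 n2 p2 q2 p1 q1 u2 u1 where c: "chosen_diagram C r r1 \<mu> m2 m1 k1 n1 k2 n2 p2 q2 p1 q1 u2 u1"
    by (rule chosen_diagram_ex)
  have p: "is_pushout C (fst \<mu>) (snd \<mu>) m2 m1"
    using some_pushout[OF \<mu>(1) \<mu>t(4,1)] c by (simp add: chosen_diagram_def)
  have mt: "m2 \<in> Arr C" "m1 \<in> Arr C" "Dom C m2 = Cod C (snd r)" "Dom C m1 = Cod C (fst r1)" "Cod C m1 = Cod C m2"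
    using pushout_comm[OF p] \<mu>t g1 t by (auto simp: comm_square_def)
  obtain u where u: "u \<in> M" "Dom C u = Cod C m2" "u \<odot> m2 = h" "u \<odot> m1 = g1"
    using effective_union[OF t(2,1) pb p] by metis
  have "is_pushout C (snd r) d (u \<odot> m2) x" using m u by (simp add: middle_diagram_def)
  from pushout_complement_decompose(1)[OF this linear_ruleD(2)[OF l(1)] u(1) mt(1) _ mt(3)]
  have pc2: "has_pushout_complement C (snd r) m2" using u by simp
  obtain d1 y1 where "is_pushout C (fst r1) d1 (u \<odot> m1) y1" using pc u unfolding has_pushout_complement_def by auto
  from pushout_complement_decompose(1)[OF this linear_ruleD(1)[OF l(2)] u(1) mt(2) _ mt(4)]
  have pc1: "has_pushout_complement C (fst r1) m1" using u mt by simp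
  show "\<exists>m2 m1 k1 n1 k2 n2 p2 q2 p1 q1 u2 u1. composite_diagram C r r1 \<mu> m2 m1 k1 n1 k2 n2 p2 q2 p1 q1 u2 u1"
    using chosen_diagram_composite[OF l o c pc1 pc2] by blast
qed

lemma induces_of_composite:
  assumes l: "linear_rule C M r" "linear_rule C M r1" and o: "overlap_span C M r r1 \<mu>"
    and cd: "composite_diagram C r r1 \<mu> m2 m1 k1 n1 k n p q p1 q1 u2 u1"
    and \<nu>: "is_pushout C (fst \<nu>) (snd \<nu>) h3 e" "fst \<nu> \<in> M" "snd \<nu> \<in> M" and pc: "has_pushout_complement C (q \<odot> u2) e"
  obtains g1 d h x g y where "induces C M r \<mu> m2 m1 k n p q \<nu> g1 d h x g y h3" "has_pushout_complement C (fst r1) g1"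
    "middle_diagram C M r g1 d h x g y h3"
proof -
  have e: "e \<in> M" "h3 \<in> M" using M_pushout_stable[OF \<nu>(1,2)] M_pushout_stable'[OF \<nu>(1,3)] by auto
  have "Cod C h3 = Cod C e" using pushout_comm[OF \<nu>(1)] by (simp add: comm_square_def)
  then obtain g1 d h x g y u f where m: "middle_diagram C M r g1 d h x g y h3" "has_pushout_complement C (fst r1) g1"
    "embedding C M m2 m1 k n p q g1 d h x g y u f e"
    using embedding_of_pushout[OF l o cd e _ pc] by metis
  have "is_pullback C (fst \<nu>) (snd \<nu>) h3 e" using pushout_along_M_is_pullback[OF \<nu>(1,2)] .
  moreover have "jointly_epic C h3 e" using pushout_jointly_epic[OF \<nu>(1)] .
  ultimately have "induces C M r \<mu> m2 m1 k n p q \<nu> g1 d h x g y h3"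
    unfolding induces_def using m cd o by (auto simp: composite_diagram_def overlap_span_def)
  with that m show thesis by blast
qed

text \<open>\<open>embedding_ex\<close> supplies the reversed embedding and
  \<open>jointly_epic_transfer\<close> its generation property. The span \<open>\<kappa>\<close> is
  left arbitrary so that the representative of its class can be chosen afterwards.\<close>

lemma induces_reverse:
  assumes l: "linear_rule C M r" and i: "induces C M r \<mu> m2 m1 k n p q \<nu> g1 d h x g y h3"
    and i': "is_pushout C (fst \<mu>') (snd \<mu>') m2' m1'" "fst \<mu>' \<in> M" "is_pushout C (fst r) k' m2' n'" "is_pushout C (snd r) k' p' q'"
    and pb: "is_pullback C (fst \<mu>') (snd \<mu>') g h3"
  obtains e' where "e' \<in> M" "Cod C e' = Cod C g1"
    "\<And>\<kappa>. is_pullback C (fst \<kappa>) (snd \<kappa>) g1 e' \<Longrightarrow> induces C M (prod.swap r) \<mu>' m2' m1' k' n' p' q' \<kappa> h3 d g y h x g1"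
proof -
  have l': "linear_rule C M (prod.swap r)" using l by (simp add: linear_rule_swap)
  obtain u f e where u: "embedding C M m2 m1 k n p q g1 d h x g y u f e"
    and m: "middle_diagram C M r g1 d h x g y h3" "is_pushout C (fst \<mu>) (snd \<mu>) m2 m1"
    "is_pushout C (snd r) k m2 n" "is_pushout C (fst r) k p q" "jointly_epic C h3 e"
    using i unfolding induces_def by blast
  note m' = middle_diagram_reverse[OF l m(1)]
  have "is_pushout C (snd (prod.swap r)) k' m2' n'" "is_pushout C (fst (prod.swap r)) k' p' q'" using i' by simp_all
  from embedding_ex[OF l' m' i'(1) this pb]
  obtain v f' e' where e': "embedding C M m2' m1' k' n' p' q' h3 d g y h x v f' e'" .
  have "m1' \<in> Arr C" "Cod C m1' = Cod C m2'" using pushout_comm[OF i'(1)] by (auto simp: comm_square_def)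
  from jointly_epic_transfer[OF l m(1,3,4) pushout_jointly_epic[OF m(2)] u i'(3,4) this e' m(5)]
  have je: "jointly_epic C g1 e'" .
  have t: "e' \<in> M" "Cod C e' = Cod C h" using embedding_typing[OF l' m' _ _ e'] i' by simp_all
  show thesis
  proof (rule that[of e'])
    show "e' \<in> M" "Cod C e' = Cod C g1" using t m by (simp_all add: middle_diagram_def)
    fix \<kappa> assume "is_pullback C (fst \<kappa>) (snd \<kappa>) g1 e'"
    then show "induces C M (prod.swap r) \<mu>' m2' m1' k' n' p' q' \<kappa> h3 d g y h x g1"
      unfolding induces_def using m' i' e' je by auto
  qed
qed

text \<open>A pullback span replaced by the \<open>SOME\<close> member of its class is still a
  pullback. Being a fixed point of this choice matters because \<open>composite\<close> uses the
  chosen member, and the second match is taken relative to that composite.\<close>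

lemma pullback_rep_ex:
  assumes "h \<in> M" "k \<in> M" "Cod C h = Cod C k"
  obtains \<mu> where "is_pullback C (fst \<mu>) (snd \<mu>) h k" "(SOME \<nu>. \<nu> \<in> span_iso C `` {\<mu>}) = \<mu>"
proof -
  obtain a b where ab: "is_pullback C a b h k" using M_pullback_ex[OF assms(1) M_arr[OF assms(2)] assms(3)] by blast
  define \<mu> where "\<mu> = (SOME \<nu>. \<nu> \<in> span_iso C `` {(a, b)})"
  have "is_span C (a, b)" using pullback_comm[OF ab] by (auto simp: comm_square_def is_span_def)
  from span_class_rep[OF this] have i: "((a, b), \<mu>) \<in> span_iso C" unfolding \<mu>_def .
  show thesis
  proof (rule that[of \<mu>])
    show "is_pullback C (fst \<mu>) (snd \<mu>) h k" using pullback_span_iso[OF i] ab by simp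
    show "(SOME \<nu>. \<nu> \<in> span_iso C `` {\<mu>}) = \<mu>"
      unfolding span_iso_class_eq[OF i, symmetric] by (rule \<mu>_def[symmetric])
  qed
qed

lemma right_induces_ex:
  assumes l: "linear_rule C M r2" "linear_rule C M r3" and i: "left_induces C M r2 r1 \<mu> \<nu> g1 d h x g y h3"
    and pc: "has_pushout_complement C (snd r3) h3"
  obtains \<mu>' \<kappa> where "right_induces C M r3 r2 \<mu>' \<kappa> g1 d h x g y h3"
    "(SOME \<nu>. \<nu> \<in> span_iso C `` {\<mu>'}) = \<mu>'" "(SOME \<nu>. \<nu> \<in> span_iso C `` {\<kappa>}) = \<kappa>"
proof -
  have l': "linear_rule C M (prod.swap r2)" "linear_rule C M (prod.swap r3)" using l by (simp_all add: linear_rule_swap)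
  obtain m2 m1 k n p q where ind: "induces C M r2 \<mu> m2 m1 k n p q \<nu> g1 d h x g y h3"
    using i unfolding left_induces_def by blast
  then have m: "middle_diagram C M r2 g1 d h x g y h3" by (simp add: induces_def)
  note t = middle_diagram_typing[OF l(1) m]
  obtain \<mu>' where \<mu>': "is_pullback C (fst \<mu>') (snd \<mu>') h3 g" "(SOME \<nu>. \<nu> \<in> span_iso C `` {\<mu>'}) = \<mu>'"
    using pullback_rep_ex[OF t(3,5,16)] .
  have pb: "is_pullback C (fst (prod.swap \<mu>')) (snd (prod.swap \<mu>')) g h3" using pullback_sym[OF \<mu>'(1)] by simp
  note mc = middle_composite[OF l' middle_diagram_reverse[OF l(1) m] _ pb]
  have o: "overlap_span C M r3 r2 \<mu>'" using mc(1) pc by (simp add: overlap_span_swap)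
  obtain m2' m1' k1' n1' k2' n2' p2' q2' p1' q1' u2' u1'
    where "composite_diagram C (prod.swap r2) (prod.swap r3) (prod.swap \<mu>') m2' m1' k1' n1' k2' n2' p2' q2' p1' q1' u2' u1'"
    using mc(2) pc by auto
  from composite_diagram_reverse[OF category_axioms this]
  have cd: "composite_diagram C r3 r2 \<mu>' m1' m2' k2' n2' k1' n1' p1' q1' p2' q2' u1' u2'" by simp
  \<comment> \<open>\<open>right_induces\<close> asks for the chosen diagram; the diagram already
    found certifies that the chosen complements are genuine.\<close>
  obtain a2 a1 b1 c1 b2 c2 s2 t2 s1 t1 w2 w1 where c: "chosen_diagram C r3 r2 \<mu>' a2 a1 b1 c1 b2 c2 s2 t2 s1 t1 w2 w1"
    by (rule chosen_diagram_ex)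
  have cd': "is_pushout C (fst \<mu>') (snd \<mu>') a2 a1" "is_pushout C (fst r2) b1 a1 c1" "is_pushout C (snd r2) b1 s1 t1"
    using composite_diagram_chosen(3)[OF l(2,1) o cd c] by (auto simp: composite_diagram_def)
  have "snd \<mu>' \<in> M" using o by (simp add: overlap_span_def)
  then obtain e' where e': "e' \<in> M" "Cod C e' = Cod C g1"
    "\<And>\<kappa>. is_pullback C (fst \<kappa>) (snd \<kappa>) g1 e' \<Longrightarrow> induces C M (prod.swap r2) (prod.swap \<mu>') a1 a2 b1 c1 s1 t1 \<kappa> h3 d g y h x g1"
    using induces_reverse[OF l(1) ind, of "prod.swap \<mu>'" a1 a2 b1 c1 s1 t1] pushout_sym[OF cd'(1)] cd' pb by (metis fst_swap snd_swap)
  obtain \<kappa> where \<kappa>: "is_pullback C (fst \<kappa>) (snd \<kappa>) e' g1" "(SOME \<nu>. \<nu> \<in> span_iso C `` {\<kappa>}) = \<kappa>"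
    using pullback_rep_ex[OF e'(1) t(1) e'(2)] .
  have "induces C M (prod.swap r2) (prod.swap \<mu>') a1 a2 b1 c1 s1 t1 (prod.swap \<kappa>) h3 d g y h x g1"
    using e'(3)[of "prod.swap \<kappa>"] pullback_sym[OF \<kappa>(1)] by simp
  then have "right_induces C M r3 r2 \<mu>' \<kappa> g1 d h x g y h3" unfolding right_induces_def using c by blast
  with that \<mu>' \<kappa> show thesis by blast
qed

lemma left_induces_ex:
  assumes l: "linear_rule C M r2" "linear_rule C M r1" and i: "right_induces C M r3 r2 \<mu>' \<kappa> g1 d h x g y h3"
    and pc: "has_pushout_complement C (fst r1) g1"
  obtains \<mu> \<nu> where "left_induces C M r2 r1 \<mu> \<nu> g1 d h x g y h3"
    "(SOME \<nu>. \<nu> \<in> span_iso C `` {\<mu>}) = \<mu>" "(SOME \<nu>'. \<nu>' \<in> span_iso C `` {\<nu>}) = \<nu>"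
proof -
  have l': "linear_rule C M (prod.swap r2)" using l by (simp add: linear_rule_swap)
  obtain m2 m1 k n p q where ind: "induces C M (prod.swap r2) (prod.swap \<mu>') m1 m2 k n p q (prod.swap \<kappa>) h3 d g y h x g1"
    using i unfolding right_induces_def by blast
  then have m': "middle_diagram C M (prod.swap r2) h3 d g y h x g1" by (simp add: induces_def)
  have m: "middle_diagram C M r2 g1 d h x g y h3" using middle_diagram_reverse[OF l' m'] by simp
  note t = middle_diagram_typing[OF l(1) m]
  obtain \<mu> where \<mu>: "is_pullback C (fst \<mu>) (snd \<mu>) h g1" "(SOME \<nu>. \<nu> \<in> span_iso C `` {\<mu>}) = \<mu>"
    using pullback_rep_ex[OF t(2,1) t(15)[symmetric]] .
  note mc = middle_composite[OF l m pc \<mu>(1)]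
  obtain m2' m1' k1' n1' k2' n2' p2' q2' p1' q1' u2' u1'
    where cd: "composite_diagram C r2 r1 \<mu> m2' m1' k1' n1' k2' n2' p2' q2' p1' q1' u2' u1'" using mc(2) by blast
  obtain a2 a1 b1 c1 b2 c2 s2 t2 s1 t1 w2 w1 where c: "chosen_diagram C r2 r1 \<mu> a2 a1 b1 c1 b2 c2 s2 t2 s1 t1 w2 w1"
    by (rule chosen_diagram_ex)
  have cd': "is_pushout C (fst \<mu>) (snd \<mu>) a2 a1" "is_pushout C (snd r2) b2 a2 c2" "is_pushout C (fst r2) b2 s2 t2"
    using composite_diagram_chosen(3)[OF l mc(1) cd c] by (auto simp: composite_diagram_def)
  have "fst \<mu> \<in> M" using mc(1) by (simp add: overlap_span_def)
  then obtain e where e: "e \<in> M" "Cod C e = Cod C h3"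
    "\<And>\<nu>. is_pullback C (fst \<nu>) (snd \<nu>) h3 e \<Longrightarrow> induces C M r2 \<mu> a2 a1 b2 c2 s2 t2 \<nu> g1 d h x g y h3"
    using induces_reverse[OF l' ind cd'(1) _ _ _ \<mu>(1), of b2 c2 s2 t2] cd' by (metis fst_swap snd_swap swap_swap)
  obtain \<nu> where \<nu>: "is_pullback C (fst \<nu>) (snd \<nu>) h3 e" "(SOME \<nu>'. \<nu>' \<in> span_iso C `` {\<nu>}) = \<nu>"
    using pullback_rep_ex[OF t(3) e(1) e(2)[symmetric]] .
  have "left_induces C M r2 r1 \<mu> \<nu> g1 d h x g y h3" unfolding left_induces_def using c e(3)[OF \<nu>(1)] by blast
  with that \<mu> \<nu> show thesis by blast
qed

text \<open>The left-hand spans determine the middle diagram up to isomorphism, and this determines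
  the first right-hand span. The second spans are compared only when the first ones are equal, since
  they refer to the chosen construction along \<open>\<mu>'\<close>.\<close>

lemma corresponding_spans_right_unique:
  assumes l: "linear_rule C M r2" and i: "corresponding_spans C M r3 r2 r1 \<mu> \<nu> \<mu>' \<kappa>" "corresponding_spans C M r3 r2 r1 \<mu> \<nu> \<mu>'' \<kappa>'"
  shows "(\<mu>', \<mu>'') \<in> span_iso C" "\<mu>' = \<mu>'' \<Longrightarrow> (\<kappa>, \<kappa>') \<in> span_iso C"
proof -
  have l': "linear_rule C M (prod.swap r2)" using l by (simp add: linear_rule_swap)
  obtain g1 d h x g y h3 where i1: "left_induces C M r2 r1 \<mu> \<nu> g1 d h x g y h3" "right_induces C M r3 r2 \<mu>' \<kappa> g1 d h x g y h3"
    using i(1) unfolding corresponding_spans_def by blast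
  obtain g1' d' h' x' g' y' h3' where i2: "left_induces C M r2 r1 \<mu> \<nu> g1' d' h' x' g' y' h3'" "right_induces C M r3 r2 \<mu>'' \<kappa>' g1' d' h' x' g' y' h3'"
    using i(2) unfolding corresponding_spans_def by blast
  have iso: "middle_iso C g1 d h x g y h3 g1' d' h' x' g' y' h3'"
    using i1(1) i2(1) induces_middle_iso[OF l] unfolding left_induces_def by (metis chosen_diagram_unique)
  note iso' = middle_iso_reverse[OF iso]
  show "(\<mu>', \<mu>'') \<in> span_iso C"
    using i1(2) i2(2) induces_first_unique[OF l' _ _ iso', of "prod.swap \<mu>'" _ _ _ _ _ _ _ "prod.swap \<mu>''"] span_iso_swap[of "prod.swap \<mu>'" "prod.swap \<mu>''"]
    unfolding right_induces_def by (metis swap_swap)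
  show "(\<kappa>, \<kappa>') \<in> span_iso C" if "\<mu>' = \<mu>''"
  proof -
    have "(prod.swap \<kappa>, prod.swap \<kappa>') \<in> span_iso C"
      using i1(2) i2(2) induces_second_unique[OF l' _ _ iso'] that unfolding right_induces_def by (metis chosen_diagram_unique)
    from span_iso_swap[OF this] show ?thesis by simp
  qed
qed

lemma corresponding_spans_left_unique:
  assumes l: "linear_rule C M r2" and i: "corresponding_spans C M r3 r2 r1 \<mu> \<nu> \<mu>' \<kappa>" "corresponding_spans C M r3 r2 r1 \<mu>'' \<nu>' \<mu>' \<kappa>"
  shows "(\<mu>, \<mu>'') \<in> span_iso C" "\<mu> = \<mu>'' \<Longrightarrow> (\<nu>, \<nu>') \<in> span_iso C"
proof -
  have l': "linear_rule C M (prod.swap r2)" using l by (simp add: linear_rule_swap)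
  obtain g1 d h x g y h3 where i1: "left_induces C M r2 r1 \<mu> \<nu> g1 d h x g y h3" "right_induces C M r3 r2 \<mu>' \<kappa> g1 d h x g y h3"
    using i(1) unfolding corresponding_spans_def by blast
  obtain g1' d' h' x' g' y' h3' where i2: "left_induces C M r2 r1 \<mu>'' \<nu>' g1' d' h' x' g' y' h3'" "right_induces C M r3 r2 \<mu>' \<kappa> g1' d' h' x' g' y' h3'"
    using i(2) unfolding corresponding_spans_def by blast
  have "middle_iso C h3 d g y h x g1 h3' d' g' y' h' x' g1'"
    using i1(2) i2(2) induces_middle_iso[OF l'] unfolding right_induces_def by (metis chosen_diagram_unique)
  note iso = middle_iso_reverse[OF this]
  show "(\<mu>, \<mu>'') \<in> span_iso C"
    using i1(1) i2(1) induces_first_unique[OF l _ _ iso] unfolding left_induces_def by metis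
  show "(\<nu>, \<nu>') \<in> span_iso C" if "\<mu> = \<mu>''"
    using i1(1) i2(1) induces_second_unique[OF l _ _ iso] that unfolding left_induces_def by (metis chosen_diagram_unique)
qed

lemma corresponding_spans_associative:
  assumes R: "linear_crule C M R1" "linear_crule C M R2" "linear_crule C M R3"
    and i: "corresponding_spans C M (fst R3) (fst R2) (fst R1) \<mu> \<nu> \<mu>' \<kappa>"
  shows "crule_iso C M (compose_along C M R3 \<nu> (compose_along C M R2 \<mu> R1)) (compose_along C M (compose_along C M R3 \<mu>' R2) \<kappa> R1)"
    and "linear_crule C M (compose_along C M R3 \<nu> (compose_along C M R2 \<mu> R1))"
    and "admissible_span C M R2 R1 \<mu> \<and> admissible_span C M R3 (compose_along C M R2 \<mu> R1) \<nu> \<longleftrightarrow>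
      admissible_span C M R3 R2 \<mu>' \<and> admissible_span C M (compose_along C M R3 \<mu>' R2) R1 \<kappa>"
proof -
  note l1 = linear_cruleD(1)[OF R(1)] and l2 = linear_cruleD(1)[OF R(2)] and l3 = linear_cruleD(1)[OF R(3)]
  have l2': "linear_rule C M (prod.swap (fst R2))" and l3': "linear_rule C M (prod.swap (fst R3))"
    using l2 l3 by (simp_all add: linear_rule_swap)
  define R21 where "R21 = compose_along C M R2 \<mu> R1"
  define R32 where "R32 = compose_along C M R3 \<mu>' R2"
  obtain g1 dd h x g y h3 where pc: "has_pushout_complement C (fst (fst R1)) g1" "has_pushout_complement C (snd (fst R3)) h3"
    and li: "left_induces C M (fst R2) (fst R1) \<mu> \<nu> g1 dd h x g y h3" and ri: "right_induces C M (fst R3) (fst R2) \<mu>' \<kappa> g1 dd h x g y h3"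
    using i unfolding corresponding_spans_def by blast
  obtain m2 m1 k1 n1 k2 n2 p2 q2 p1 q1 u2 u1 where c: "chosen_diagram C (fst R2) (fst R1) \<mu> m2 m1 k1 n1 k2 n2 p2 q2 p1 q1 u2 u1"
    and ind: "induces C M (fst R2) \<mu> m2 m1 k2 n2 p2 q2 \<nu> g1 dd h x g y h3" using li unfolding left_induces_def by blast
  obtain m2' m1' k1' n1' k2' n2' p2' q2' p1' q1' u2' u1' where c': "chosen_diagram C (fst R3) (fst R2) \<mu>' m2' m1' k1' n1' k2' n2' p2' q2' p1' q1' u2' u1'"
    and ind': "induces C M (prod.swap (fst R2)) (prod.swap \<mu>') m1' m2' k1' n1' p1' q1' (prod.swap \<kappa>) h3 dd g y h x g1"
    using ri unfolding right_induces_def by blast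
  obtain u f e where e: "embedding C M m2 m1 k2 n2 p2 q2 g1 dd h x g y u f e" "is_pullback C (fst \<nu>) (snd \<nu>) h3 e" "jointly_epic C h3 e"
    and m: "middle_diagram C M (fst R2) g1 dd h x g y h3" using ind unfolding induces_def by blast
  obtain v f' e' where e': "embedding C M m1' m2' k1' n1' p1' q1' h3 dd g y h x v f' e'" "is_pullback C (fst (prod.swap \<kappa>)) (snd (prod.swap \<kappa>)) g1 e'" "jointly_epic C g1 e'"
    using ind' unfolding induces_def by blast
  have pk: "is_pullback C (fst \<kappa>) (snd \<kappa>) e' g1" using pullback_sym[OF e'(2)] by simp
  note mc = middle_composite[OF l2 l1 m pc(1) induces_span_pullback[OF l2 ind]]
  note mc' = middle_composite[OF l2' l3' middle_diagram_reverse[OF l2 m] _ induces_span_pullback[OF l2' ind']]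
  have o: "overlap_span C M (fst R2) (fst R1) \<mu>" by (fact mc(1))
  have o': "overlap_span C M (fst R3) (fst R2) \<mu>'" using mc'(1) pc by (simp add: overlap_span_swap)
  have d: "composite_diagram C (fst R2) (fst R1) \<mu> m2 m1 k1 n1 k2 n2 p2 q2 p1 q1 u2 u1"
    using mc(2) composite_diagram_chosen(3)[OF l2 l1 o _ c] by blast
  obtain a2 a1 b1 c1 b2 c2 s2 t2 s1 t1 w2 w1
    where "composite_diagram C (prod.swap (fst R2)) (prod.swap (fst R3)) (prod.swap \<mu>') a2 a1 b1 c1 b2 c2 s2 t2 s1 t1 w2 w1"
    using mc'(2) pc by auto
  from composite_diagram_reverse[OF category_axioms this]
  have "composite_diagram C (fst R3) (fst R2) \<mu>' a1 a2 b2 c2 b1 c1 s1 t1 s2 t2 w1 w2" by simp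
  from composite_diagram_chosen(3)[OF l3 l2 o' this c']
  have d': "composite_diagram C (fst R3) (fst R2) \<mu>' m2' m1' k1' n1' k2' n2' p2' q2' p1' q1' u2' u1'" .
  have R21: "R21 = composite_crule C M (snd R2) (snd R1) m2 n1 q2 p1 q1 u2 u1"
    unfolding R21_def using compose_along_chosen[OF c] .
  have R32: "R32 = composite_crule C M (snd R3) (snd R2) m2' n1' q2' p1' q1' u2' u1'"
    unfolding R32_def using compose_along_chosen[OF c'] .
  note ca = composite_associative[OF R o d R21 o' d' R32 m e(1) e'(1) e(2,3) pk e'(3) pc]
  have L21: "linear_crule C M R21" "linear_crule C M R32"
    unfolding R21_def R32_def using compose_along_iso(2)[OF R(2,1) o d] compose_along_iso(2)[OF R(3,2) o' d'] .
  obtain K1 N1 K2 N2 P2 Q2 P1 Q1 U2 U1 where dA: "composite_diagram C (fst R3) (fst R21) \<nu> h3 e K1 N1 K2 N2 P2 Q2 P1 Q1 U2 U1"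
    using ca(3) by blast
  obtain K1' N1' K2' N2' P2' Q2' P1' Q1' U2' U1' where dB: "composite_diagram C (fst R32) (fst R1) \<kappa> e' g1 K1' N1' K2' N2' P2' Q2' P1' Q1' U2' U1'"
    using ca(4) by blast
  show i: "crule_iso C M (compose_along C M R3 \<nu> (compose_along C M R2 \<mu> R1)) (compose_along C M (compose_along C M R3 \<mu>' R2) \<kappa> R1)"
    and L: "linear_crule C M (compose_along C M R3 \<nu> (compose_along C M R2 \<mu> R1))"
    using ca(5,6) unfolding R21_def R32_def by auto
  have LB: "linear_crule C M (compose_along C M R32 \<kappa> R1)" using compose_along_iso(2)[OF L21(2) R(1) ca(2) dB] .
  let ?nf = "\<lambda>R. \<not> cond_equiv C M (rule_input C (fst R)) (snd R) CFalse"
  have "?nf (compose_along C M R3 \<nu> R21) \<longleftrightarrow> ?nf (compose_along C M R32 \<kappa> R1)"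
    using crule_iso_not_false[OF ca(5)] crule_iso_not_false[OF crule_iso_sym[OF ca(5) linear_cruleD(1)[OF ca(6)] linear_cruleD(1)[OF LB]]] by blast
  \<comment> \<open>Composition diagrams for all four spans are at hand, so only satisfiability is
    at stake, and that of the final condition forces that of the intermediate one.\<close>
  moreover have "admissible_span C M R2 R1 \<mu> \<and> admissible_span C M R3 R21 \<nu> \<longleftrightarrow> ?nf (compose_along C M R3 \<nu> R21)"
    using admissible_spanI[OF R(2,1) o d] admissible_spanI[OF R(3) L21(1) ca(1) dA] admissible_spanE[OF R(3) L21(1)]
      composite_condition_not_false(2)[OF R(3) L21(1) ca(1) dA] unfolding R21_def by metis
  moreover have "admissible_span C M R3 R2 \<mu>' \<and> admissible_span C M R32 R1 \<kappa> \<longleftrightarrow> ?nf (compose_along C M R32 \<kappa> R1)"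
    using admissible_spanI[OF R(3,2) o' d'] admissible_spanI[OF L21(2) R(1) ca(2) dB] admissible_spanE[OF L21(2) R(1)]
      composite_condition_not_false(1)[OF L21(2) R(1) ca(2) dB] unfolding R32_def by metis
  ultimately show "admissible_span C M R2 R1 \<mu> \<and> admissible_span C M R3 (compose_along C M R2 \<mu> R1) \<nu> \<longleftrightarrow>
      admissible_span C M R3 R2 \<mu>' \<and> admissible_span C M (compose_along C M R3 \<mu>' R2) R1 \<kappa>"
    unfolding R21_def R32_def by blast
qed

lemma corresponding_spans_right_ex:
  assumes R: "linear_crule C M R1" "linear_crule C M R2" "linear_crule C M R3"
    and a: "admissible_span C M R2 R1 \<mu>" "admissible_span C M R3 (compose_along C M R2 \<mu> R1) \<nu>"
  obtains \<mu>' \<kappa> where "corresponding_spans C M (fst R3) (fst R2) (fst R1) \<mu> \<nu> \<mu>' \<kappa>"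
    "(SOME \<nu>. \<nu> \<in> span_iso C `` {\<mu>'}) = \<mu>'" "(SOME \<nu>. \<nu> \<in> span_iso C `` {\<kappa>}) = \<kappa>"
proof -
  note l1 = linear_cruleD(1)[OF R(1)] and l2 = linear_cruleD(1)[OF R(2)] and l3 = linear_cruleD(1)[OF R(3)]
  obtain m2 m1 k1 n1 k2 n2 p2 q2 p1 q1 u2 u1 where o: "overlap_span C M (fst R2) (fst R1) \<mu>"
    and c: "chosen_diagram C (fst R2) (fst R1) \<mu> m2 m1 k1 n1 k2 n2 p2 q2 p1 q1 u2 u1"
    and d: "composite_diagram C (fst R2) (fst R1) \<mu> m2 m1 k1 n1 k2 n2 p2 q2 p1 q1 u2 u1"
    and e: "compose_along C M R2 \<mu> R1 = composite_crule C M (snd R2) (snd R1) m2 n1 q2 p1 q1 u2 u1"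
    and L: "linear_crule C M (compose_along C M R2 \<mu> R1)"
    using admissible_spanE[OF R(2,1) a(1)] by metis
  obtain h3 e0 K1 N1 K2 N2 P2 Q2 P1 Q1 U2 U1 where o': "overlap_span C M (fst R3) (fst (compose_along C M R2 \<mu> R1)) \<nu>"
    and d': "composite_diagram C (fst R3) (fst (compose_along C M R2 \<mu> R1)) \<nu> h3 e0 K1 N1 K2 N2 P2 Q2 P1 Q1 U2 U1"
    using admissible_spanE[OF R(3) L a(2)] by metis
  have p: "is_pushout C (fst \<nu>) (snd \<nu>) h3 e0" "is_pushout C (q2 \<odot> u2) K1 e0 N1" "is_pushout C (snd (fst R3)) K2 h3 N2"
    using d' e by (auto simp: composite_diagram_def composite_crule_def)
  have pc3: "has_pushout_complement C (snd (fst R3)) h3" "has_pushout_complement C (q2 \<odot> u2) e0"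
    using p unfolding has_pushout_complement_def by blast+
  have \<nu>: "fst \<nu> \<in> M" "snd \<nu> \<in> M" using o' by (auto simp: overlap_span_def)
  obtain g1 dd h x g y where i: "induces C M (fst R2) \<mu> m2 m1 k2 n2 p2 q2 \<nu> g1 dd h x g y h3" "has_pushout_complement C (fst (fst R1)) g1"
    using induces_of_composite[OF l2 l1 o d p(1) \<nu> pc3(2)] by metis
  have li: "left_induces C M (fst R2) (fst R1) \<mu> \<nu> g1 dd h x g y h3" unfolding left_induces_def using c i by blast
  obtain \<mu>' \<kappa> where "right_induces C M (fst R3) (fst R2) \<mu>' \<kappa> g1 dd h x g y h3"
    "(SOME \<nu>. \<nu> \<in> span_iso C `` {\<mu>'}) = \<mu>'" "(SOME \<nu>. \<nu> \<in> span_iso C `` {\<kappa>}) = \<kappa>"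
    using right_induces_ex[OF l2 l3 li pc3(1)] .
  with that li i(2) pc3(1) show thesis unfolding corresponding_spans_def by blast
qed

lemma corresponding_spans_left_ex:
  assumes R: "linear_crule C M R1" "linear_crule C M R2" "linear_crule C M R3"
    and a: "admissible_span C M R3 R2 \<mu>'" "admissible_span C M (compose_along C M R3 \<mu>' R2) R1 \<kappa>"
  obtains \<mu> \<nu> where "corresponding_spans C M (fst R3) (fst R2) (fst R1) \<mu> \<nu> \<mu>' \<kappa>"
    "(SOME \<nu>. \<nu> \<in> span_iso C `` {\<mu>}) = \<mu>" "(SOME \<nu>'. \<nu>' \<in> span_iso C `` {\<nu>}) = \<nu>"
proof -
  note l1 = linear_cruleD(1)[OF R(1)] and l2 = linear_cruleD(1)[OF R(2)] and l3 = linear_cruleD(1)[OF R(3)]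
  have l2': "linear_rule C M (prod.swap (fst R2))" and l3': "linear_rule C M (prod.swap (fst R3))"
    using l2 l3 by (simp_all add: linear_rule_swap)
  obtain m2 m1 k1 n1 k2 n2 p2 q2 p1 q1 u2 u1 where o: "overlap_span C M (fst R3) (fst R2) \<mu>'"
    and c: "chosen_diagram C (fst R3) (fst R2) \<mu>' m2 m1 k1 n1 k2 n2 p2 q2 p1 q1 u2 u1"
    and d: "composite_diagram C (fst R3) (fst R2) \<mu>' m2 m1 k1 n1 k2 n2 p2 q2 p1 q1 u2 u1"
    and e: "compose_along C M R3 \<mu>' R2 = composite_crule C M (snd R3) (snd R2) m2 n1 q2 p1 q1 u2 u1"
    and L: "linear_crule C M (compose_along C M R3 \<mu>' R2)"
    using admissible_spanE[OF R(3,2) a(1)] by metis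
  obtain e0 g1 K1 N1 K2 N2 P2 Q2 P1 Q1 U2 U1 where o': "overlap_span C M (fst (compose_along C M R3 \<mu>' R2)) (fst R1) \<kappa>"
    and d': "composite_diagram C (fst (compose_along C M R3 \<mu>' R2)) (fst R1) \<kappa> e0 g1 K1 N1 K2 N2 P2 Q2 P1 Q1 U2 U1"
    using admissible_spanE[OF L R(1) a(2)] by metis
  have p: "is_pushout C (fst \<kappa>) (snd \<kappa>) e0 g1" "is_pushout C (q1 \<odot> u1) K2 e0 N2" "is_pushout C (fst (fst R1)) K1 g1 N1"
    using d' e by (auto simp: composite_diagram_def composite_crule_def)
  have pc: "has_pushout_complement C (fst (fst R1)) g1" "has_pushout_complement C (q1 \<odot> u1) e0"
    using p unfolding has_pushout_complement_def by blast+
  have \<kappa>: "fst (prod.swap \<kappa>) \<in> M" "snd (prod.swap \<kappa>) \<in> M" using o' by (auto simp: overlap_span_def)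
  have ps: "is_pushout C (fst (prod.swap \<kappa>)) (snd (prod.swap \<kappa>)) g1 e0" using pushout_sym[OF p(1)] by simp
  have os: "overlap_span C M (prod.swap (fst R2)) (prod.swap (fst R3)) (prod.swap \<mu>')" using o by (simp add: overlap_span_swap)
  obtain h3 dd g y h x where i: "induces C M (prod.swap (fst R2)) (prod.swap \<mu>') m1 m2 k1 n1 p1 q1 (prod.swap \<kappa>) h3 dd g y h x g1"
    "has_pushout_complement C (fst (prod.swap (fst R3))) h3"
    using induces_of_composite[OF l2' l3' os composite_diagram_reverse[OF category_axioms d] ps \<kappa> pc(2)] by metis
  have ri: "right_induces C M (fst R3) (fst R2) \<mu>' \<kappa> g1 dd h x g y h3" unfolding right_induces_def using c i by blast
  obtain \<mu> \<nu> where "left_induces C M (fst R2) (fst R1) \<mu> \<nu> g1 dd h x g y h3"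
    "(SOME \<nu>. \<nu> \<in> span_iso C `` {\<mu>}) = \<mu>" "(SOME \<nu>'. \<nu>' \<in> span_iso C `` {\<nu>}) = \<nu>"
    using left_induces_ex[OF l2 l1 ri pc(1)] .
  with that ri i(2) pc(1) show thesis unfolding corresponding_spans_def by fastforce
qed

end

text \<open>Keeping the correspondence relational lets both directions be treated alike. Choosing
  partners gives the map; uniqueness of left partners makes it injective, and existence of left
  partners with uniqueness of right partners makes it surjective.\<close>

lemma bij_betw_of_relation:
  assumes "\<And>a. a \<in> A \<Longrightarrow> \<exists>b\<in>B. \<rho> a b" "\<And>b. b \<in> B \<Longrightarrow> \<exists>a\<in>A. \<rho> a b"
    and "\<And>a b b'. \<lbrakk>a \<in> A; b \<in> B; b' \<in> B; \<rho> a b; \<rho> a b'\<rbrakk> \<Longrightarrow> b = b'"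
    and "\<And>a a' b. \<lbrakk>a \<in> A; a' \<in> A; b \<in> B; \<rho> a b; \<rho> a' b\<rbrakk> \<Longrightarrow> a = a'"
  shows "\<exists>\<Phi>. bij_betw \<Phi> A B \<and> (\<forall>a\<in>A. \<rho> a (\<Phi> a))"
proof -
  obtain \<Phi> where \<Phi>: "\<And>a. a \<in> A \<Longrightarrow> \<Phi> a \<in> B \<and> \<rho> a (\<Phi> a)" using assms(1) by metis
  have "inj_on \<Phi> A" using \<Phi> assms(4) by (metis inj_onI)
  moreover have "\<Phi> ` A = B" using \<Phi> assms(2,3) by blast
  ultimately show ?thesis using \<Phi> unfolding bij_betw_def by blast
qed

theorem theorem4p16:
  fixes C :: "('o, 'm) category" and M :: "'m set" and R\<^sub>1 R\<^sub>2 R\<^sub>3 :: "'m crule"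
  assumes "rewriting_category C M"
    and "linear_crule C M R\<^sub>1" and "linear_crule C M R\<^sub>2" and "linear_crule C M R\<^sub>3"
  shows "\<exists>\<Phi>. bij_betw \<Phi>
      (SIGMA \<mu>21 : matches C M R\<^sub>2 R\<^sub>1. matches C M R\<^sub>3 (composite C M R\<^sub>2 \<mu>21 R\<^sub>1))
      (SIGMA \<mu>32 : matches C M R\<^sub>3 R\<^sub>2. matches C M (composite C M R\<^sub>3 \<mu>32 R\<^sub>2) R\<^sub>1) \<and>
    (\<forall>\<mu>21 \<in> matches C M R\<^sub>2 R\<^sub>1. \<forall>\<mu>321 \<in> matches C M R\<^sub>3 (composite C M R\<^sub>2 \<mu>21 R\<^sub>1).
      \<forall>\<mu>32 \<nu>321. \<Phi> (\<mu>21, \<mu>321) = (\<mu>32, \<nu>321) \<longrightarrow>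
        crule_equiv C M
          (composite C M R\<^sub>3 \<mu>321 (composite C M R\<^sub>2 \<mu>21 R\<^sub>1))
          (composite C M (composite C M R\<^sub>3 \<mu>32 R\<^sub>2) \<nu>321 R\<^sub>1))"
proof -
  interpret rewriting_category C M by fact
  note R = assms(2-4)
  note l2 = linear_cruleD(1)[OF R(2)]
  define rep :: "'m span set \<Rightarrow> 'm span" where "rep X = (SOME \<mu>. \<mu> \<in> X)" for X
  define cl where "cl \<mu> = span_iso C `` {\<mu>}" for \<mu>
  define A where "A = (SIGMA \<mu>21 : matches C M R\<^sub>2 R\<^sub>1. matches C M R\<^sub>3 (composite C M R\<^sub>2 \<mu>21 R\<^sub>1))"
  define B where "B = (SIGMA \<mu>32 : matches C M R\<^sub>3 R\<^sub>2. matches C M (composite C M R\<^sub>3 \<mu>32 R\<^sub>2) R\<^sub>1)"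
  \<comment> \<open>Classes are related through their chosen representatives, the spans along which
    \<open>composite\<close> is actually formed.\<close>
  define \<rho> where "\<rho> a b \<longleftrightarrow>
    corresponding_spans C M (fst R\<^sub>3) (fst R\<^sub>2) (fst R\<^sub>1) (rep (fst a)) (rep (snd a)) (rep (fst b)) (rep (snd b))" for a b
  have comp: "composite C M R X R' = compose_along C M R (rep X) R'" for R X R'
    unfolding composite_def rep_def ..
  have L: "linear_crule C M (compose_along C M R \<mu> R')"
    if "linear_crule C M R" "linear_crule C M R'" "admissible_span C M R R' \<mu>" for R R' \<mu>
    using admissible_spanE[OF that] by metis
  have mem: "admissible_span C M R R' (rep X)" "cl (rep X) = X"
    if "linear_crule C M R" "linear_crule C M R'" "X \<in> matches C M R R'" for R R' X
    using matches_rep[OF that] unfolding rep_def cl_def by auto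
  have A: "admissible_span C M R\<^sub>2 R\<^sub>1 (rep (fst a))" "cl (rep (fst a)) = fst a"
    "admissible_span C M R\<^sub>3 (compose_along C M R\<^sub>2 (rep (fst a)) R\<^sub>1) (rep (snd a))" "cl (rep (snd a)) = snd a"
    if "a \<in> A" for a
  proof -
    have a: "fst a \<in> matches C M R\<^sub>2 R\<^sub>1" "snd a \<in> matches C M R\<^sub>3 (compose_along C M R\<^sub>2 (rep (fst a)) R\<^sub>1)"
      using that unfolding A_def comp by auto
    note 1 = mem[OF R(2,1) a(1)]
    show "admissible_span C M R\<^sub>2 R\<^sub>1 (rep (fst a))" "cl (rep (fst a)) = fst a"
      "admissible_span C M R\<^sub>3 (compose_along C M R\<^sub>2 (rep (fst a)) R\<^sub>1) (rep (snd a))" "cl (rep (snd a)) = snd a"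
      using 1 mem[OF R(3) L[OF R(2,1) 1(1)] a(2)] by auto
  qed
  have B: "admissible_span C M R\<^sub>3 R\<^sub>2 (rep (fst b))" "cl (rep (fst b)) = fst b"
    "admissible_span C M (compose_along C M R\<^sub>3 (rep (fst b)) R\<^sub>2) R\<^sub>1 (rep (snd b))" "cl (rep (snd b)) = snd b"
    if "b \<in> B" for b
  proof -
    have b: "fst b \<in> matches C M R\<^sub>3 R\<^sub>2" "snd b \<in> matches C M (compose_along C M R\<^sub>3 (rep (fst b)) R\<^sub>2) R\<^sub>1"
      using that unfolding B_def comp by auto
    note 1 = mem[OF R(3,2) b(1)]
    show "admissible_span C M R\<^sub>3 R\<^sub>2 (rep (fst b))" "cl (rep (fst b)) = fst b"
      "admissible_span C M (compose_along C M R\<^sub>3 (rep (fst b)) R\<^sub>2) R\<^sub>1 (rep (snd b))" "cl (rep (snd b)) = snd b"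
      using 1 mem[OF L[OF R(3,2) 1(1)] R(1) b(2)] by auto
  qed
  have "\<exists>\<Phi>. bij_betw \<Phi> A B \<and> (\<forall>a\<in>A. \<rho> a (\<Phi> a))"
  proof (rule bij_betw_of_relation)
    fix a assume a: "a \<in> A"
    obtain \<mu>' \<kappa> where c: "corresponding_spans C M (fst R\<^sub>3) (fst R\<^sub>2) (fst R\<^sub>1) (rep (fst a)) (rep (snd a)) \<mu>' \<kappa>"
      and r: "rep (cl \<mu>') = \<mu>'" "rep (cl \<kappa>) = \<kappa>"
      using corresponding_spans_right_ex[OF R A(1,3)[OF a]] unfolding rep_def cl_def by metis
    have "admissible_span C M R\<^sub>3 R\<^sub>2 \<mu>'" "admissible_span C M (compose_along C M R\<^sub>3 \<mu>' R\<^sub>2) R\<^sub>1 \<kappa>"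
      using corresponding_spans_associative(3)[OF R c] A(1,3)[OF a] by auto
    \<comment> \<open>Membership of the second class refers to the composite along the
      representative of \<open>cl \<mu>'\<close>, which is \<open>\<mu>'\<close> itself by
      \<open>r\<close>.\<close>
    then have "(cl \<mu>', cl \<kappa>) \<in> B" unfolding B_def comp using r matches_class by (simp add: cl_def)
    then show "\<exists>b\<in>B. \<rho> a b" using c r unfolding \<rho>_def by force
  next
    fix b assume b: "b \<in> B"
    obtain \<mu> \<nu> where c: "corresponding_spans C M (fst R\<^sub>3) (fst R\<^sub>2) (fst R\<^sub>1) \<mu> \<nu> (rep (fst b)) (rep (snd b))"
      and r: "rep (cl \<mu>) = \<mu>" "rep (cl \<nu>) = \<nu>"
      using corresponding_spans_left_ex[OF R B(1,3)[OF b]] unfolding rep_def cl_def by metis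
    have "admissible_span C M R\<^sub>2 R\<^sub>1 \<mu>" "admissible_span C M R\<^sub>3 (compose_along C M R\<^sub>2 \<mu> R\<^sub>1) \<nu>"
      using corresponding_spans_associative(3)[OF R c] B(1,3)[OF b] by auto
    then have "(cl \<mu>, cl \<nu>) \<in> A" unfolding A_def comp using r matches_class by (simp add: cl_def)
    then show "\<exists>a\<in>A. \<rho> a b" using c r unfolding \<rho>_def by force
  next
    fix a b b' assume "a \<in> A" and b: "b \<in> B" "b' \<in> B" and \<rho>: "\<rho> a b" "\<rho> a b'"
    note u = corresponding_spans_right_unique[OF l2 \<rho>[unfolded \<rho>_def]]
    \<comment> \<open>The first classes are identified first, because the comparison of second spans
      in \<open>u(2)\<close> presupposes equal first representatives.\<close>
    have 1: "fst b = fst b'" using span_iso_class_eq[OF u(1)] B(2) b unfolding cl_def by metis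
    have "snd b = snd b'" using span_iso_class_eq[OF u(2)] 1 B(4) b unfolding cl_def by metis
    with 1 show "b = b'" by (rule prod_eqI)
  next
    fix a a' b assume a: "a \<in> A" "a' \<in> A" and "b \<in> B" and \<rho>: "\<rho> a b" "\<rho> a' b"
    note u = corresponding_spans_left_unique[OF l2 \<rho>[unfolded \<rho>_def]]
    have 1: "fst a = fst a'" using span_iso_class_eq[OF u(1)] A(2) a unfolding cl_def by metis
    have "snd a = snd a'" using span_iso_class_eq[OF u(2)] 1 A(4) a unfolding cl_def by metis
    with 1 show "a = a'" by (rule prod_eqI)
  qed
  then obtain \<Phi> where \<Phi>: "bij_betw \<Phi> A B" "\<And>a. a \<in> A \<Longrightarrow> \<rho> a (\<Phi> a)" by blast
  have "crule_equiv C M (composite C M R\<^sub>3 \<mu>321 (composite C M R\<^sub>2 \<mu>21 R\<^sub>1)) (composite C M (composite C M R\<^sub>3 \<mu>32 R\<^sub>2) \<nu>321 R\<^sub>1)"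
    if "\<mu>21 \<in> matches C M R\<^sub>2 R\<^sub>1" "\<mu>321 \<in> matches C M R\<^sub>3 (composite C M R\<^sub>2 \<mu>21 R\<^sub>1)" "\<Phi> (\<mu>21, \<mu>321) = (\<mu>32, \<nu>321)"
    for \<mu>21 \<mu>321 \<mu>32 \<nu>321
  proof -
    have "\<rho> (\<mu>21, \<mu>321) (\<mu>32, \<nu>321)" using \<Phi>(2)[of "(\<mu>21, \<mu>321)"] that unfolding A_def by simp
    from corresponding_spans_associative(1,2)[OF R this[unfolded \<rho>_def fst_conv snd_conv]]
    show ?thesis unfolding comp by (rule crule_iso_imp_equiv)
  qed
  with \<Phi>(1) show ?thesis unfolding A_def B_def by blast
qed


end
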